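(* Any simplicial $3$-sphere with a $3$-complicated $3$-edge knot in its $1$-skeleton is not LC (locally constructible). More generally, a simplicial $3$-sphere with an $m$-gonal knot (a knot formed by a closed path of $m$ edges in its $1$-skeleton) cannot be LC if the knot is at least $m$-complicated.
   Context: All complexes are finite. A simplicial $3$-sphere is a simplicial complex whose underlying space is homeomorphic to the $3$-sphere. A knot is $m$-complicated if the fundamental group of its complement in the $3$-sphere has a presentation with $m+1$ generators, but no presentation with $m$ generators; "at least $m$-complicated" means $k$-complicated for some $k\ge m$. LC: A regular CW complex is simplicial if every lower interval $[0,F]$ in its face poset is boolean. A $d$-pseudomanifold is a finite, pure $d$-dimensional, simplicial regular CW complex in which each $(d-1)$-cell belongs to at most two $d$-cells; its boundary is the smallest subcomplex containing all $(d-1)$-cells that lie in exactly one $d$-cell. For $d\ge2$, a local construction for a pure $d$-dimensional simplicial complex $C$ with $N$ facets is a sequence $T_1,\dots,T_N,\dots,T_k$ ($k\ge N$) of $d$-pseudomanifolds such that: (1) $T_1$ is a $d$-simplex; (2) for $i\le N-1$, $T_{i+1}$ is obtained from $T_i$ by gluing a new $d$-simplex to $T_i$ along one of the $(d-1)$-cells of $\partial T_i$; (3) for $i\ge N$, $T_{i+1}$ is obtained from $T_i$ by identifying a pair of $(d-1)$-cells $\sigma,\tau$ in $\partial T_i$ whose intersection contains a $(d-2)$-cell $F$ (the identification being the simplicial one that fixes $F$ pointwise); (4) $T_k=C$. $C$ is LC if a local construction for $C$ exists. *)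

theory Defs
  imports "HOL-Analysis.Analysis" "HOL-Algebra.Coset"
begin

section \<open>Finite regular CW complexes\<close>

text \<open>The closed unit ball, open unit ball and unit sphere of the library's
  \<^term>\<open>Euclidean_space n\<close>; for \<open>n = 0\<close> these are a point, that point, and the empty set.\<close>

definition closed_ball_top :: "nat \<Rightarrow> (nat \<Rightarrow> real) topology" where
  "closed_ball_top n = subtopology (Euclidean_space n) {x. (\<Sum>i<n. (x i)\<^sup>2) \<le> 1}"

definition open_ball_set :: "nat \<Rightarrow> (nat \<Rightarrow> real) set" where
  "open_ball_set n = {x \<in> topspace (Euclidean_space n). (\<Sum>i<n. (x i)\<^sup>2) < 1}"

definition bounding_sphere :: "nat \<Rightarrow> (nat \<Rightarrow> real) set" where
  "bounding_sphere n = {x \<in> topspace (Euclidean_space n). (\<Sum>i<n. (x i)\<^sup>2) = 1}"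

text \<open>A cell complex is a space together with its open cells, listed by dimension;
  the closed cell belonging to an open cell is its closure.\<close>

record 'a cell_complex =
  carrier_space :: "'a topology"
  ncells :: "nat \<Rightarrow> 'a set set"

definition cells :: "'a cell_complex \<Rightarrow> 'a set set" where
  "cells T = (\<Union>n. ncells T n)"

definition closed_cell :: "'a cell_complex \<Rightarrow> 'a set \<Rightarrow> 'a set" where
  "closed_cell T c = carrier_space T closure_of c"

text \<open>Regularity: the characteristic maps are embeddings of closed balls.  Closure-finiteness
  and the weak topology are automatic for finite complexes.\<close>

definition finite_regular_CW :: "'a cell_complex \<Rightarrow> bool" where
  "finite_regular_CW T \<longleftrightarrow>
     Hausdorff_space (carrier_space T) \<and>
     finite (cells T) \<and>
     \<Union>(cells T) = topspace (carrier_space T) \<and>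
     (\<forall>m n. \<forall>c \<in> ncells T m. \<forall>e \<in> ncells T n. (m, c) \<noteq> (n, e) \<longrightarrow> c \<inter> e = {}) \<and>
     (\<forall>n. \<forall>c \<in> ncells T n. \<exists>f.
        embedding_map (closed_ball_top n) (carrier_space T) f \<and>
        f ` open_ball_set n = c \<and>
        f ` bounding_sphere n \<subseteq> (\<Union>k<n. \<Union>(ncells T k)))"

text \<open>The face poset has the empty set as its bottom element \<open>0\<close>.\<close>

definition face_poset :: "'a cell_complex \<Rightarrow> 'a set set" where
  "face_poset T = insert {} (cells T)"

definition face_le :: "'a cell_complex \<Rightarrow> 'a set \<Rightarrow> 'a set \<Rightarrow> bool" where
  "face_le T c e \<longleftrightarrow> c \<subseteq> closed_cell T e"

definition lower_interval :: "'a cell_complex \<Rightarrow> 'a set \<Rightarrow> 'a set set" where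
  "lower_interval T e = {c \<in> face_poset T. face_le T c e}"

definition boolean_interval :: "'a cell_complex \<Rightarrow> 'a set \<Rightarrow> bool" where
  "boolean_interval T e \<longleftrightarrow>
     (\<exists>(V :: nat set) h. finite V \<and> bij_betw h (lower_interval T e) (Pow V) \<and>
        (\<forall>a \<in> lower_interval T e. \<forall>b \<in> lower_interval T e. face_le T a b \<longleftrightarrow> h a \<subseteq> h b))"

definition simplicial_CW :: "'a cell_complex \<Rightarrow> bool" where
  "simplicial_CW T \<longleftrightarrow> finite_regular_CW T \<and> (\<forall>e \<in> face_poset T. boolean_interval T e)"

definition subcomplex :: "'a cell_complex \<Rightarrow> 'a set set \<Rightarrow> bool" where
  "subcomplex T S \<longleftrightarrow>
     S \<subseteq> cells T \<and> (\<forall>e \<in> S. \<forall>c \<in> cells T. face_le T c e \<longrightarrow> c \<in> S)"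


section \<open>Pseudomanifolds\<close>

definition pure_dim :: "nat \<Rightarrow> 'a cell_complex \<Rightarrow> bool" where
  "pure_dim d T \<longleftrightarrow>
     ncells T d \<noteq> {} \<and> (\<forall>c \<in> cells T. \<exists>D \<in> ncells T d. face_le T c D)"

text \<open>In the following definitions, a \<open>(d-1)\<close>-cell ``belongs to'' a \<open>d\<close>-cell if it is a face of
  it.  They are used for \<open>d \<ge> 2\<close> only, so that \<open>d - 1\<close> and \<open>d - 2\<close> do not truncate.\<close>

definition cofacets :: "nat \<Rightarrow> 'a cell_complex \<Rightarrow> 'a set \<Rightarrow> 'a set set" where
  "cofacets d T s = {D \<in> ncells T d. face_le T s D}"

definition pseudomanifold :: "nat \<Rightarrow> 'a cell_complex \<Rightarrow> bool" where
  "pseudomanifold d T \<longleftrightarrow>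
     simplicial_CW T \<and> pure_dim d T \<and> (\<forall>s \<in> ncells T (d - 1). card (cofacets d T s) \<le> 2)"

definition boundary_cells :: "nat \<Rightarrow> 'a cell_complex \<Rightarrow> 'a set set" where
  "boundary_cells d T =
     \<Inter>{S. subcomplex T S \<and> {s \<in> ncells T (d - 1). card (cofacets d T s) = 1} \<subseteq> S}"


section \<open>Local constructions\<close>

definition is_simplex_complex :: "nat \<Rightarrow> 'a cell_complex \<Rightarrow> bool" where
  "is_simplex_complex d T \<longleftrightarrow>
     pseudomanifold d T \<and> (\<exists>D \<in> ncells T d. closed_cell T D = topspace (carrier_space T))"

text \<open>\<open>T'\<close> is the union of a copy \<open>j(T)\<close> of \<open>T\<close> and of one new closed \<open>d\<close>-cell, and the two
  meet exactly in the copy of the closed boundary cell \<open>s\<close>.  The new closed \<open>d\<close>-cell is a simplex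
  because every complex in a local construction is simplicial.\<close>

definition glue_simplex_step :: "nat \<Rightarrow> 'a cell_complex \<Rightarrow> 'b cell_complex \<Rightarrow> bool" where
  "glue_simplex_step d T T' \<longleftrightarrow>
     (\<exists>s D j.
        s \<in> ncells T (d - 1) \<inter> boundary_cells d T \<and>
        D \<in> ncells T' d \<and>
        embedding_map (carrier_space T) (carrier_space T') j \<and>
        (\<forall>n. \<forall>c \<in> ncells T n. j ` c \<in> ncells T' n) \<and>
        topspace (carrier_space T') = j ` topspace (carrier_space T) \<union> closed_cell T' D \<and>
        j ` topspace (carrier_space T) \<inter> closed_cell T' D = j ` closed_cell T s)"

text \<open>The simplicial identification of the closed cells \<open>s\<close> and \<open>t\<close> is a homeomorphism \<open>\<phi>\<close>
  that carries faces of \<open>s\<close> to faces of \<open>t\<close> and fixes the common face \<open>F\<close> pointwise; on faces it is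
  uniquely determined by \<open>F\<close>.  The closed cells \<open>s\<close> and \<open>t\<close> may meet in more than \<open>F\<close>; injectivity
  of the quotient map \<open>q\<close> on open cells then makes \<open>\<phi>\<close> the identity on the common faces, as it is
  for a map that is linear on simplices.\<close>

definition identify_step :: "nat \<Rightarrow> 'a cell_complex \<Rightarrow> 'b cell_complex \<Rightarrow> bool" where
  "identify_step d T T' \<longleftrightarrow>
     (\<exists>s t F \<phi> q.
        s \<in> ncells T (d - 1) \<inter> boundary_cells d T \<and>
        t \<in> ncells T (d - 1) \<inter> boundary_cells d T \<and>
        s \<noteq> t \<and>
        F \<in> ncells T (d - 2) \<and> F \<subseteq> closed_cell T s \<inter> closed_cell T t \<and>
        homeomorphic_map (subtopology (carrier_space T) (closed_cell T s))
                         (subtopology (carrier_space T) (closed_cell T t)) \<phi> \<and>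
        (\<forall>n. \<forall>c \<in> ncells T n. c \<subseteq> closed_cell T s \<longrightarrow> \<phi> ` c \<in> ncells T n) \<and>
        (\<forall>x \<in> closed_cell T F. \<phi> x = x) \<and>
        quotient_map (carrier_space T) (carrier_space T') q \<and>
        (\<forall>x \<in> topspace (carrier_space T). \<forall>y \<in> topspace (carrier_space T).
           q x = q y \<longleftrightarrow>
             x = y \<or> (x \<in> closed_cell T s \<and> y = \<phi> x) \<or> (y \<in> closed_cell T s \<and> x = \<phi> y)) \<and>
        (\<forall>c \<in> cells T. inj_on q c) \<and>
        (\<forall>n. ncells T' n = (\<lambda>c. q ` c) ` ncells T n))"

text \<open>Geometric simplicial complexes are those of the library
  (\<^const>\<open>simplicial_complex\<close>, which has the empty face among its simplices); the open cells are
  the relative interiors of the nonempty simplices.\<close>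

definition cell_complex_of :: "'a::euclidean_space set set \<Rightarrow> 'a cell_complex" where
  "cell_complex_of C =
     \<lparr> carrier_space = top_of_set (\<Union>C),
       ncells = (\<lambda>n. {rel_interior S | S. S \<in> C \<and> int n simplex S}) \<rparr>"

definition cellular_iso :: "'a cell_complex \<Rightarrow> 'b cell_complex \<Rightarrow> bool" where
  "cellular_iso T T' \<longleftrightarrow>
     (\<exists>h. homeomorphic_map (carrier_space T) (carrier_space T') h \<and>
          (\<forall>n. ncells T' n = (\<lambda>c. h ` c) ` ncells T n))"

definition facets :: "'a set set \<Rightarrow> 'a set set" where
  "facets C = {S \<in> C. \<forall>S' \<in> C. S \<subseteq> S' \<longrightarrow> S' = S}"

text \<open>A local construction consists of complexes up to cellular homeomorphism.  Taking their points
  in \<^typ>\<open>nat \<Rightarrow> real\<close> is no restriction: every finite CW complex is homeomorphic to a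
  subspace of some Euclidean space.  Purity of \<open>C\<close> is inherited from the last complex.\<close>

definition local_construction ::
  "nat \<Rightarrow> 'a::euclidean_space set set \<Rightarrow> nat \<Rightarrow> (nat \<Rightarrow> (nat \<Rightarrow> real) cell_complex) \<Rightarrow> bool" where
  "local_construction d C k T \<longleftrightarrow>
     (let N = card (facets C) in
        2 \<le> d \<and> 1 \<le> k \<and> N \<le> k \<and>
        (\<forall>i \<in> {1..k}. pseudomanifold d (T i)) \<and>
        is_simplex_complex d (T 1) \<and>
        (\<forall>i. 1 \<le> i \<and> i < N \<longrightarrow> glue_simplex_step d (T i) (T (Suc i))) \<and>
        (\<forall>i. N \<le> i \<and> i < k \<longrightarrow> identify_step d (T i) (T (Suc i))) \<and>
        cellular_iso (T k) (cell_complex_of C))"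

definition LC :: "nat \<Rightarrow> 'a::euclidean_space set set \<Rightarrow> bool" where
  "LC d C \<longleftrightarrow> (\<exists>k T. local_construction d C k T)"


section \<open>Group presentations\<close>

text \<open>The letter \<open>(i, True)\<close> is the \<open>i\<close>-th generator and \<open>(i, False)\<close> its inverse.\<close>

definition words :: "nat \<Rightarrow> (nat \<times> bool) list set" where
  "words m = lists ({..<m} \<times> UNIV)"

definition cancels :: "nat \<Rightarrow> (nat \<times> bool) list \<Rightarrow> (nat \<times> bool) list \<Rightarrow> bool" where
  "cancels m v w \<longleftrightarrow>
     (\<exists>a b i s. i < m \<and> v = a @ [(i, s), (i, \<not> s)] @ b \<and> w = a @ b)"

definition free_equiv :: "nat \<Rightarrow> ((nat \<times> bool) list \<times> (nat \<times> bool) list) set" where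
  "free_equiv m = {(v, w). v \<in> words m \<and> w \<in> words m \<and> equivclp (cancels m) v w}"

definition free_group :: "nat \<Rightarrow> (nat \<times> bool) list set monoid" where
  "free_group m =
     \<lparr> carrier = words m // free_equiv m,
       mult = (\<lambda>A B. \<Union>v \<in> A. \<Union>w \<in> B. free_equiv m `` {v @ w}),
       one = free_equiv m `` {[]} \<rparr>"

definition normal_closure :: "('a, 'b) monoid_scheme \<Rightarrow> 'a set \<Rightarrow> 'a set" where
  "normal_closure G R = \<Inter>{N. N \<lhd> G \<and> R \<subseteq> N}"

definition presented_group ::
  "nat \<Rightarrow> (nat \<times> bool) list set set \<Rightarrow> (nat \<times> bool) list set set monoid" where
  "presented_group m R = free_group m Mod normal_closure (free_group m) R"

definition has_presentation :: "('a, 'b) monoid_scheme \<Rightarrow> nat \<Rightarrow> bool" where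
  "has_presentation G m \<longleftrightarrow> (\<exists>R \<subseteq> carrier (free_group m). G \<cong> presented_group m R)"


section \<open>Fundamental groups and knots\<close>

definition loops_at :: "'a::topological_space set \<Rightarrow> 'a \<Rightarrow> (real \<Rightarrow> 'a) set" where
  "loops_at S x = {p. path p \<and> path_image p \<subseteq> S \<and> pathstart p = x \<and> pathfinish p = x}"

definition loop_homotopy ::
  "'a::topological_space set \<Rightarrow> 'a \<Rightarrow> ((real \<Rightarrow> 'a) \<times> (real \<Rightarrow> 'a)) set" where
  "loop_homotopy S x = {(p, q). p \<in> loops_at S x \<and> q \<in> loops_at S x \<and> homotopic_paths S p q}"

definition fundamental_group ::
  "'a::topological_space set \<Rightarrow> 'a \<Rightarrow> (real \<Rightarrow> 'a) set monoid" where
  "fundamental_group S x =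
     \<lparr> carrier = loops_at S x // loop_homotopy S x,
       mult = (\<lambda>A B. \<Union>p \<in> A. \<Union>q \<in> B. loop_homotopy S x `` {p +++ q}),
       one = loop_homotopy S x `` {\<lambda>t. x} \<rparr>"

text \<open>The knot complement \<open>S - K\<close> is path-connected, so the choice of base point is immaterial.\<close>

definition complicated :: "nat \<Rightarrow> 'a::topological_space set \<Rightarrow> 'a set \<Rightarrow> bool" where
  "complicated m S K \<longleftrightarrow>
     (\<exists>x \<in> S - K. has_presentation (fundamental_group (S - K) x) (m + 1) \<and>
                 \<not> has_presentation (fundamental_group (S - K) x) m)"

definition at_least_complicated :: "nat \<Rightarrow> 'a::topological_space set \<Rightarrow> 'a set \<Rightarrow> bool" where
  "at_least_complicated m S K \<longleftrightarrow> (\<exists>k \<ge> m. complicated k S K)"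

definition simplicial_3_sphere :: "'a::euclidean_space set set \<Rightarrow> bool" where
  "simplicial_3_sphere C \<longleftrightarrow>
     simplicial_complex C \<and> (\<Union>C) homeomorphic (sphere 0 1 :: (real ^ 4) set)"

text \<open>The list \<open>vs\<close> contains the vertices of the closed path in cyclic order.  They are distinct
  and at least three, so that the edges form a simple closed curve.\<close>

definition polygon_in :: "'a::euclidean_space set set \<Rightarrow> nat \<Rightarrow> 'a list \<Rightarrow> bool" where
  "polygon_in C m vs \<longleftrightarrow>
     3 \<le> m \<and> length vs = m \<and> distinct vs \<and>
     (\<forall>i<m. closed_segment (vs ! i) (vs ! (Suc i mod m)) \<in> C)"

definition polygon_curve :: "'a::euclidean_space list \<Rightarrow> 'a set" where
  "polygon_curve vs =
     (\<Union>i<length vs. closed_segment (vs ! i) (vs ! (Suc i mod length vs)))"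

definition gonal_knot :: "'a::euclidean_space set set \<Rightarrow> nat \<Rightarrow> 'a set \<Rightarrow> bool" where
  "gonal_knot C m K \<longleftrightarrow> (\<exists>vs. polygon_in C m vs \<and> K = polygon_curve vs)"

end

theory Submission
  imports Defs "HOL-Algebra.Generated_Groups" "HOL-Homology.Invariance_of_Domain"
begin

text \<open>
  A group has a presentation with \<open>m\<close> generators iff \<open>m\<close> elements generate it, so it suffices to generate
  the knot group by one loop for each edge of the knot. Start with the open tetrahedra of \<open>C\<close> together with
  the open triangles along which they were glued to a tree: this set is simply connected. If two
  triangles with the common edge \<open>F\<close> are identified, then the tetrahedra around \<open>F\<close> form a chain ending
  in these two triangles, which the identification closes up. If \<open>F\<close> is not in the knot, add the open star of
  \<open>F\<close>: it is starlike and meets the set built so far in a path-connected set, so no generator is needed.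
  If \<open>F\<close> is in the knot, add only the open triangle, at the cost of one generator; as an edge is closed up
  only once, this happens at most \<open>m\<close> times. The open stars of the remaining cells off the knot come for
  free in the same way, because the tetrahedra around each cell are strongly connected.

  For the cell complexes \<open>T\<^sub>i\<close> of the local construction, two invariants are stated pointwise, so that
  nothing about the shape of closed cells is needed: the tetrahedra at a point are connected through
  triangles at that point, and at most two free triangles meet in a point of an edge. Invariance of domain
  shows that an identification never glues two triangles of the same tetrahedron.
\<close>

section \<open>Finitely generated groups have finite-rank presentations\<close>

text \<open>An edge off the knot receives its whole star because the new triangle alone would close
  a loop around the edge and cost a generator; inside the star this loop is null-homotopic. Only
  loops around edges of the knot cannot be filled in.

  The main obstacle is that a tetrahedron with two adjacent facets folded together is again
  homeomorphic to a ball, so the shape of the closed cell alone does not exclude folding. It is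
  excluded because a characteristic map sends the open ball onto the open cell: near a point of the
  slit the folded tetrahedron is a full neighbourhood, whereas regularity would place this point on
  the image of the bounding sphere.

  Counting is transferred to \<open>C\<close>. Every cell of every stage is sent to a simplex of
  \<open>C\<close>, and this never merges two tetrahedra, so incidences inside a tetrahedron are
  read off from the vertices of a geometric simplex. This replaces any study of the combinatorics of
  the intermediate complexes.\<close>

definition word_class :: "nat \<Rightarrow> (nat \<times> bool) list \<Rightarrow> (nat \<times> bool) list set" where
  "word_class m v = free_equiv m `` {v}"

definition inverse_word :: "(nat \<times> bool) list \<Rightarrow> (nat \<times> bool) list" where
  "inverse_word w = rev (map (\<lambda>(i, s). (i, \<not> s)) w)"

fun word_value :: "('a, 'b) monoid_scheme \<Rightarrow> (nat \<Rightarrow> 'a) \<Rightarrow> (nat \<times> bool) list \<Rightarrow> 'a" where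
  "word_value G g [] = \<one>\<^bsub>G\<^esub>"
| "word_value G g ((i, s) # w) = (if s then g i else inv\<^bsub>G\<^esub> g i) \<otimes>\<^bsub>G\<^esub> word_value G g w"

lemma words_Nil [simp]: "[] \<in> words m"
  and words_Cons [simp]: "x # v \<in> words m \<longleftrightarrow> fst x < m \<and> v \<in> words m"
  and words_append [simp]: "v @ w \<in> words m \<longleftrightarrow> v \<in> words m \<and> w \<in> words m"
  by (simp_all add: words_def mem_Times_iff)

lemma inverse_word_in_words: "w \<in> words m \<Longrightarrow> inverse_word w \<in> words m"
  by (induction w) (auto simp: inverse_word_def)

lemma cancels_words: "cancels m v w \<Longrightarrow> v \<in> words m \<longleftrightarrow> w \<in> words m"
  by (auto simp: cancels_def)

lemma cancels_context: "cancels m v w \<Longrightarrow> cancels m (a @ v @ b) (a @ w @ b)"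
  unfolding cancels_def by (metis append.assoc)

lemma equivclp_cancels_context:
  "equivclp (cancels m) v w \<Longrightarrow> equivclp (cancels m) (a @ v @ b) (a @ w @ b)"
proof (induction rule: equivclp_induct)
  case base
  then show ?case by simp
next
  case (step y z)
  from step.hyps have "equivclp (cancels m) (a @ y @ b) (a @ z @ b)"
    using cancels_context r_into_equivclp equivclp_sym by (metis (no_types))
  with step.IH show ?case
    by (rule equivclp_trans)
qed

lemma equiv_free_equiv: "equiv (words m) (free_equiv m)"
proof (intro equivI)
  show "refl_on (words m) (free_equiv m)"
    by (auto simp: refl_on_def free_equiv_def)
  show "sym (free_equiv m)"
    by (auto simp: sym_def free_equiv_def intro: equivclp_sym)
  show "trans (free_equiv m)"
    unfolding trans_def free_equiv_def by (auto intro: equivclp_trans)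
  show "free_equiv m \<subseteq> words m \<times> words m"
    by (auto simp: free_equiv_def)
qed

lemma word_class_eq_iff:
  "v \<in> words m \<Longrightarrow> w \<in> words m \<Longrightarrow> word_class m v = word_class m w \<longleftrightarrow> equivclp (cancels m) v w"
  unfolding word_class_def
  by (simp add: eq_equiv_class_iff[OF equiv_free_equiv]) (simp add: free_equiv_def)

lemma carrier_free_group: "carrier (free_group m) = word_class m ` words m"
  by (auto simp: free_group_def quotient_def word_class_def)

lemma mult_free_group:
  assumes "v \<in> words m" "w \<in> words m"
  shows "word_class m v \<otimes>\<^bsub>free_group m\<^esub> word_class m w = word_class m (v @ w)"
proof -
  have "word_class m (v' @ w') = word_class m (v @ w)"
    if "(v, v') \<in> free_equiv m" "(w, w') \<in> free_equiv m" for v' w'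
  proof -
    have "equivclp (cancels m) (v @ w) (v' @ w)" "equivclp (cancels m) (v' @ w) (v' @ w')"
      using equivclp_cancels_context[of m v v' "[]" w] equivclp_cancels_context[of m w w' v' "[]"] that
      by (simp_all add: free_equiv_def)
    then have "equivclp (cancels m) (v' @ w') (v @ w)"
      using equivclp_trans equivclp_sym by metis
    with that assms show ?thesis
      by (simp add: word_class_eq_iff free_equiv_def)
  qed
  moreover have "(v, v) \<in> free_equiv m" "(w, w) \<in> free_equiv m"
    using assms by (simp_all add: free_equiv_def)
  ultimately have "(\<Union>v' \<in> word_class m v. \<Union>w' \<in> word_class m w. word_class m (v' @ w')) = word_class m (v @ w)"
    unfolding word_class_def by blast
  then show ?thesis
    by (simp add: free_group_def word_class_def)
qed

lemma one_free_group: "\<one>\<^bsub>free_group m\<^esub> = word_class m []"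
  by (simp add: free_group_def word_class_def)

lemma equivclp_inverse_word: "w \<in> words m \<Longrightarrow> equivclp (cancels m) (inverse_word w @ w) []"
proof (induction w)
  case (Cons x w)
  obtain i s where x: "x = (i, s)" by (cases x)
  have "cancels m (inverse_word (x # w) @ x # w) (inverse_word w @ w)"
    unfolding cancels_def using Cons.prems
    by (intro exI[of _ "inverse_word w"] exI[of _ w] exI[of _ i] exI[of _ "\<not> s"])
       (auto simp: inverse_word_def x)
  then have "equivclp (cancels m) (inverse_word (x # w) @ x # w) (inverse_word w @ w)"
    by (rule r_into_equivclp)
  moreover have "equivclp (cancels m) (inverse_word w @ w) []"
    using Cons by simp
  ultimately show ?case
    by (rule equivclp_trans)
qed (auto simp: inverse_word_def)

lemma group_free_group: "group (free_group m)"
proof (rule groupI)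
  fix x y z
  assume "x \<in> carrier (free_group m)" "y \<in> carrier (free_group m)" "z \<in> carrier (free_group m)"
  then show "x \<otimes>\<^bsub>free_group m\<^esub> y \<otimes>\<^bsub>free_group m\<^esub> z = x \<otimes>\<^bsub>free_group m\<^esub> (y \<otimes>\<^bsub>free_group m\<^esub> z)"
    by (auto simp: carrier_free_group mult_free_group)
next
  fix x
  assume "x \<in> carrier (free_group m)"
  then obtain w where w: "w \<in> words m" "x = word_class m w"
    by (auto simp: carrier_free_group)
  have "word_class m (inverse_word w) \<otimes>\<^bsub>free_group m\<^esub> x = \<one>\<^bsub>free_group m\<^esub>"
    using w equivclp_inverse_word
    by (simp add: mult_free_group inverse_word_in_words one_free_group word_class_eq_iff)
  then show "\<exists>y\<in>carrier (free_group m). y \<otimes>\<^bsub>free_group m\<^esub> x = \<one>\<^bsub>free_group m\<^esub>"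
    using w inverse_word_in_words by (auto simp: carrier_free_group)
qed (auto simp: carrier_free_group mult_free_group one_free_group)

section \<open>Evaluating words in a group\<close>

context
  fixes G :: "('a, 'b) monoid_scheme" and m :: nat and g :: "nat \<Rightarrow> 'a"
  assumes G: "group G" and g: "\<And>i. i < m \<Longrightarrow> g i \<in> carrier G"
begin

interpretation group G by (fact G)

lemma word_value_closed: "w \<in> words m \<Longrightarrow> word_value G g w \<in> carrier G"
  by (induction w) (auto simp: g)

lemma word_value_append:
  "v \<in> words m \<Longrightarrow> w \<in> words m \<Longrightarrow> word_value G g (v @ w) = word_value G g v \<otimes>\<^bsub>G\<^esub> word_value G g w"
proof (induction v)
  case (Cons x v)
  then show ?case
    by (cases x) (simp add: g word_value_closed m_assoc)
qed (simp add: word_value_closed)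

lemma word_value_cancels:
  assumes "cancels m v w" "w \<in> words m"
  shows "word_value G g v = word_value G g w"
proof -
  obtain a b i s where *: "i < m" "v = a @ [(i, s), (i, \<not> s)] @ b" "w = a @ b"
    using assms by (auto simp: cancels_def)
  then have "word_value G g ([(i, s), (i, \<not> s)] @ b) = word_value G g b"
    using assms by (auto simp: g word_value_closed simp flip: m_assoc)
  with * assms show ?thesis
    by (simp add: word_value_append)
qed

lemma word_value_equivclp:
  assumes "equivclp (cancels m) v w" "v \<in> words m"
  shows "word_value G g v = word_value G g w"
proof -
  from assms have "w \<in> words m \<and> word_value G g v = word_value G g w"
  proof (induction rule: equivclp_induct)
    case (step y z)
    then show ?case
      using cancels_words word_value_cancels by metis
  qed auto
  then show ?thesis by blast
qed

lemma generate_subset_word_values: "generate G (g ` {..<m}) \<subseteq> word_value G g ` words m"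
proof
  fix x
  assume "x \<in> generate G (g ` {..<m})"
  then show "x \<in> word_value G g ` words m"
  proof induction
    case one
    show ?case by (rule image_eqI[of _ _ "[]"]) auto
  next
    case (incl h)
    then obtain i where "i < m" "h = g i" by auto
    then show ?case by (intro image_eqI[of _ _ "[(i, True)]"]) (auto simp: g)
  next
    case (inv h)
    then obtain i where "i < m" "h = g i" by auto
    then show ?case by (intro image_eqI[of _ _ "[(i, False)]"]) (auto simp: g)
  next
    case (eng h1 h2)
    then obtain v w where "v \<in> words m" "w \<in> words m" "h1 = word_value G g v" "h2 = word_value G g w"
      by auto
    then show ?case
      by (intro image_eqI[of _ _ "v @ w"]) (auto simp: word_value_append)
  qed
qed

text \<open>The set of relators may be arbitrary, so the whole kernel of the evaluation homomorphism
  serves: it is normal, hence its own normal closure, and the first isomorphism theorem applies. The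
  values of \<open>g\<close> may repeat.\<close>

lemma has_presentation_if_generated:
  assumes gen: "carrier G = generate G (g ` {..<m})"
  shows "has_presentation G m"
proof -
  \<comment> \<open>\<open>SOME\<close> picks a word from the class; by
    \<open>word_value_equivclp\<close> its value does not depend on the choice.\<close>
  define \<phi> where "\<phi> A = word_value G g (SOME w. w \<in> words m \<and> A = word_class m w)" for A
  have \<phi>: "\<phi> (word_class m w) = word_value G g w" if "w \<in> words m" for w
  proof -
    have "\<exists>v. v \<in> words m \<and> word_class m w = word_class m v"
      using that by blast
    from someI_ex[OF this] show ?thesis
      unfolding \<phi>_def using that word_value_equivclp by (metis word_class_eq_iff)
  qed
  have "\<phi> \<in> hom (free_group m) G"
    by (auto simp: hom_def carrier_free_group \<phi> word_value_closed mult_free_group word_value_append)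
  then interpret \<phi>: group_hom "free_group m" G \<phi>
    by (simp add: group_hom_def group_hom_axioms_def group_free_group G)
  let ?N = "kernel (free_group m) G \<phi>"
  have "\<phi> ` carrier (free_group m) = carrier G"
  proof
    show "carrier G \<subseteq> \<phi> ` carrier (free_group m)"
    proof
      fix x assume "x \<in> carrier G"
      then obtain w where "w \<in> words m" "x = word_value G g w"
        using gen generate_subset_word_values by auto
      then show "x \<in> \<phi> ` carrier (free_group m)"
        by (intro image_eqI[of _ _ "word_class m w"]) (auto simp: carrier_free_group \<phi>)
    qed
  qed auto
  then have "free_group m Mod ?N \<cong> G"
    by (rule \<phi>.FactGroup_iso)
  moreover have "normal_closure (free_group m) ?N = ?N"
    unfolding normal_closure_def using \<phi>.normal_kernel by blast
  ultimately have "presented_group m ?N \<cong> G"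
    by (simp add: presented_group_def)
  then have "G \<cong> presented_group m ?N"
    using \<phi>.normal_kernel normal.factorgroup_is_group group.iso_sym
    unfolding presented_group_def \<open>normal_closure (free_group m) ?N = ?N\<close> by blast
  moreover have "?N \<subseteq> carrier (free_group m)"
    by (auto simp: kernel_def)
  ultimately show ?thesis
    unfolding has_presentation_def by blast
qed

end

section \<open>Generating the fundamental group\<close>

definition paths_in :: "'a::topological_space set \<Rightarrow> 'a \<Rightarrow> 'a \<Rightarrow> (real \<Rightarrow> 'a) set" where
  "paths_in S a b = {p. path p \<and> path_image p \<subseteq> S \<and> pathstart p = a \<and> pathfinish p = b}"

lemma loops_at_eq: "loops_at S x = paths_in S x x"
  by (simp add: loops_at_def paths_in_def)

lemma paths_in_linepath [simp]: "a \<in> S \<Longrightarrow> linepath a a \<in> paths_in S a a"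
  by (simp add: paths_in_def)

lemma paths_in_join [intro]: "p \<in> paths_in S a b \<Longrightarrow> q \<in> paths_in S b c \<Longrightarrow> p +++ q \<in> paths_in S a c"
  by (auto simp: paths_in_def path_image_join)

lemma paths_in_reverse [intro]: "p \<in> paths_in S a b \<Longrightarrow> reversepath p \<in> paths_in S b a"
  by (auto simp: paths_in_def)

lemma paths_in_mono: "p \<in> paths_in S a b \<Longrightarrow> S \<subseteq> T \<Longrightarrow> p \<in> paths_in T a b"
  by (auto simp: paths_in_def)

lemma paths_in_homotopic: "homotopic_paths S p q \<Longrightarrow> p \<in> paths_in S a b \<Longrightarrow> q \<in> paths_in S a b"
  using homotopic_paths_imp_path[of S p q] homotopic_paths_imp_pathstart[of S p q]
    homotopic_paths_imp_pathfinish[of S p q] homotopic_paths_imp_subset[of S p q]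
  by (simp add: paths_in_def)

lemma paths_in_endpoints: "p \<in> paths_in S a b \<Longrightarrow> a \<in> S \<and> b \<in> S"
  by (auto simp: paths_in_def)

lemma path_connected_paths_in: "path_connected S \<longleftrightarrow> (\<forall>a\<in>S. \<forall>b\<in>S. paths_in S a b \<noteq> {})"
  by (simp add: path_connected_def paths_in_def set_eq_iff conj_ac)

lemma homotopic_join:
  assumes "homotopic_paths S p p'" "homotopic_paths S q q'" "p \<in> paths_in S a b" "q \<in> paths_in S b c"
  shows "homotopic_paths S (p +++ q) (p' +++ q')"
  using assms by (intro homotopic_paths_join) (auto simp: paths_in_def)

lemma homotopic_join_left:
  assumes "homotopic_paths S p p'" "p \<in> paths_in S a b" "q \<in> paths_in S b c"
  shows "homotopic_paths S (p +++ q) (p' +++ q)"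
  using assms by (intro homotopic_paths_join) (auto simp: paths_in_def)

lemma homotopic_join_right:
  assumes "homotopic_paths S q q'" "p \<in> paths_in S a b" "q \<in> paths_in S b c"
  shows "homotopic_paths S (p +++ q) (p +++ q')"
  using assms by (intro homotopic_paths_join) (auto simp: paths_in_def)

lemma homotopic_assoc:
  assumes "p \<in> paths_in S a b" "q \<in> paths_in S b c" "r \<in> paths_in S c d"
  shows "homotopic_paths S (p +++ (q +++ r)) ((p +++ q) +++ r)"
  using assms by (intro homotopic_paths_assoc) (auto simp: paths_in_def)

lemma homotopic_cancel_left:
  fixes S :: "'a::real_normed_vector set"
  assumes "r \<in> paths_in S a b" "q \<in> paths_in S b c"
  shows "homotopic_paths S (reversepath r +++ (r +++ q)) q"
proof -
  have "homotopic_paths S (reversepath r +++ (r +++ q)) ((reversepath r +++ r) +++ q)"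
    using assms by (intro homotopic_assoc) auto
  also have "homotopic_paths S \<dots> (linepath b b +++ q)"
    using assms by (intro homotopic_join[where a = b and b = b and c = c])
      (use homotopic_paths_linv[of r S] in \<open>auto simp: paths_in_def path_image_join\<close>)
  also have "homotopic_paths S \<dots> q"
    using assms by (intro homotopic_paths_lid') (auto simp: paths_in_def)
  finally show ?thesis .
qed

lemma homotopic_cancel_middle:
  fixes S :: "'a::real_normed_vector set"
  assumes "p \<in> paths_in S a b" "r \<in> paths_in S d b" "q \<in> paths_in S b c"
  shows "homotopic_paths S ((p +++ reversepath r) +++ (r +++ q)) (p +++ q)"
proof -
  have "homotopic_paths S ((p +++ reversepath r) +++ (r +++ q)) (p +++ (reversepath r +++ (r +++ q)))"
    using assms by (intro homotopic_paths_sym[OF homotopic_assoc]) auto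
  also have "homotopic_paths S \<dots> (p +++ q)"
    using assms by (blast intro: homotopic_join_right homotopic_cancel_left)
  finally show ?thesis .
qed

lemma homotopic_cancel_right:
  fixes S :: "'a::real_normed_vector set"
  assumes "p \<in> paths_in S a b" "r \<in> paths_in S b c"
  shows "homotopic_paths S ((p +++ r) +++ reversepath r) p"
proof -
  have "homotopic_paths S ((p +++ r) +++ reversepath r) (p +++ (r +++ reversepath r))"
    using assms by (intro homotopic_paths_sym[OF homotopic_assoc]) auto
  also have "homotopic_paths S \<dots> (p +++ linepath b b)"
    using assms by (intro homotopic_join[where a = a and b = b and c = b])
      (use homotopic_paths_rinv[of r S] in \<open>auto simp: paths_in_def path_image_join\<close>)
  also have "homotopic_paths S \<dots> p"
    using assms by (intro homotopic_paths_rid') (auto simp: paths_in_def)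
  finally show ?thesis .
qed

subsection \<open>The groupoid generated by a set of paths\<close>

text \<open>The subgroupoid of the fundamental groupoid generated by \<open>P\<close>, on the level
  of paths. Generators may have arbitrary endpoints, so that a path can be cut into pieces before
  any piece is connected to a base point.\<close>

inductive_set path_words :: "'a::real_normed_vector set \<Rightarrow> (real \<Rightarrow> 'a) set \<Rightarrow> (real \<Rightarrow> 'a) set"
  for S :: "'a set" and P :: "(real \<Rightarrow> 'a) set" where
  const: "a \<in> S \<Longrightarrow> linepath a a \<in> path_words S P"
| incl: "p \<in> P \<Longrightarrow> p \<in> path_words S P"
| join: "p \<in> path_words S P \<Longrightarrow> q \<in> path_words S P \<Longrightarrow> pathfinish p = pathstart q \<Longrightarrow> p +++ q \<in> path_words S P"
| rev: "p \<in> path_words S P \<Longrightarrow> reversepath p \<in> path_words S P"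
| homotopic: "p \<in> path_words S P \<Longrightarrow> homotopic_paths S p q \<Longrightarrow> q \<in> path_words S P"

lemma path_words_in:
  assumes "\<And>p. p \<in> P \<Longrightarrow> path p \<and> path_image p \<subseteq> S" "p \<in> path_words S P"
  shows "path p \<and> path_image p \<subseteq> S"
  using assms(2)
proof (induction)
  case (homotopic p q)
  then show ?case
    using homotopic_paths_imp_path homotopic_paths_imp_subset by blast
qed (use assms(1) in \<open>auto simp: path_image_join simp del: linepath_trivial\<close>)

lemma path_words_mono:
  assumes "S \<subseteq> T" "P \<subseteq> path_words T Q" "p \<in> path_words S P"
  shows "p \<in> path_words T Q"
  using assms(3)
proof (induction)
  case (homotopic p q)
  then show ?case
    by (meson assms(1) homotopic_paths_subset path_words.homotopic)
next
  case (const a)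
  then show ?case
    using assms(1) path_words.const[of a T Q] by blast
next
  case (incl p)
  then show ?case
    using assms(2) by blast
qed (auto intro: path_words.join path_words.rev)

text \<open>In place of a subdivision with a Lebesgue number, connectedness of the interval is used:
  near each parameter the path stays in \<open>U\<close> or in \<open>W\<close>, so whether the
  initial segment up to \<open>t\<close> is generated does not depend on \<open>t\<close> there.
  This works in both directions, as \<open>subpath\<close> may also run backwards.\<close>

lemma path_words_open_cover:
  assumes S: "S = U \<union> W" and U: "openin (top_of_set S) U" and W: "openin (top_of_set S) W"
    and p: "path p" "path_image p \<subseteq> S"
    and PU: "\<And>q. path q \<Longrightarrow> path_image q \<subseteq> U \<Longrightarrow> q \<in> P"
    and PW: "\<And>q. path q \<Longrightarrow> path_image q \<subseteq> W \<Longrightarrow> q \<in> P"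
  shows "p \<in> path_words S P"
proof -
  let ?Q = "\<lambda>t. subpath 0 t p \<in> path_words S P"
  have contp: "continuous_on {0..1} p"
    using p by (simp add: path_def)
  have "?Q 1"
  proof (rule connected_induction_simple[of "{0..1::real}" 0 1 ?Q])
    show "?Q 0"
      using p by (auto simp: subpath_refl path_image_def intro!: path_words.const)
  next
    fix a :: real
    assume a: "a \<in> {0..1}"
    have "p a \<in> path_image p"
      using a by (simp add: path_image_def)
    then have "p a \<in> U \<union> W"
      using p(2) S by blast
    then obtain V where V: "V = U \<or> V = W" "p a \<in> V" "openin (top_of_set S) V"
      using U W by blast
    have "openin (top_of_set {0..1}) ({0..1} \<inter> p -` V)"
      using contp p V by (intro continuous_openin_preimage[of _ _ S]) (auto simp: path_image_def)
    then obtain e where e: "e > 0" "\<And>t. t \<in> {0..1} \<Longrightarrow> dist t a < e \<Longrightarrow> p t \<in> V"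
      using a V(2) unfolding openin_euclidean_subtopology_iff by (metis IntI Int_iff vimage_eq)
    let ?T = "{0..1} \<inter> ball a e"
    have "?Q y" if x: "x \<in> ?T" and y: "y \<in> ?T" and Q: "?Q x" for x y
    proof -
      have "closed_segment x y \<subseteq> ?T"
        using x y by (intro closed_segment_subset) (auto intro: convex_Int)
      then have "p t \<in> V" if "t \<in> closed_segment x y" for t
        using e(2)[of t] that by (auto simp: dist_commute subset_iff)
      then have "path_image (subpath x y p) \<subseteq> V"
        by (auto simp: path_image_subpath_gen)
      then have "subpath x y p \<in> P"
        using V PU PW x y p by (metis IntD1 path_subpath)
      then have "subpath 0 x p +++ subpath x y p \<in> path_words S P"
        using Q by (intro path_words.join[OF _ path_words.incl]) auto
      moreover have "homotopic_paths S (subpath 0 x p +++ subpath x y p) (subpath 0 y p)"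
        using p x y by (intro homotopic_join_subpaths) auto
      ultimately show ?thesis
        by (rule path_words.homotopic)
    qed
    moreover have "openin (top_of_set {0..1}) ?T" "a \<in> ?T"
      using a e by auto
    ultimately show "\<exists>T. openin (top_of_set {0..1}) T \<and> a \<in> T \<and> (\<forall>x\<in>T. \<forall>y\<in>T. ?Q x \<longrightarrow> ?Q y)"
      by blast
  qed auto
  then show ?thesis by simp
qed

text \<open>If every \<open>\<tau> a\<close> is a path from \<open>x\<close> to \<open>a\<close>, then \<open>p \<mapsto> \<tau>(start) p \<tau>(end)\<^sup>-\<^sup>1\<close> is a retraction of the
  fundamental groupoid onto the fundamental group at \<open>x\<close>.\<close>

lemma path_words_retract:
  assumes \<tau>: "\<And>a. a \<in> S \<Longrightarrow> \<tau> a \<in> paths_in S x a"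
    and P: "\<And>p. p \<in> P \<Longrightarrow> path p \<and> path_image p \<subseteq> S"
    and PL: "\<And>p. p \<in> P \<Longrightarrow> \<tau> (pathstart p) +++ (p +++ reversepath (\<tau> (pathfinish p))) \<in> path_words S L"
    and p: "p \<in> path_words S P"
  shows "\<tau> (pathstart p) +++ (p +++ reversepath (\<tau> (pathfinish p))) \<in> path_words S L"
  using p
proof (induction)
  case (const a)
  have "homotopic_paths S (\<tau> a +++ (linepath a a +++ reversepath (\<tau> a))) ((\<tau> a +++ linepath a a) +++ reversepath (\<tau> a))"
    using const \<tau>[OF const] by (intro homotopic_assoc) auto
  also have "homotopic_paths S \<dots> (\<tau> a +++ reversepath (\<tau> a))"
    using \<tau>[OF const] const
    by (intro homotopic_join[where a = x and b = a and c = x] homotopic_paths_rid')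
       (auto simp: paths_in_def path_image_join)
  also have "homotopic_paths S \<dots> (linepath x x)"
    using \<tau>[OF const] homotopic_paths_rinv[of "\<tau> a" S] by (auto simp: paths_in_def)
  finally have "homotopic_paths S (linepath x x) (\<tau> a +++ (linepath a a +++ reversepath (\<tau> a)))"
    by (rule homotopic_paths_sym)
  moreover have "x \<in> S"
    using paths_in_endpoints[OF \<tau>[OF const]] by blast
  ultimately show ?case
    using path_words.homotopic[OF path_words.const, of x S _ L] by (simp del: linepath_trivial)
next
  case (incl p)
  then show ?case by (rule PL)
next
  case (join p q)
  define a b c where "a = pathstart p" and "b = pathfinish p" and "c = pathfinish q"
  have p: "p \<in> paths_in S a b" and q: "q \<in> paths_in S b c"
    using path_words_in[OF P] join by (auto simp: paths_in_def a_def b_def c_def)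
  have \<tau>': "\<tau> a \<in> paths_in S x a" "\<tau> b \<in> paths_in S x b" "\<tau> c \<in> paths_in S x c"
    using \<tau> paths_in_endpoints[OF p] paths_in_endpoints[OF q] by auto
  let ?u = "(\<tau> a +++ (p +++ reversepath (\<tau> b))) +++ (\<tau> b +++ (q +++ reversepath (\<tau> c)))"
  have ends: "pathfinish (\<tau> a +++ (p +++ reversepath (\<tau> b))) = pathstart (\<tau> b +++ (q +++ reversepath (\<tau> c)))"
    using \<tau>' by (simp add: paths_in_def)
  have words: "\<tau> a +++ (p +++ reversepath (\<tau> b)) \<in> path_words S L"
    "\<tau> b +++ (q +++ reversepath (\<tau> c)) \<in> path_words S L"
    using join.IH join.hyps by (simp_all add: a_def b_def c_def)
  have "?u \<in> path_words S L"
    by (rule path_words.join[OF words ends])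
  moreover have "homotopic_paths S ?u (((\<tau> a +++ p) +++ reversepath (\<tau> b)) +++ (\<tau> b +++ (q +++ reversepath (\<tau> c))))"
    using p q \<tau>' by (blast intro: homotopic_join_left homotopic_assoc)
  moreover have "homotopic_paths S \<dots> ((\<tau> a +++ p) +++ (q +++ reversepath (\<tau> c)))"
    using p q \<tau>' by (intro homotopic_cancel_middle) auto
  moreover have "homotopic_paths S \<dots> (\<tau> a +++ (p +++ (q +++ reversepath (\<tau> c))))"
    using p q \<tau>' by (intro homotopic_paths_sym[OF homotopic_assoc]) auto
  moreover have "homotopic_paths S \<dots> (\<tau> a +++ ((p +++ q) +++ reversepath (\<tau> c)))"
    using p q \<tau>' by (blast intro: homotopic_join_right homotopic_assoc)
  ultimately have "\<tau> a +++ ((p +++ q) +++ reversepath (\<tau> c)) \<in> path_words S L"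
    by (meson path_words.homotopic)
  then show ?case
    by (simp add: a_def c_def)
next
  case (rev p)
  define a b where "a = pathstart p" and "b = pathfinish p"
  have p: "p \<in> paths_in S a b"
    using path_words_in[OF P] rev by (auto simp: paths_in_def a_def b_def)
  have \<tau>': "\<tau> a \<in> paths_in S x a" "\<tau> b \<in> paths_in S x b"
    using \<tau> paths_in_endpoints[OF p] by auto
  have "reversepath (\<tau> a +++ (p +++ reversepath (\<tau> b))) \<in> path_words S L"
    using rev.IH by (intro path_words.rev) (simp add: a_def b_def)
  also have "reversepath (\<tau> a +++ (p +++ reversepath (\<tau> b))) = (\<tau> b +++ reversepath p) +++ reversepath (\<tau> a)"
    using p \<tau>' by (simp add: reversepath_joinpaths paths_in_def)
  finally have "(\<tau> b +++ reversepath p) +++ reversepath (\<tau> a) \<in> path_words S L" (is "?v \<in> _") .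
  moreover have "homotopic_paths S ?v (\<tau> b +++ (reversepath p +++ reversepath (\<tau> a)))"
    using p \<tau>' by (intro homotopic_paths_sym[OF homotopic_assoc]) auto
  ultimately have "\<tau> b +++ (reversepath p +++ reversepath (\<tau> a)) \<in> path_words S L"
    by (rule path_words.homotopic)
  then show ?case
    by (simp add: a_def b_def)
next
  case (homotopic p q)
  define a b where "a = pathstart p" and "b = pathfinish p"
  have ab: "pathstart q = a" "pathfinish q = b"
    using homotopic_paths_imp_pathstart[OF homotopic.hyps(2)] homotopic_paths_imp_pathfinish[OF homotopic.hyps(2)]
    by (simp_all add: a_def b_def)
  have p: "p \<in> paths_in S a b"
    using path_words_in[OF P] homotopic by (auto simp: paths_in_def a_def b_def)
  have \<tau>': "\<tau> a \<in> paths_in S x a" "\<tau> b \<in> paths_in S x b"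
    using \<tau> paths_in_endpoints[OF p] by auto
  have "homotopic_paths S (\<tau> a +++ (p +++ reversepath (\<tau> b))) (\<tau> a +++ (q +++ reversepath (\<tau> b)))"
    using p \<tau>' homotopic.hyps(2)
    by (blast intro: homotopic_join_right homotopic_join_left)
  moreover have "\<tau> a +++ (p +++ reversepath (\<tau> b)) \<in> path_words S L"
    using homotopic.IH by (simp add: a_def b_def)
  ultimately have "\<tau> a +++ (q +++ reversepath (\<tau> b)) \<in> path_words S L"
    using path_words.homotopic by blast
  then show ?case
    using ab by simp
qed

section \<open>Bounds for the number of generating loops\<close>

definition pi1_rank_le :: "'a::real_normed_vector set \<Rightarrow> nat \<Rightarrow> bool" where
  "pi1_rank_le S n \<longleftrightarrow> path_connected S \<and>
     (\<exists>x\<in>S. \<exists>L \<subseteq> loops_at S x. finite L \<and> card L \<le> n \<and> loops_at S x \<subseteq> path_words S L)"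

text \<open>Change of base point: the generators are conjugated by a path from \<open>y\<close> to
  \<open>x\<close>. A loop \<open>r\<close> at \<open>y\<close> is first moved to \<open>x\<close>,
  where it is a word in \<open>L\<close>; the retraction returns this word to
  \<open>y\<close>.\<close>

lemma pi1_rank_le_at:
  assumes "pi1_rank_le S n" "y \<in> S"
  shows "\<exists>L \<subseteq> loops_at S y. finite L \<and> card L \<le> n \<and> loops_at S y \<subseteq> path_words S L"
proof -
  obtain x L where x: "x \<in> S" and L: "L \<subseteq> loops_at S x" "finite L" "card L \<le> n" "loops_at S x \<subseteq> path_words S L"
    and conn: "path_connected S"
    using assms by (auto simp: pi1_rank_le_def)
  from conn assms(2) have "\<forall>a\<in>S. \<exists>p. p \<in> paths_in S y a"
    by (auto simp: path_connected_paths_in)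
  then obtain \<tau> where \<tau>: "\<And>a. a \<in> S \<Longrightarrow> \<tau> a \<in> paths_in S y a"
    by metis
  define L' where "L' = (\<lambda>p. \<tau> x +++ (p +++ reversepath (\<tau> x))) ` L"
  have "L' \<subseteq> loops_at S y"
    using L(1) \<tau>[OF x] by (auto simp: L'_def loops_at_eq)
  moreover have "finite L'" "card L' \<le> n"
    using L card_image_le[OF L(2)] by (auto simp: L'_def intro: order_trans)
  moreover have "r \<in> path_words S L'" if r: "r \<in> paths_in S y y" for r
  proof -
    let ?p = "reversepath (\<tau> x) +++ (r +++ \<tau> x)"
    have p: "?p \<in> paths_in S x x"
      using r \<tau>[OF x] by auto
    then have "?p \<in> path_words S L"
      using L(4) by (auto simp: loops_at_eq)
    then have "\<tau> (pathstart ?p) +++ (?p +++ reversepath (\<tau> (pathfinish ?p))) \<in> path_words S L'"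
    proof (rule path_words_retract[where x = y and P = L and \<tau> = \<tau>, rotated -1])
      fix q assume q: "q \<in> L"
      then show "path q \<and> path_image q \<subseteq> S"
        using L(1) by (auto simp: loops_at_def)
      have "\<tau> (pathstart q) +++ (q +++ reversepath (\<tau> (pathfinish q))) \<in> L'"
        using q L(1) by (auto simp: loops_at_def L'_def)
      then show "\<tau> (pathstart q) +++ (q +++ reversepath (\<tau> (pathfinish q))) \<in> path_words S L'"
        by (rule path_words.incl)
    qed (simp_all add: \<tau>)
    then have "\<tau> x +++ (?p +++ reversepath (\<tau> x)) \<in> path_words S L'" (is "?v \<in> _")
      using \<tau>[OF x] by (simp add: paths_in_def)
    moreover have "homotopic_paths S ?v ((\<tau> x +++ ?p) +++ reversepath (\<tau> x))"
      using \<tau>[OF x] p by (intro homotopic_assoc) auto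
    moreover have "homotopic_paths S \<dots> ((r +++ \<tau> x) +++ reversepath (\<tau> x))"
    proof (rule homotopic_join_left)
      show "homotopic_paths S (\<tau> x +++ ?p) (r +++ \<tau> x)"
        using homotopic_cancel_left[of "reversepath (\<tau> x)" S x y "r +++ \<tau> x" x] \<tau>[OF x] r by auto
    qed (use \<tau>[OF x] p in auto)
    moreover have "homotopic_paths S \<dots> r"
      using r \<tau>[OF x] by (intro homotopic_cancel_right) auto
    ultimately show ?thesis
      by (meson path_words.homotopic)
  qed
  ultimately show ?thesis
    by (auto simp: loops_at_eq)
qed

lemma pi1_rank_le_simply_connected:
  assumes "simply_connected S" "S \<noteq> {}"
  shows "pi1_rank_le S 0"
proof -
  obtain x where x: "x \<in> S" using assms by auto
  have "p \<in> path_words S {}" if "p \<in> loops_at S x" for p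
  proof (rule path_words.homotopic[OF path_words.const[OF x]])
    show "homotopic_paths S (linepath x x) p"
      using that assms x by (auto simp: simply_connected_eq_homotopic_paths loops_at_def)
  qed
  then have "{} \<subseteq> loops_at S x \<and> finite {} \<and> card {} \<le> (0::nat) \<and> loops_at S x \<subseteq> path_words S {}"
    by auto
  then show ?thesis
    using x assms(1) simply_connected_imp_path_connected unfolding pi1_rank_le_def by blast
qed

text \<open>The generating half of van Kampen's theorem. The two path-connected parts of \<open>U \<inter> W\<close> need not be
  disjoint; passing from one to the other through \<open>W\<close> and back through \<open>U\<close> is the only new loop.\<close>

lemma pi1_rank_le_Un:
  fixes U W :: "'a::real_normed_vector set"
  assumes U: "openin (top_of_set (U \<union> W)) U" and W: "openin (top_of_set (U \<union> W)) W"
    and rank: "pi1_rank_le U n" and sc: "simply_connected W"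
    and AB: "U \<inter> W = A \<union> B" "path_connected A" "path_connected B" "A \<noteq> {}"
  shows "pi1_rank_le (U \<union> W) (if B \<subseteq> A then n else Suc n)"
proof -
  let ?S = "U \<union> W"
  obtain x where x: "x \<in> A" using AB(4) by auto
  then have xUW: "x \<in> U" "x \<in> W" using AB(1) by auto
  obtain L where L: "L \<subseteq> loops_at U x" "finite L" "card L \<le> n" "loops_at U x \<subseteq> path_words U L"
    using pi1_rank_le_at[OF rank xUW(1)] by auto
  have pcU: "path_connected U" and pcW: "path_connected W"
    using rank sc by (auto simp: pi1_rank_le_def simply_connected_imp_path_connected)
  \<comment> \<open>\<open>\<delta>\<close> crosses from \<open>A\<close> to \<open>B\<close> inside
    \<open>W\<close>, and its conjugate returns through \<open>U\<close>. Both \<open>b\<close> and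
    \<open>\<delta>\<close> are arbitrary if \<open>B\<close> is empty.\<close>
  obtain b where b: "B \<noteq> {} \<Longrightarrow> b \<in> B" by auto
  obtain \<delta> where \<delta>: "B \<noteq> {} \<Longrightarrow> \<delta> \<in> paths_in W x b"
    using pcW xUW b AB(1) by (metis Int_iff UnCI all_not_in_conv path_connected_paths_in)
  \<comment> \<open>Points of \<open>U\<close> are reached inside \<open>U\<close>, so conjugation
    turns paths in \<open>U\<close> into loops in \<open>U\<close>; the remaining points are reached
    inside \<open>W\<close>.\<close>
  have "\<exists>p. p \<in> paths_in ?S x a \<and> (a \<in> U \<longrightarrow> p \<in> paths_in U x a) \<and> (a \<notin> U \<longrightarrow> p \<in> paths_in W x a)"
    if "a \<in> ?S" for a
    using pcU pcW that xUW paths_in_mono[of _ U x a ?S] paths_in_mono[of _ W x a ?S]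
    unfolding path_connected_paths_in by (cases "a \<in> U") blast+
  then obtain \<tau> where \<tau>: "\<And>a. a \<in> ?S \<Longrightarrow> \<tau> a \<in> paths_in ?S x a"
    and \<tau>U: "\<And>a. a \<in> U \<Longrightarrow> \<tau> a \<in> paths_in U x a" and \<tau>W: "\<And>a. a \<in> W \<Longrightarrow> a \<notin> U \<Longrightarrow> \<tau> a \<in> paths_in W x a"
    by (metis UnI1 UnI2)
  define conj where "conj p = \<tau> (pathstart p) +++ (p +++ reversepath (\<tau> (pathfinish p)))" for p
  define L' where "L' = (if B \<subseteq> A then L else insert (conj \<delta>) L)"
  have "LL": "L \<subseteq> L'" by (auto simp: L'_def)
  have loopU: "p \<in> path_words ?S L'" if "p \<in> paths_in U x x" for p
  proof (rule path_words_mono[of U ?S L L'])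
    show "L \<subseteq> path_words ?S L'" using LL by (auto intro: path_words.incl)
    show "p \<in> path_words U L" using L(4) that by (auto simp: loops_at_eq)
  qed auto
  have conjU: "conj p \<in> path_words ?S L'" if "p \<in> paths_in U a c" for a c p
  proof -
    have "conj p \<in> paths_in U x x"
      using that \<tau>U[of a] \<tau>U[of c] paths_in_endpoints[OF that] by (auto simp: conj_def paths_in_def path_image_join)
    then show ?thesis by (rule loopU)
  qed
  \<comment> \<open>The paths whose conjugates are already generated. Paths in \<open>U\<close>
    belong to \<open>Q\<close> at once; the work is to show the same for paths in
    \<open>W\<close>.\<close>
  define Q where "Q = {p. path p \<and> path_image p \<subseteq> ?S \<and> conj p \<in> path_words ?S L'}"
  have Q: "conj p \<in> path_words ?S L'" if "p \<in> path_words ?S Q" for p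
    unfolding conj_def
    by (rule path_words_retract[where P = Q and x = x, OF \<tau> _ _ that]) (auto simp: Q_def conj_def[symmetric])
  have QU: "p \<in> Q" if "path p" "path_image p \<subseteq> U" for p
    using that conjU[of p] by (auto simp: Q_def paths_in_def)
  \<comment> \<open>Each point of \<open>W\<close> is reached from \<open>x\<close> by a word in
    \<open>Q\<close> that stays in \<open>W\<close>. As \<open>W\<close> is simply connected, any
    path in \<open>W\<close> is then homotopic to the product of one such word, reversed, and
    another.\<close>
  have "\<exists>\<sigma> \<in> path_words ?S Q. \<sigma> \<in> paths_in W x a" if a: "a \<in> W" for a
  proof -
    consider "a \<notin> U" | "a \<in> A" | "a \<in> B" "a \<notin> A" using AB(1) a by auto
    then show ?thesis
    proof cases
      case 1
      have [simp]: "pathstart (\<tau> a) = x" "pathfinish (\<tau> a) = a"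
        using \<tau>W[OF a 1] by (auto simp: paths_in_def)
      have "homotopic_paths ?S (\<tau> x +++ linepath x x) (\<tau> x +++ (\<tau> a +++ reversepath (\<tau> a)))"
        using \<tau>[of x] \<tau>[of a] a xUW homotopic_paths_rinv[of "\<tau> a" ?S]
        by (intro homotopic_join[where a = x and b = x and c = x])
           (auto simp: paths_in_def intro: homotopic_paths_sym)
      moreover have "\<tau> x +++ linepath x x \<in> path_words ?S L'"
        using xUW \<tau>U[of x] by (intro loopU) auto
      ultimately have "conj (\<tau> a) \<in> path_words ?S L'"
        by (auto simp: conj_def intro: path_words.homotopic)
      then have "\<tau> a \<in> Q"
        using \<tau>[of a] a by (auto simp: Q_def paths_in_def)
      then show ?thesis using \<tau>W[OF a 1] by (auto intro: path_words.incl)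
    next
      case 2
      then obtain p where p: "p \<in> paths_in A x a"
        using AB(2) x by (auto simp: path_connected_paths_in)
      then have "p \<in> Q" "p \<in> paths_in W x a"
        using AB(1) by (auto simp: paths_in_def intro!: QU)
      then show ?thesis by (auto intro: path_words.incl)
    next
      case 3
      then have \<delta>: "\<delta> \<in> paths_in W x b" and bB: "b \<in> B" using \<delta> b by auto
      obtain p where p: "p \<in> paths_in B b a"
        using AB(3) 3 bB by (auto simp: path_connected_paths_in)
      have "conj \<delta> \<in> path_words ?S L'"
        using 3 by (auto simp: L'_def intro: path_words.incl)
      then have "\<delta> \<in> Q"
        using \<delta> by (auto simp: Q_def paths_in_def)
      moreover have "p \<in> Q" "p \<in> paths_in W b a"
        using AB(1) p by (auto simp: paths_in_def intro!: QU)
      ultimately show ?thesis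
        using \<delta> by (intro bexI[of _ "\<delta> +++ p"] path_words.join path_words.incl) (auto simp: paths_in_def path_image_join)
    qed
  qed
  then obtain \<sigma> where \<sigma>: "\<And>a. a \<in> W \<Longrightarrow> \<sigma> a \<in> path_words ?S Q" "\<And>a. a \<in> W \<Longrightarrow> \<sigma> a \<in> paths_in W x a"
    by metis
  have QW: "p \<in> Q" if p: "path p" "path_image p \<subseteq> W" for p
  proof -
    let ?a = "pathstart p" and ?c = "pathfinish p"
    have ac: "?a \<in> W" "?c \<in> W" using p by auto
    have "reversepath (\<sigma> ?a) +++ \<sigma> ?c \<in> path_words ?S Q"
      using \<sigma>[OF ac(1)] \<sigma>[OF ac(2)] by (intro path_words.join path_words.rev) (auto simp: paths_in_def)
    moreover have "homotopic_paths W (reversepath (\<sigma> ?a) +++ \<sigma> ?c) p"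
      using sc \<sigma>(2)[OF ac(1)] \<sigma>(2)[OF ac(2)] p unfolding simply_connected_eq_homotopic_paths
      by (auto simp: paths_in_def path_image_join)
    ultimately have "p \<in> path_words ?S Q"
      by (meson homotopic_paths_subset path_words.homotopic sup_ge2)
    then have "conj p \<in> path_words ?S L'" by (rule Q)
    with p show ?thesis by (auto simp: Q_def)
  qed
  have "p \<in> path_words ?S L'" if p: "p \<in> paths_in ?S x x" for p
  proof -
    have "p \<in> path_words ?S Q"
      using p by (intro path_words_open_cover[OF refl U W] QU QW) (auto simp: paths_in_def)
    then have "\<tau> x +++ (p +++ reversepath (\<tau> x)) \<in> path_words ?S L'"
      using Q[of p] p by (simp add: conj_def paths_in_def)
    \<comment> \<open>\<open>\<tau> x\<close> need not be constant, but as a loop in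
      \<open>U\<close> it is generated, so the conjugation by it can be undone.\<close>
    moreover have \<tau>x: "\<tau> x \<in> path_words ?S L'" "\<tau> x \<in> paths_in ?S x x"
      using loopU \<tau>U \<tau> xUW by auto
    ultimately have "reversepath (\<tau> x) +++ ((\<tau> x +++ (p +++ reversepath (\<tau> x))) +++ \<tau> x) \<in> path_words ?S L'"
      (is "?v \<in> _")
      by (auto simp: paths_in_def intro!: path_words.join[OF path_words.rev path_words.join])
    moreover have "homotopic_paths ?S ?v (reversepath (\<tau> x) +++ (\<tau> x +++ ((p +++ reversepath (\<tau> x)) +++ \<tau> x)))"
      using p \<tau>x(2) by (blast intro: homotopic_join_right homotopic_paths_sym homotopic_assoc)
    moreover have "homotopic_paths ?S \<dots> ((p +++ reversepath (\<tau> x)) +++ \<tau> x)"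
      using p \<tau>x(2) by (blast intro: homotopic_cancel_left)
    moreover have "homotopic_paths ?S \<dots> p"
      using homotopic_cancel_right[of p ?S x x "reversepath (\<tau> x)" x] p \<tau>x(2) by auto
    ultimately show ?thesis
      by (meson path_words.homotopic)
  qed
  moreover have "L' \<subseteq> loops_at ?S x"
  proof -
    have "conj \<delta> \<in> paths_in ?S x x" if "B \<noteq> {}"
    proof -
      have "\<delta> \<in> paths_in ?S x b" using \<delta>[OF that] paths_in_mono[of \<delta> W] by auto
      then show ?thesis
        using \<tau>[of x] \<tau>[of b] paths_in_endpoints[of \<delta> ?S x b]
        by (auto simp: conj_def paths_in_def path_image_join)
    qed
    then show ?thesis
      using L(1) paths_in_mono[of _ U x x ?S] by (auto simp: L'_def loops_at_eq)
  qed
  moreover have "finite L'" "card L' \<le> (if B \<subseteq> A then n else Suc n)"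
    using L by (auto simp: L'_def card_insert_if)
  moreover have "path_connected ?S"
    using pcU pcW xUW by (intro path_connected_Un) auto
  ultimately show ?thesis
    using xUW unfolding pi1_rank_le_def loops_at_eq by blast
qed

subsection \<open>The fundamental group\<close>

context
  fixes S :: "'a::real_normed_vector set" and x :: 'a
  assumes x: "x \<in> S"
begin

definition loop_class :: "(real \<Rightarrow> 'a) \<Rightarrow> (real \<Rightarrow> 'a) set" where
  "loop_class p = loop_homotopy S x `` {p}"

lemma equiv_loop_homotopy: "equiv (loops_at S x) (loop_homotopy S x)"
proof (intro equivI)
  show "refl_on (loops_at S x) (loop_homotopy S x)"
    by (auto simp: refl_on_def loop_homotopy_def loops_at_def)
  show "sym (loop_homotopy S x)"
    by (auto simp: sym_def loop_homotopy_def intro: homotopic_paths_sym)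
  show "trans (loop_homotopy S x)"
    unfolding trans_def loop_homotopy_def by (auto intro: homotopic_paths_trans)
  show "loop_homotopy S x \<subseteq> loops_at S x \<times> loops_at S x"
    by (auto simp: loop_homotopy_def)
qed

lemma loop_class_eq_iff:
  "p \<in> loops_at S x \<Longrightarrow> q \<in> loops_at S x \<Longrightarrow> loop_class p = loop_class q \<longleftrightarrow> homotopic_paths S p q"
  unfolding loop_class_def
  by (simp add: eq_equiv_class_iff[OF equiv_loop_homotopy]) (simp add: loop_homotopy_def)

lemma carrier_fundamental_group: "carrier (fundamental_group S x) = loop_class ` loops_at S x"
  by (auto simp: fundamental_group_def quotient_def loop_class_def)

lemma mult_fundamental_group:
  assumes "p \<in> loops_at S x" "q \<in> loops_at S x"
  shows "loop_class p \<otimes>\<^bsub>fundamental_group S x\<^esub> loop_class q = loop_class (p +++ q)"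
proof -
  have eq: "loop_class (p' +++ q') = loop_class (p +++ q)"
    if "(p, p') \<in> loop_homotopy S x" "(q, q') \<in> loop_homotopy S x" for p' q'
  proof -
    have pq: "p \<in> paths_in S x x" "q \<in> paths_in S x x" "p' \<in> paths_in S x x" "q' \<in> paths_in S x x"
      "homotopic_paths S p' p" "homotopic_paths S q' q"
      using that by (simp_all add: loop_homotopy_def loops_at_eq homotopic_paths_sym)
    then have "homotopic_paths S (p' +++ q') (p +++ q)"
      by (intro homotopic_join)
    moreover have "p' +++ q' \<in> loops_at S x" "p +++ q \<in> loops_at S x"
      using pq unfolding loops_at_eq by (blast intro: paths_in_join)+
    ultimately show ?thesis
      by (simp add: loop_class_eq_iff)
  qed
  have "(p, p) \<in> loop_homotopy S x" "(q, q) \<in> loop_homotopy S x"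
    using assms by (simp_all add: loop_homotopy_def loops_at_def)
  with eq have "(\<Union>p' \<in> loop_class p. \<Union>q' \<in> loop_class q. loop_class (p' +++ q')) = loop_class (p +++ q)"
    unfolding loop_class_def by blast
  then show ?thesis
    by (simp add: fundamental_group_def loop_class_def)
qed

lemma const_loop: "linepath x x \<in> loops_at S x"
  using x by (simp add: loops_at_eq)

lemma one_fundamental_group: "\<one>\<^bsub>fundamental_group S x\<^esub> = loop_class (linepath x x)"
  by (simp add: fundamental_group_def loop_class_def linepath_refl)

lemma loop_class_reversepath:
  assumes "p \<in> loops_at S x"
  shows "loop_class (reversepath p) \<otimes>\<^bsub>fundamental_group S x\<^esub> loop_class p = \<one>\<^bsub>fundamental_group S x\<^esub>"
proof -
  have p: "p \<in> paths_in S x x" "reversepath p \<in> loops_at S x" "reversepath p +++ p \<in> loops_at S x"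
    using assms by (auto simp: loops_at_eq)
  then have "homotopic_paths S (reversepath p +++ p) (linepath x x)"
    using homotopic_paths_linv[of p S] by (auto simp: paths_in_def)
  then show ?thesis
    using assms p const_loop by (simp add: mult_fundamental_group one_fundamental_group loop_class_eq_iff)
qed

lemma group_fundamental_group: "group (fundamental_group S x)"
proof (rule groupI)
  fix A B assume "A \<in> carrier (fundamental_group S x)" "B \<in> carrier (fundamental_group S x)"
  then show "A \<otimes>\<^bsub>fundamental_group S x\<^esub> B \<in> carrier (fundamental_group S x)"
    by (auto simp: carrier_fundamental_group mult_fundamental_group loops_at_eq)
next
  show "\<one>\<^bsub>fundamental_group S x\<^esub> \<in> carrier (fundamental_group S x)"
    using const_loop by (auto simp: carrier_fundamental_group one_fundamental_group)
next
  fix A B C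
  assume "A \<in> carrier (fundamental_group S x)" "B \<in> carrier (fundamental_group S x)"
    "C \<in> carrier (fundamental_group S x)"
  then obtain p q r where *: "p \<in> loops_at S x" "q \<in> loops_at S x" "r \<in> loops_at S x"
    "A = loop_class p" "B = loop_class q" "C = loop_class r"
    by (auto simp: carrier_fundamental_group)
  moreover from * have "loop_class (p +++ q +++ r) = loop_class ((p +++ q) +++ r)"
    by (subst loop_class_eq_iff) (auto simp: loops_at_eq intro!: homotopic_assoc)
  moreover from * have "p +++ q \<in> loops_at S x" "q +++ r \<in> loops_at S x"
    by (auto simp: loops_at_eq)
  ultimately show "A \<otimes>\<^bsub>fundamental_group S x\<^esub> B \<otimes>\<^bsub>fundamental_group S x\<^esub> C =
      A \<otimes>\<^bsub>fundamental_group S x\<^esub> (B \<otimes>\<^bsub>fundamental_group S x\<^esub> C)"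
    by (simp add: mult_fundamental_group)
next
  fix A assume "A \<in> carrier (fundamental_group S x)"
  then obtain p where p: "p \<in> loops_at S x" "A = loop_class p"
    by (auto simp: carrier_fundamental_group)
  have "loop_class (linepath x x +++ p) = loop_class p"
    using p x by (subst loop_class_eq_iff) (auto simp: loops_at_eq paths_in_def path_image_join intro: homotopic_paths_lid')
  then show "\<one>\<^bsub>fundamental_group S x\<^esub> \<otimes>\<^bsub>fundamental_group S x\<^esub> A = A"
    using p const_loop by (simp add: one_fundamental_group mult_fundamental_group)
  show "\<exists>B\<in>carrier (fundamental_group S x). B \<otimes>\<^bsub>fundamental_group S x\<^esub> A = \<one>\<^bsub>fundamental_group S x\<^esub>"
    using p loop_class_reversepath
    by (intro bexI[of _ "loop_class (reversepath p)"]) (auto simp: carrier_fundamental_group loops_at_eq)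
qed

lemma path_words_of_loops:
  assumes "L \<subseteq> loops_at S x" "q \<in> path_words S L"
  shows "path q" "path_image q \<subseteq> S"
  using path_words_in[of L S q] assms by (auto simp: loops_at_def)

text \<open>Constant paths at all points of \<open>S\<close> are words, so the group statement is
  restricted to words that start at \<open>x\<close>. That words are closed is proved along with it:
  it makes both factors of a product loops at the same point.\<close>

lemma path_words_generate:
  assumes L: "L \<subseteq> loops_at S x" and p: "p \<in> path_words S L"
  shows "pathstart p = pathfinish p \<and>
    (pathstart p = x \<longrightarrow> loop_class p \<in> generate (fundamental_group S x) (loop_class ` L))"
  using p
proof (induction)
  case (const a)
  then show ?case
    using generate.one[of "fundamental_group S x"]
    by (auto simp: one_fundamental_group simp del: linepath_trivial)
next
  case (incl p)
  then show ?case
    using L by (auto simp: loops_at_def intro: generate.incl)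
next
  case (join p q)
  have "loop_class (p +++ q) \<in> generate (fundamental_group S x) (loop_class ` L)" if "pathstart p = x"
  proof -
    have "p \<in> loops_at S x" "q \<in> loops_at S x"
      using path_words_of_loops[OF L join.hyps(1)] path_words_of_loops[OF L join.hyps(2)] join that
      by (auto simp: loops_at_def)
    moreover have "loop_class p \<otimes>\<^bsub>fundamental_group S x\<^esub> loop_class q
        \<in> generate (fundamental_group S x) (loop_class ` L)"
      using join that by (intro generate.eng) auto
    ultimately show ?thesis
      by (simp add: mult_fundamental_group)
  qed
  with join.IH join.hyps(3) show ?case by (metis pathstart_join pathfinish_join)
next
  case (rev p)
  interpret group "fundamental_group S x" by (rule group_fundamental_group)
  have "loop_class (reversepath p) \<in> generate (fundamental_group S x) (loop_class ` L)" if "pathstart p = x"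
  proof -
    have p: "p \<in> loops_at S x" "reversepath p \<in> loops_at S x"
      using path_words_of_loops[OF L rev.hyps] rev.IH that by (auto simp: loops_at_def)
    then have inv: "loop_class (reversepath p) = inv\<^bsub>fundamental_group S x\<^esub> loop_class p"
      using loop_class_reversepath
      by (intro inv_equality[symmetric]) (auto simp: carrier_fundamental_group)
    have sub: "loop_class ` L \<subseteq> carrier (fundamental_group S x)"
      using L by (auto simp: carrier_fundamental_group)
    have "loop_class p \<in> generate (fundamental_group S x) (loop_class ` L)"
      using rev.IH that by blast
    from generate_m_inv_closed[OF sub this] inv show ?thesis
      by (simp only:)
  qed
  moreover have "pathstart (reversepath p) = pathfinish p" "pathfinish (reversepath p) = pathstart p"
    by simp_all
  ultimately show ?case
    using rev.IH by metis
next
  case (homotopic p q)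
  have ends: "pathstart q = pathstart p" "pathfinish q = pathfinish p"
    using homotopic_paths_imp_pathstart[OF homotopic.hyps(2)] homotopic_paths_imp_pathfinish[OF homotopic.hyps(2)]
    by simp_all
  have "loop_class q = loop_class p" if "pathstart p = x"
  proof -
    have p: "p \<in> paths_in S x x"
      using path_words_of_loops[OF L homotopic.hyps(1)] homotopic.IH that by (simp add: paths_in_def)
    then have "q \<in> paths_in S x x"
      by (rule paths_in_homotopic[OF homotopic.hyps(2)])
    with p have "loop_class p = loop_class q"
      using homotopic.hyps(2) by (subst loop_class_eq_iff) (simp_all add: loops_at_eq)
    then show ?thesis by (rule sym)
  qed
  with homotopic.IH ends show ?case by metis
qed

end

lemma has_presentation_fundamental_group:
  assumes "pi1_rank_le S n" "n \<le> m" "x \<in> S"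
  shows "has_presentation (fundamental_group S x) m"
proof -
  let ?G = "fundamental_group S x"
  interpret group ?G by (rule group_fundamental_group[OF assms(3)])
  obtain L where L: "L \<subseteq> loops_at S x" "finite L" "card L \<le> n" "loops_at S x \<subseteq> path_words S L"
    using pi1_rank_le_at[OF assms(1,3)] by auto
  obtain l where l: "l ` {..<card L} = L"
    using ex_bij_betw_nat_finite[OF L(2)] by (auto simp: bij_betw_def atLeast0LessThan)
  \<comment> \<open>The unit pads the list of at most \<open>n\<close> loop classes to exactly
    \<open>m\<close> generators.\<close>
  define g where "g i = (if i < card L then loop_class S x (l i) else \<one>\<^bsub>?G\<^esub>)" for i
  have g: "g i \<in> carrier ?G" for i
    using l L(1) one_closed by (auto simp: g_def carrier_fundamental_group[OF assms(3)] simp del: one_closed)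
  have "loop_class S x ` L \<subseteq> g ` {..<m}"
  proof -
    have "loop_class S x (l i) \<in> g ` {..<m}" if "i < card L" for i
      using that L(3) assms(2) by (intro image_eqI[of _ _ i]) (auto simp: g_def)
    then have "loop_class S x ` l ` {..<card L} \<subseteq> g ` {..<m}"
      by auto
    then show ?thesis unfolding l .
  qed
  then have "generate ?G (loop_class S x ` L) \<subseteq> generate ?G (g ` {..<m})"
    by (rule mono_generate)
  moreover have "carrier ?G \<subseteq> generate ?G (loop_class S x ` L)"
  proof
    fix A assume "A \<in> carrier ?G"
    then obtain p where "p \<in> loops_at S x" "A = loop_class S x p"
      by (auto simp: carrier_fundamental_group[OF assms(3)])
    then show "A \<in> generate ?G (loop_class S x ` L)"
      using path_words_generate[OF assms(3) L(1), of p] L(4) by (auto simp: loops_at_def)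
  qed
  moreover have "generate ?G (g ` {..<m}) \<subseteq> carrier ?G"
    using g by (intro generate_incl) auto
  ultimately show ?thesis
    using g by (intro has_presentation_if_generated[where g = g] is_group) auto
qed

section \<open>Open stars in simplicial complexes\<close>

definition cell_union :: "'a::euclidean_space set set \<Rightarrow> 'a set" where
  "cell_union Y = \<Union>(rel_interior ` Y)"

definition star :: "'a set set \<Rightarrow> 'a set \<Rightarrow> 'a set set" where
  "star C c = {S \<in> C. c \<subseteq> S}"

text \<open>The families whose open simplices have an open union in the complex. The empty face lies
  below every simplex, so a family that contains it is all of \<open>C\<close>; for this reason
  \<open>{}\<close> is kept out of the families built later.\<close>

definition upper_set :: "'a set set \<Rightarrow> 'a set set \<Rightarrow> bool" where
  "upper_set C Y \<longleftrightarrow> Y \<subseteq> C \<and> (\<forall>S\<in>Y. \<forall>S'\<in>C. S \<subseteq> S' \<longrightarrow> S' \<in> Y)"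

definition tets :: "'a::euclidean_space set set \<Rightarrow> 'a set set" where
  "tets C = {S \<in> C. 3 simplex S}"

lemma upper_set_star: "upper_set C (star C c)"
  by (auto simp: upper_set_def star_def)

lemma upper_set_Un: "upper_set C Y \<Longrightarrow> upper_set C Z \<Longrightarrow> upper_set C (Y \<union> Z)"
  by (auto simp: upper_set_def)

lemma cell_union_Un: "cell_union (Y \<union> Z) = cell_union Y \<union> cell_union Z"
  by (auto simp: cell_union_def)

context
  fixes C :: "'a::euclidean_space set set"
  assumes C: "simplicial_complex C"
begin

lemma sc_simplex: "S \<in> C \<Longrightarrow> \<exists>n. n simplex S"
  using C by (auto simp: simplicial_complex_def)

lemma sc_convex: "S \<in> C \<Longrightarrow> convex S"
  using sc_simplex convex_simplex by blast

lemma sc_closed: "S \<in> C \<Longrightarrow> closed S"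
  using sc_simplex closed_simplex by blast

lemma sc_finite: "finite C"
  using C by (auto simp: simplicial_complex_def)

lemma sc_subset_face: "S \<in> C \<Longrightarrow> S' \<in> C \<Longrightarrow> S \<subseteq> S' \<Longrightarrow> S face_of S'"
  using C unfolding simplicial_complex_def by (metis inf.absorb_iff2 inf_commute)

text \<open>The face \<open>S \<inter> S'\<close> of \<open>S\<close> contains a relative interior
  point of \<open>S\<close> and is therefore all of \<open>S\<close>.\<close>

lemma sc_rel_interior_subset:
  assumes "S \<in> C" "S' \<in> C" "x \<in> rel_interior S" "x \<in> S'"
  shows "S \<subseteq> S'"
proof -
  have "(S \<inter> S') face_of S"
    using C assms by (auto simp: simplicial_complex_def)
  then have "S \<subseteq> S \<inter> S'"
    using assms rel_interior_subset by (intro subset_of_face_of[of "S \<inter> S'" S S]) auto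
  then show ?thesis by auto
qed

lemma sc_rel_interior_unique:
  "S \<in> C \<Longrightarrow> S' \<in> C \<Longrightarrow> x \<in> rel_interior S \<Longrightarrow> x \<in> rel_interior S' \<Longrightarrow> S = S'"
  using rel_interior_subset
  by (intro subset_antisym sc_rel_interior_subset[of _ _ x]) auto

text \<open>Take a simplex of least dimension that contains \<open>x\<close>: if \<open>x\<close>
  were on its relative frontier, a facet, again in \<open>C\<close>, would contain
  \<open>x\<close>.\<close>

lemma sc_carrier:
  assumes "x \<in> S" "S \<in> C"
  obtains S0 where "S0 \<in> C" "x \<in> rel_interior S0"
proof -
  let ?m = "\<lambda>T. nat (aff_dim T + 1)"
  obtain T where T: "T \<in> C" "x \<in> T" and min: "\<And>T'. T' \<in> C \<Longrightarrow> x \<in> T' \<Longrightarrow> ?m T \<le> ?m T'"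
    using ex_has_least_nat[of "\<lambda>T. T \<in> C \<and> x \<in> T" S ?m] assms by auto
  have "x \<in> rel_interior T"
  proof (rule ccontr)
    assume "x \<notin> rel_interior T"
    then have "x \<in> rel_frontier T"
      using T sc_closed by (auto simp: rel_frontier_def)
    moreover have "polyhedron T"
      using sc_simplex[OF T(1)] simplex_imp_polyhedron by blast
    ultimately obtain F where F: "F facet_of T" "x \<in> F"
      by (auto simp: rel_frontier_of_polyhedron)
    then have "F \<in> C" using T C by (auto simp: simplicial_complex_def facet_of_def)
    with min[OF this F(2)] F show False
      using aff_dim_geq[of F] by (auto simp: facet_of_def aff_dim_empty)
  qed
  with T that show ?thesis by blast
qed

text \<open>The complement is the union of the finitely many closed simplices outside
  \<open>Y\<close>; upward closure says that none of these has a face in \<open>Y\<close>.\<close>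

lemma openin_cell_union:
  assumes "upper_set C Y"
  shows "openin (top_of_set (\<Union>C)) (cell_union Y)"
proof -
  have "cell_union Y = \<Union>C - \<Union>(C - Y)"
  proof (rule equalityI; rule subsetI)
    fix x assume "x \<in> cell_union Y"
    then obtain S where S: "S \<in> Y" "x \<in> rel_interior S" by (auto simp: cell_union_def)
    with assms have "S \<in> C" by (auto simp: upper_set_def)
    have "x \<notin> S'" if "S' \<in> C - Y" for S'
    proof
      assume "x \<in> S'"
      then have "S \<subseteq> S'"
        using sc_rel_interior_subset[OF \<open>S \<in> C\<close> _ S(2)] that by blast
      then show False
        using assms that S(1) by (auto simp: upper_set_def)
    qed
    moreover have "x \<in> S"
      using S(2) rel_interior_subset by blast
    ultimately show "x \<in> \<Union>C - \<Union>(C - Y)"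
      using \<open>S \<in> C\<close> by blast
  next
    fix x assume "x \<in> \<Union>C - \<Union>(C - Y)"
    then obtain S where "S \<in> C" "x \<in> S" "x \<notin> \<Union>(C - Y)" by blast
    moreover then obtain S0 where "S0 \<in> C" "x \<in> rel_interior S0" using sc_carrier by blast
    moreover then have "x \<in> S0" using rel_interior_subset by blast
    ultimately show "x \<in> cell_union Y"
      unfolding cell_union_def by blast
  qed
  moreover have "closed (\<Union>(C - Y))"
    using sc_finite sc_closed by (intro closed_Union) auto
  then have "closedin (top_of_set (\<Union>C)) (\<Union>(C - Y))"
    by (intro closed_subset) auto
  ultimately show ?thesis
    by (metis openin_diff openin_subtopology_self)
qed

lemma openin_cell_union_gen:
  assumes "upper_set C Y" "upper_set C Z" "Y \<subseteq> Z"
  shows "openin (top_of_set (cell_union Z)) (cell_union Y)"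
proof -
  have "cell_union Z \<subseteq> \<Union>C"
    using assms(2) rel_interior_subset unfolding cell_union_def upper_set_def by blast
  moreover have "cell_union Y \<subseteq> cell_union Z"
    using assms(3) by (auto simp: cell_union_def)
  ultimately show ?thesis
    using openin_cell_union[OF assms(1)] openin_subset_trans by blast
qed

lemma cell_union_Int:
  assumes "Y \<subseteq> C" "Z \<subseteq> C"
  shows "cell_union Y \<inter> cell_union Z = cell_union (Y \<inter> Z)"
proof -
  have "S = S'" if "S \<in> Y" "S' \<in> Z" "x \<in> rel_interior S" "x \<in> rel_interior S'" for S S' x
    using that assms sc_rel_interior_unique[of S S' x] by blast
  then show ?thesis
    unfolding cell_union_def by blast
qed

text \<open>The star is starlike about any relative interior point of \<open>c\<close>: a segment
  from a point of an open simplex \<open>S\<close> above \<open>c\<close> to that centre stays in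
  the open simplex until its end.\<close>

lemma simply_connected_star:
  assumes "c \<in> C" "c \<noteq> {}"
  shows "simply_connected (cell_union (star C c))"
proof (rule starlike_imp_simply_connected)
  obtain b where b: "b \<in> rel_interior c"
    using assms sc_convex rel_interior_eq_empty by blast
  show "starlike (cell_union (star C c))"
    unfolding starlike_def
  proof (intro bexI[of _ b] ballI)
    show "b \<in> cell_union (star C c)"
      using b assms by (auto simp: cell_union_def star_def)
    fix x assume "x \<in> cell_union (star C c)"
    then obtain S where S: "S \<in> C" "c \<subseteq> S" "x \<in> rel_interior S"
      by (auto simp: cell_union_def star_def)
    have "b \<in> closure S"
      using b S rel_interior_subset closure_subset by blast
    then have "open_segment x b \<subseteq> rel_interior S"
      using S sc_convex by (intro rel_interior_closure_convex_segment) auto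
    then show "closed_segment b x \<subseteq> cell_union (star C c)"
      using b assms S unfolding closed_segment_eq_open cell_union_def star_def
      by (auto simp: open_segment_commute)
  qed
qed

section \<open>Joining open simplices by chains of tetrahedra\<close>

lemma path_connected_rel_interior: "S \<in> C \<Longrightarrow> path_connected (rel_interior S)"
  using sc_convex convex_rel_interior convex_imp_path_connected by blast

lemma path_component_incident_cells:
  assumes "S \<in> Y" "D \<in> Y" "Y \<subseteq> C" "S \<subseteq> D" "x \<in> rel_interior S" "y \<in> rel_interior D"
  shows "path_component (cell_union Y) x y"
proof -
  have "x \<in> closure D"
    using assms rel_interior_subset closure_subset by blast
  then have "open_segment y x \<subseteq> rel_interior D"
    using assms sc_convex by (intro rel_interior_closure_convex_segment) auto
  then have "closed_segment x y \<subseteq> cell_union Y"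
    using assms unfolding closed_segment_eq_open cell_union_def
    by (auto simp: open_segment_commute)
  then show ?thesis
    by (metis path_component_def path_image_linepath path_linepath pathfinish_linepath pathstart_linepath)
qed

definition tet_adjacency :: "'a set set \<Rightarrow> 'a set \<Rightarrow> ('a set \<times> 'a set) set" where
  "tet_adjacency A c = {(E, E'). E \<in> tets C \<and> E' \<in> tets C \<and> (\<exists>s\<in>A. c \<subseteq> s \<and> s \<subseteq> E \<and> s \<subseteq> E')}"

text \<open>A cell of the intersection lies in a tetrahedron around \<open>c\<close>, and all
  tetrahedra belong to \<open>Y\<close>. Consecutive tetrahedra of a chain are joined through the
  open simplex of \<open>A\<close> that they share, which belongs to \<open>Y\<close> and to the
  star as well.\<close>

lemma path_connected_Int_star:
  assumes Y: "upper_set C Y" and c: "c \<in> C" "c \<noteq> {}"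
    and pure: "\<And>S. S \<in> C \<Longrightarrow> \<exists>D\<in>tets C. S \<subseteq> D" and tetsY: "tets C \<subseteq> Y" and A: "A \<subseteq> Y"
    and conn: "\<And>D D'. D \<in> tets C \<Longrightarrow> D' \<in> tets C \<Longrightarrow> c \<subseteq> D \<Longrightarrow> c \<subseteq> D' \<Longrightarrow> (D, D') \<in> (tet_adjacency A c)\<^sup>*"
  shows "path_connected (cell_union Y \<inter> cell_union (star C c))"
    and "cell_union Y \<inter> cell_union (star C c) \<noteq> {}"
proof -
  let ?Z = "Y \<inter> star C c"
  have YC: "Y \<subseteq> C" using Y by (auto simp: upper_set_def)
  have eq: "cell_union Y \<inter> cell_union (star C c) = cell_union ?Z"
    using YC by (intro cell_union_Int) (auto simp: star_def)
  have ne: "rel_interior S \<noteq> {}" if "S \<in> ?Z" for S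
    using that c sc_convex rel_interior_eq_empty by (force simp: star_def)
  obtain D0 where D0: "D0 \<in> tets C" "c \<subseteq> D0" using pure c by blast
  have D0Z: "D0 \<in> ?Z" using D0 tetsY YC by (auto simp: star_def)
  then obtain b where b: "b \<in> rel_interior D0" using ne by blast
  then show "cell_union Y \<inter> cell_union (star C c) \<noteq> {}"
    unfolding eq cell_union_def using D0Z by blast
  have inc: "path_component (cell_union ?Z) x y"
    if "S \<in> ?Z" "D \<in> ?Z" "S \<subseteq> D" "x \<in> rel_interior S" "y \<in> rel_interior D" for S D x y
    using that YC by (intro path_component_incident_cells) auto
  have tet: "path_component (cell_union ?Z) b y" if "(D0, D) \<in> (tet_adjacency A c)\<^sup>*" "y \<in> rel_interior D" for D y
    using that
  proof (induction arbitrary: y rule: rtrancl_induct)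
    case base
    then show ?case using inc[OF D0Z D0Z _ b] by auto
  next
    case (step E E')
    then obtain s where s: "s \<in> A" "c \<subseteq> s" "s \<subseteq> E" "s \<subseteq> E'" "E \<in> tets C" "E' \<in> tets C"
      by (auto simp: tet_adjacency_def)
    then have Z: "s \<in> ?Z" "E \<in> ?Z" "E' \<in> ?Z"
      using A tetsY YC by (auto simp: star_def)
    then obtain p q where pq: "p \<in> rel_interior E" "q \<in> rel_interior s" using ne by blast
    have "path_component (cell_union ?Z) b p" using step.IH pq by blast
    moreover have "path_component (cell_union ?Z) p q" using inc[of s E q p] Z s pq path_component_sym by blast
    moreover have "path_component (cell_union ?Z) q y" using inc[of s E' q y] Z s pq step.prems by blast
    ultimately show ?case using path_component_trans by blast
  qed
  have "path_component (cell_union ?Z) b x" if x: "x \<in> cell_union ?Z" for x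
  proof -
    obtain S where S: "S \<in> ?Z" "x \<in> rel_interior S" using x by (auto simp: cell_union_def)
    obtain D where D: "D \<in> tets C" "S \<subseteq> D" using pure S YC by blast
    then have DZ: "D \<in> ?Z" "c \<subseteq> D" using S tetsY YC by (auto simp: star_def)
    then obtain y where y: "y \<in> rel_interior D" using ne by blast
    have "path_component (cell_union ?Z) b y"
      using conn[OF D0(1) D(1) D0(2) DZ(2)] y tet by blast
    moreover have "path_component (cell_union ?Z) x y" using inc S DZ D y by blast
    ultimately show ?thesis using path_component_sym path_component_trans by blast
  qed
  then show "path_connected (cell_union Y \<inter> cell_union (star C c))"
    unfolding eq path_connected_component using path_component_sym path_component_trans by blast
qed

lemma closed_cell_complex_of:
  assumes "S \<in> C"
  shows "closed_cell (cell_complex_of C) (rel_interior S) = S"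
proof -
  have "closure (rel_interior S) = S"
    using assms sc_convex sc_closed convex_closure_rel_interior by (metis closure_closed)
  moreover have "rel_interior S \<subseteq> \<Union>C" using assms rel_interior_subset by blast
  ultimately show ?thesis
    using assms by (auto simp: closed_cell_def cell_complex_of_def closure_of_subtopology Int_absorb1)
qed

text \<open>Besides the two vertices \<open>E\<close> of the edge, the tetrahedron has two further
  vertices, and a triangle through the edge is spanned by \<open>E\<close> and one of these.\<close>

lemma card_triangles_at_edge:
  assumes D: "D \<in> C" "3 simplex D" and e: "e \<in> C" "1 simplex e"
  shows "card {t \<in> C. 2 simplex t \<and> e \<subseteq> t \<and> t \<subseteq> D} \<le> 2"
proof (cases "e \<subseteq> D")
  case True
  obtain V where V: "\<not> affine_dependent V" "finite V" "card V = 4" "D = convex hull V"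
    using D(2) unfolding simplex_def by (force intro: aff_independent_finite)
  have face: "\<exists>T \<subseteq> V. t = convex hull T \<and> int (card T) = n + 1"
    if t: "t \<in> C" "t \<subseteq> D" "n simplex t" for t n
  proof -
    obtain T where T: "T \<subseteq> V" "t = convex hull T"
      using sc_subset_face[OF t(1) D(1) t(2)] V by (auto simp: face_of_convex_hull_affine_independent)
    have "aff_dim t = n" using t aff_dim_simplex by blast
    moreover have "\<not> affine_dependent T" using T V affine_dependent_subset by blast
    ultimately show ?thesis
      using T by (intro exI[of _ T]) (auto simp: affine_independent_iff_card aff_dim_convex_hull)
  qed
  obtain E where E: "E \<subseteq> V" "e = convex hull E" "card E = 2"
    using face[OF e(1) True e(2)] by auto
  have "{t \<in> C. 2 simplex t \<and> e \<subseteq> t \<and> t \<subseteq> D} \<subseteq> (\<lambda>v. convex hull (insert v E)) ` (V - E)"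
  proof
    fix t assume t: "t \<in> {t \<in> C. 2 simplex t \<and> e \<subseteq> t \<and> t \<subseteq> D}"
    then obtain T where T: "T \<subseteq> V" "t = convex hull T" "card T = 3"
      using face[of t 2] by auto
    \<comment> \<open>By affine independence of \<open>V\<close>, a vertex lies in the hull of
      \<open>T\<close> only if it is a member of \<open>T\<close>.\<close>
    have "E \<subseteq> T"
    proof
      fix v assume v: "v \<in> E"
      then have "v \<in> convex hull T" using t T E hull_subset by fast
      show "v \<in> T"
      proof (rule ccontr)
        assume "v \<notin> T"
        then have "T \<subseteq> V - {v}" using T by auto
        then have "v \<in> affine hull (V - {v})"
          using \<open>v \<in> convex hull T\<close> convex_hull_subset_affine_hull hull_mono by blast
        then show False using V(1) v E by (auto simp: affine_dependent_def)
      qed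
    qed
    then have "card (T - E) = 1"
      using T E V(2) by (subst card_Diff_subset) (auto intro: finite_subset)
    then obtain v where "T - E = {v}" by (auto simp: card_1_singleton_iff)
    then show "t \<in> (\<lambda>v. convex hull (insert v E)) ` (V - E)"
      using \<open>E \<subseteq> T\<close> T by (intro image_eqI[of _ _ v]) (auto intro!: arg_cong[of _ _ "(hull) convex"])
  qed
  moreover have "card (V - E) = 2"
    using E V by (subst card_Diff_subset) (auto intro: finite_subset)
  moreover have "card ((\<lambda>v. convex hull (insert v E)) ` (V - E)) \<le> card (V - E)"
    using V(2) by (intro card_image_le) auto
  ultimately show ?thesis
    using V(2) by (metis (no_types, lifting) card_mono finite_Diff finite_imageI le_trans)
next
  case False
  then have "{t \<in> C. 2 simplex t \<and> e \<subseteq> t \<and> t \<subseteq> D} = {}" by auto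
  then show ?thesis by (metis card.empty zero_le)
qed

end

section \<open>Finite regular CW complexes and cellular maps\<close>

abbreviation points :: "'a cell_complex \<Rightarrow> 'a set" where
  "points T \<equiv> topspace (carrier_space T)"

section \<open>The unit ball in coordinates\<close>

lemma topspace_closed_ball_top:
  "topspace (closed_ball_top n) = {x. (\<forall>i\<ge>n. x i = 0) \<and> (\<Sum>i<n. (x i)\<^sup>2) \<le> 1}"
  by (auto simp: closed_ball_top_def topspace_Euclidean_space)

lemma closed_ball_top_eq: "closed_ball_top n = top_of_set (topspace (closed_ball_top n))"
proof -
  have "closed_ball_top n = top_of_set {x. (\<forall>i\<ge>n. x i = 0) \<and> (\<Sum>i<n. (x i)\<^sup>2) \<le> 1}"
    by (simp add: closed_ball_top_def Euclidean_space_def euclidean_product_topology subtopology_subtopology Collect_conj_eq)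
  then show ?thesis
    unfolding topspace_closed_ball_top .
qed

lemma open_ball_set_eq: "open_ball_set n = {x. (\<forall>i\<ge>n. x i = 0) \<and> (\<Sum>i<n. (x i)\<^sup>2) < 1}"
  by (auto simp: open_ball_set_def topspace_Euclidean_space)

lemma bounding_sphere_eq: "bounding_sphere n = {x. (\<forall>i\<ge>n. x i = 0) \<and> (\<Sum>i<n. (x i)\<^sup>2) = 1}"
  by (auto simp: bounding_sphere_def topspace_Euclidean_space)

lemma closed_ball_top_decompose: "topspace (closed_ball_top n) = open_ball_set n \<union> bounding_sphere n"
  by (auto simp: topspace_closed_ball_top open_ball_set_eq bounding_sphere_eq)

lemma open_ball_set_nonempty: "open_ball_set n \<noteq> {}"
proof -
  have "(\<lambda>i. 0) \<in> open_ball_set n" by (simp add: open_ball_set_eq)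
  then show ?thesis by blast
qed

text \<open>The ball is a closed subset of a cube, which is compact by Tychonoff's theorem.
  Compactness makes the images of characteristic maps closed and the whole complex compact.\<close>

lemma compact_space_closed_ball_top: "compact_space (closed_ball_top n)"
proof -
  let ?B = "{x :: nat \<Rightarrow> real. (\<forall>i\<ge>n. x i = 0) \<and> (\<Sum>i<n. (x i)\<^sup>2) \<le> 1}"
  let ?P = "PiE UNIV (\<lambda>i::nat. {-1..1::real})"
  have "compactin (powertop_real UNIV) ?P"
    by (subst compactin_PiE) auto
  then have "compact ?P"
    by (simp add: euclidean_product_topology)
  moreover have "closed ?B"
  proof -
    have eq: "?B = (\<Inter>i\<in>{n..}. {x. x i = 0}) \<inter> {x. (\<Sum>i<n. (x i)\<^sup>2) \<le> 1}" by auto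
    moreover have "closed {x :: nat \<Rightarrow> real. x i = 0}" for i
      by (intro closed_Collect_eq continuous_intros continuous_on_product_coordinates)
    moreover have "closed {x :: nat \<Rightarrow> real. (\<Sum>i<n. (x i)\<^sup>2) \<le> 1}"
      by (intro closed_Collect_le continuous_intros continuous_on_product_coordinates)
    ultimately show ?thesis unfolding eq by (intro closed_Int closed_INT ballI)
  qed
  moreover have "?B \<subseteq> ?P"
  proof
    fix x assume x: "x \<in> ?B"
    have "\<bar>x i\<bar> \<le> 1" for i
    proof (cases "i < n")
      case True
      have "(x i)\<^sup>2 \<le> (\<Sum>j<n. (x j)\<^sup>2)"
        by (rule member_le_sum) (use True in simp_all)
      also have "\<dots> \<le> 1" using x by simp
      finally have "(x i)\<^sup>2 \<le> 1" .
      then show ?thesis by (simp add: abs_square_le_1)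
    qed (use x in auto)
    then have "-1 \<le> x i \<and> x i \<le> 1" for i
      by (metis abs_le_iff minus_le_iff)
    then show "x \<in> ?P" by (auto simp: PiE_def Pi_def extensional_def)
  qed
  ultimately have "compact (?P \<inter> ?B)" "?P \<inter> ?B = ?B"
    by (auto intro: compact_Int_closed)
  then have "compactin euclidean (topspace (closed_ball_top n))"
    by (simp add: topspace_closed_ball_top)
  then show ?thesis
    by (subst closed_ball_top_eq) (rule compact_space_subtopology)
qed

text \<open>The common form of the inclusion in a gluing step, the quotient map in an identification
  step, and all composites of these.\<close>

definition cell_map :: "('a \<Rightarrow> 'b) \<Rightarrow> 'a cell_complex \<Rightarrow> 'b cell_complex \<Rightarrow> bool" where
  "cell_map g T T' \<longleftrightarrow> continuous_map (carrier_space T) (carrier_space T') g \<and>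
     (\<forall>n. \<forall>c\<in>ncells T n. g ` c \<in> ncells T' n) \<and> (\<forall>c\<in>cells T. inj_on g c)"

lemma ncells_subset_cells: "c \<in> ncells T n \<Longrightarrow> c \<in> cells T"
  by (auto simp: cells_def)

lemma cell_map_compose:
  assumes f: "cell_map f T T'" and g: "cell_map g T' T''"
  shows "cell_map (g \<circ> f) T T''"
  unfolding cell_map_def
proof (intro conjI allI ballI)
  show "continuous_map (carrier_space T) (carrier_space T'') (g \<circ> f)"
    using f g by (auto simp: cell_map_def intro: continuous_map_compose)
  fix n c assume "c \<in> ncells T n"
  then show "(g \<circ> f) ` c \<in> ncells T'' n"
    using f g unfolding cell_map_def image_comp[symmetric] by blast
next
  fix c assume "c \<in> cells T"
  then obtain n where "c \<in> ncells T n" by (auto simp: cells_def)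
  then show "inj_on (g \<circ> f) c"
    using f g unfolding cell_map_def by (metis comp_inj_on ncells_subset_cells)
qed

section \<open>Cells and closed cells of a finite regular CW complex\<close>

context
  fixes T :: "'a cell_complex"
  assumes CW: "finite_regular_CW T"
begin

lemma cw_Hausdorff: "Hausdorff_space (carrier_space T)"
  using CW unfolding finite_regular_CW_def by (elim conjE)

lemma cw_finite: "finite (cells T)" "finite (ncells T n)"
proof -
  show "finite (cells T)" using CW unfolding finite_regular_CW_def by (elim conjE)
  then show "finite (ncells T n)" by (rule rev_finite_subset) (auto simp: cells_def)
qed

lemma cw_topspace: "points T = \<Union>(cells T)"
  using CW unfolding finite_regular_CW_def by (elim conjE) (rule sym)

lemma cell_subset_topspace: "c \<in> ncells T n \<Longrightarrow> c \<subseteq> points T"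
  by (auto simp: cw_topspace cells_def)

lemma cw_disjoint:
  assumes "c \<in> ncells T m" "e \<in> ncells T n" "x \<in> c" "x \<in> e"
  shows "m = n \<and> c = e"
proof (rule ccontr)
  assume "\<not> (m = n \<and> c = e)"
  then have "(m, c) \<noteq> (n, e)" by simp
  moreover have "\<forall>m n. \<forall>c \<in> ncells T m. \<forall>e \<in> ncells T n. (m, c) \<noteq> (n, e) \<longrightarrow> c \<inter> e = {}"
    using CW unfolding finite_regular_CW_def by (elim conjE)
  ultimately have "c \<inter> e = {}" using assms(1,2) by blast
  with assms show False by blast
qed

lemma cw_point: "x \<in> points T \<Longrightarrow> \<exists>n. \<exists>c\<in>ncells T n. x \<in> c"
  by (auto simp: cw_topspace cells_def)

lemma cw_char:
  assumes "c \<in> ncells T n"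
  obtains f where "embedding_map (closed_ball_top n) (carrier_space T) f"
    "f ` open_ball_set n = c" "f ` bounding_sphere n \<subseteq> (\<Union>k<n. \<Union>(ncells T k))"
    "f ` topspace (closed_ball_top n) = f ` open_ball_set n \<union> f ` bounding_sphere n"
    "closed_cell T c \<subseteq> f ` topspace (closed_ball_top n)"
    "compactin (carrier_space T) (f ` topspace (closed_ball_top n))"
proof -
  obtain f where f: "embedding_map (closed_ball_top n) (carrier_space T) f"
    "f ` open_ball_set n = c" "f ` bounding_sphere n \<subseteq> (\<Union>k<n. \<Union>(ncells T k))"
    using CW assms unfolding finite_regular_CW_def by meson
  have cont: "continuous_map (closed_ball_top n) (carrier_space T) f"
    using f(1) homeomorphic_imp_continuous_map continuous_map_into_fulltopology
    unfolding embedding_map_def by blast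
  have comp: "compactin (carrier_space T) (f ` topspace (closed_ball_top n))"
    using compact_space_closed_ball_top cont image_compactin unfolding compact_space_def by blast
  have "c \<subseteq> f ` topspace (closed_ball_top n)"
    using f(2) by (auto simp: closed_ball_top_decompose)
  then have "closed_cell T c \<subseteq> f ` topspace (closed_ball_top n)"
    unfolding closed_cell_def
    using comp cw_Hausdorff by (intro closure_of_minimal compactin_imp_closedin)
  then show ?thesis
    using that f comp by (simp add: closed_ball_top_decompose image_Un)
qed

lemma cell_nonempty:
  assumes "c \<in> ncells T n"
  shows "c \<noteq> {}"
proof -
  obtain f where "f ` open_ball_set n = c"
    by (rule cw_char[OF assms])
  then show ?thesis using open_ball_set_nonempty by blast
qed

lemma closed_cell_subset:
  assumes "c \<in> ncells T n"
  shows "closed_cell T c \<subseteq> c \<union> (\<Union>k<n. \<Union>(ncells T k))"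
proof -
  obtain f where f: "f ` open_ball_set n = c" "f ` bounding_sphere n \<subseteq> (\<Union>k<n. \<Union>(ncells T k))"
    "f ` topspace (closed_ball_top n) = f ` open_ball_set n \<union> f ` bounding_sphere n"
    "closed_cell T c \<subseteq> f ` topspace (closed_ball_top n)"
    by (rule cw_char[OF assms])
  then have "closed_cell T c \<subseteq> c \<union> f ` bounding_sphere n" by simp
  also have "\<dots> \<subseteq> c \<union> (\<Union>k<n. \<Union>(ncells T k))"
    using f(2) by (intro Un_mono order_refl)
  finally show ?thesis .
qed

lemma cell_subset_closed_cell: "c \<in> ncells T n \<Longrightarrow> c \<subseteq> closed_cell T c"
  unfolding closed_cell_def by (intro closure_of_subset cell_subset_topspace)

lemma closedin_closed_cell: "closedin (carrier_space T) (closed_cell T c)"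
  by (simp add: closed_cell_def)

lemma closed_cell_topspace: "closed_cell T c \<subseteq> points T"
  by (simp add: closed_cell_def closure_of_subset_topspace)

lemma closed_cell_mono: "c \<subseteq> closed_cell T e \<Longrightarrow> closed_cell T c \<subseteq> closed_cell T e"
  unfolding closed_cell_def by (intro closure_of_minimal) auto

text \<open>The boundary of a closed cell is covered by cells of lower dimension; that it is a union
  of cells is not asserted. Hence incidence is decided by points and dimensions.\<close>

lemma cell_meets_closed_cell:
  assumes "c \<in> ncells T m" "e \<in> ncells T n" "x \<in> c" "x \<in> closed_cell T e"
  shows "(c = e \<and> m = n) \<or> m < n"
proof -
  consider "x \<in> e" | k e' where "k < n" "e' \<in> ncells T k" "x \<in> e'"
    using closed_cell_subset[OF assms(2)] assms(4) by blast
  then show ?thesis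
    using cw_disjoint[OF assms(1) _ assms(3)] assms(2) by cases blast+
qed

lemma same_dim_face: "c \<in> ncells T n \<Longrightarrow> e \<in> ncells T n \<Longrightarrow> x \<in> c \<Longrightarrow> x \<in> closed_cell T e \<Longrightarrow> c = e"
  using cell_meets_closed_cell by blast

lemma cw_compact: "compact_space (carrier_space T)"
proof -
  have "compactin (carrier_space T) (closed_cell T c)" if "c \<in> cells T" for c
  proof -
    obtain n where "c \<in> ncells T n" using \<open>c \<in> cells T\<close> by (auto simp: cells_def)
    then obtain f where "closed_cell T c \<subseteq> f ` topspace (closed_ball_top n)"
      "compactin (carrier_space T) (f ` topspace (closed_ball_top n))"
      by (rule cw_char)
    then show ?thesis
      using closedin_closed_cell closed_compactin by blast
  qed
  then have "compactin (carrier_space T) (\<Union>(closed_cell T ` cells T))"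
    using cw_finite by (intro compactin_Union) auto
  moreover have "\<Union>(closed_cell T ` cells T) = points T"
  proof
    show "\<Union>(closed_cell T ` cells T) \<subseteq> points T"
      using closed_cell_topspace by blast
    show "points T \<subseteq> \<Union>(closed_cell T ` cells T)"
    proof
      fix x assume "x \<in> points T"
      then obtain n c where "c \<in> ncells T n" "x \<in> c" using cw_point by blast
      then show "x \<in> \<Union>(closed_cell T ` cells T)"
        using cell_subset_closed_cell ncells_subset_cells by blast
    qed
  qed
  ultimately show ?thesis
    by (simp add: compact_space_def)
qed

end

context
  fixes T :: "'a cell_complex" and T' :: "'b cell_complex" and g :: "'a \<Rightarrow> 'b"
  assumes CW: "finite_regular_CW T" and CW': "finite_regular_CW T'" and g: "cell_map g T T'"
begin

lemma cell_map_ncells: "c \<in> ncells T n \<Longrightarrow> g ` c \<in> ncells T' n"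
  using g unfolding cell_map_def by blast

lemma cell_map_continuous: "continuous_map (carrier_space T) (carrier_space T') g"
  using g unfolding cell_map_def by blast

lemma cell_map_topspace: "x \<in> points T \<Longrightarrow> g x \<in> points T'"
  using continuous_map_image_subset_topspace[OF cell_map_continuous] by blast

lemma cell_map_inj: "c \<in> ncells T n \<Longrightarrow> inj_on g c"
  using g ncells_subset_cells unfolding cell_map_def by blast

text \<open>A continuous map from a compact space to a Hausdorff space is closed, so it maps
  closures onto closures.\<close>

lemma cell_map_closed_cell:
  assumes "c \<in> ncells T n"
  shows "g ` closed_cell T c = closed_cell T' (g ` c)"
proof
  show "g ` closed_cell T c \<subseteq> closed_cell T' (g ` c)"
    unfolding closed_cell_def using cell_map_continuous
    by (simp add: continuous_map_eq_image_closure_subset image_subset_iff_funcset)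
  have "closed_map (carrier_space T) (carrier_space T') g"
    using cell_map_continuous CW CW' by (intro continuous_imp_closed_map cw_compact cw_Hausdorff)
  then have "closedin (carrier_space T') (g ` closed_cell T c)"
    using closedin_closed_cell[OF CW] by (simp add: closed_map_def)
  moreover have "g ` c \<subseteq> g ` closed_cell T c"
    using cell_subset_closed_cell[OF CW assms] by auto
  ultimately show "closed_cell T' (g ` c) \<subseteq> g ` closed_cell T c"
    unfolding closed_cell_def[of T'] by (intro closure_of_minimal)
qed

lemma cell_map_face: "c \<subseteq> closed_cell T e \<Longrightarrow> e \<in> ncells T n \<Longrightarrow> g ` c \<subseteq> closed_cell T' (g ` e)"
  using cell_map_closed_cell[of e n] by blast

text \<open>Cells are disjoint, so a single image point determines the image cell and its dimension.
  This is how cells are pulled back along \<open>g\<close>.\<close>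

lemma cell_map_dim:
  assumes "c \<in> ncells T m" "x \<in> c" "e \<in> ncells T' n" "g x \<in> e"
  shows "m = n \<and> g ` c = e"
  by (rule cw_disjoint[OF CW' cell_map_ncells[OF assms(1)] assms(3) imageI[OF assms(2)] assms(4)])

end

section \<open>Cellular maps do not fold cells\<close>

definition radius :: "nat \<Rightarrow> (nat \<Rightarrow> real) \<Rightarrow> real" where
  "radius n x = sqrt (\<Sum>i<n. (x i)\<^sup>2)"

definition radial_projection :: "nat \<Rightarrow> (nat \<Rightarrow> real) \<Rightarrow> nat \<Rightarrow> real" where
  "radial_projection n x = (\<lambda>i. x i / radius n x)"

lemma radius_nonneg: "radius n x \<ge> 0"
  by (simp add: radius_def sum_nonneg)

lemma radius_scale: "radius n (\<lambda>i. c * x i) = \<bar>c\<bar> * radius n x"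
  by (simp add: radius_def power_mult_distrib real_sqrt_mult flip: sum_distrib_left)

lemma continuous_on_coordinate: "continuous_on A (\<lambda>x :: nat \<Rightarrow> real. x i)"
  by (rule continuous_on_subset[OF continuous_on_product_coordinates]) auto

lemma continuous_on_radius: "continuous_on A (radius n)"
  unfolding radius_def
  by (intro continuous_intros continuous_on_coordinate)

lemma radius_le_1_iff: "radius n x \<le> 1 \<longleftrightarrow> (\<Sum>i<n. (x i)\<^sup>2) \<le> 1"
  and radius_less_1_iff: "radius n x < 1 \<longleftrightarrow> (\<Sum>i<n. (x i)\<^sup>2) < 1"
  and radius_eq_1_iff: "radius n x = 1 \<longleftrightarrow> (\<Sum>i<n. (x i)\<^sup>2) = 1"
  by (simp_all add: radius_def)

lemma topspace_closed_ball_radius: "topspace (closed_ball_top n) = {x \<in> topspace (Euclidean_space n). radius n x \<le> 1}"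
  and open_ball_radius: "open_ball_set n = {x \<in> topspace (Euclidean_space n). radius n x < 1}"
  and bounding_sphere_radius: "bounding_sphere n = {x \<in> topspace (Euclidean_space n). radius n x = 1}"
  by (simp_all add: topspace_closed_ball_top open_ball_set_eq bounding_sphere_eq topspace_Euclidean_space
      radius_le_1_iff radius_less_1_iff radius_eq_1_iff)

lemma Euclidean_space_eq: "Euclidean_space n = top_of_set (topspace (Euclidean_space n))"
  by (simp add: Euclidean_space_def euclidean_product_topology)

lemma continuous_on_scale: "continuous_on A (\<lambda>r. (\<lambda>i. r * x i) :: nat \<Rightarrow> real)"
  by (intro continuous_on_coordinatewise_then_product continuous_intros)

text \<open>Shrinking towards the centre shows that the closed ball is the closure of the open ball;
  continuity carries this over to the cell. The converse inclusion is part of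
  \<open>cw_char\<close>.\<close>

lemma closed_cell_eq_image:
  assumes CW: "finite_regular_CW T" and c: "c \<in> ncells T n"
    and f: "continuous_map (closed_ball_top n) (carrier_space T) f" "f ` open_ball_set n = c"
  shows "f ` topspace (closed_ball_top n) \<subseteq> closed_cell T c"
proof -
  have "topspace (closed_ball_top n) \<subseteq> Abstract_Topology.closure_of (closed_ball_top n) (open_ball_set n)"
  proof
    fix x assume x: "x \<in> topspace (closed_ball_top n)"
    have "(\<lambda>r. (\<lambda>i. r * x i)) ` closure {0..<1::real} \<subseteq> closure (open_ball_set n)"
    proof (rule image_closure_subset[OF continuous_on_scale closed_closure])
      have "(\<lambda>i. r * x i) \<in> open_ball_set n" if "r \<in> {0..<1}" for r
      proof -
        have "radius n (\<lambda>i. r * x i) \<le> r * 1"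
          using x that unfolding radius_scale topspace_closed_ball_radius
          by (intro mult_mono) (auto simp: radius_nonneg)
        then show ?thesis
          using x that by (simp add: open_ball_radius topspace_closed_ball_radius topspace_Euclidean_space)
      qed
      then show "(\<lambda>r. (\<lambda>i. r * x i)) ` {0..<1} \<subseteq> closure (open_ball_set n)"
        using closure_subset by blast
    qed
    moreover have "x = (\<lambda>r. (\<lambda>i. r * x i)) 1" "(1::real) \<in> closure {0..<1}"
      by simp_all
    ultimately have "x \<in> closure (open_ball_set n)" by blast
    moreover have "open_ball_set n \<subseteq> topspace (closed_ball_top n)"
      by (simp add: closed_ball_top_decompose)
    ultimately show "x \<in> Abstract_Topology.closure_of (closed_ball_top n) (open_ball_set n)"
      using x by (subst closed_ball_top_eq) (simp add: closure_of_subtopology Int_absorb1)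
  qed
  then show ?thesis
    using f continuous_map_eq_image_closure_subset[of "closed_ball_top n" "carrier_space T" f]
    unfolding closed_cell_def by blast
qed

text \<open>A self-map of the ball that is injective inside and maps the sphere to the sphere extends radially
  to a map of the whole space, which is injective on the cone over each part of the sphere on which
  the original map is injective. By invariance of domain, the images of two disjoint open cones that
  share a point of the sphere also share an interior point of the ball.\<close>

lemma ball_map_no_fold:
  fixes \<psi> :: "(nat \<Rightarrow> real) \<Rightarrow> nat \<Rightarrow> real"
  assumes cont: "continuous_map (closed_ball_top n) (closed_ball_top n) \<psi>"
    and opn: "\<psi> ` open_ball_set n \<subseteq> open_ball_set n" "inj_on \<psi> (open_ball_set n)"
    and sph: "\<psi> ` bounding_sphere n \<subseteq> bounding_sphere n"
    and W: "open W1" "open W2" "bounding_sphere n \<inter> W1 \<inter> W2 = {}"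
    and inj: "inj_on \<psi> (bounding_sphere n \<inter> W1)" "inj_on \<psi> (bounding_sphere n \<inter> W2)"
    and ab: "a \<in> bounding_sphere n \<inter> W1" "b \<in> bounding_sphere n \<inter> W2"
  shows "\<psi> a \<noteq> \<psi> b"
proof
  assume eq: "\<psi> a = \<psi> b"
  let ?E = "topspace (Euclidean_space n)"
  let ?B = "topspace (closed_ball_top n)"
  define \<rho> where "\<rho> = radial_projection n"
  \<comment> \<open>Outside the ball the map is continued along rays with the radius preserved; on
    the sphere both formulas agree.\<close>
  define \<Psi> where "\<Psi> u = (if radius n u \<le> 1 then \<psi> u else (\<lambda>i. radius n u * \<psi> (\<rho> u) i))" for u
  have \<rho>: "\<rho> u \<in> bounding_sphere n" if "u \<in> ?E" "radius n u \<noteq> 0" for u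
  proof -
    have "radius n (\<rho> u) = 1"
      using that radius_scale[of n "1 / radius n u" u] radius_nonneg[of n u]
      by (simp add: \<rho>_def radial_projection_def)
    then show ?thesis
      using that by (simp add: bounding_sphere_radius \<rho>_def radial_projection_def topspace_Euclidean_space)
  qed
  have \<rho>_id: "\<rho> u = u" if "radius n u = 1" for u
    using that by (simp add: \<rho>_def radial_projection_def)
  have \<rho>_back: "u = (\<lambda>i. radius n u * \<rho> u i)" if "radius n u \<noteq> 0" for u
    using that by (simp add: \<rho>_def radial_projection_def)
  have cont\<rho>: "continuous_on {u \<in> ?E. radius n u \<noteq> 0} \<rho>"
    unfolding \<rho>_def radial_projection_def
    by (intro continuous_on_coordinatewise_then_product continuous_intros continuous_on_radius
        continuous_on_coordinate) auto
  have cont\<psi>: "continuous_on ?B \<psi>"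
    using cont by (metis closed_ball_top_eq continuous_map_in_subtopology continuous_map_iff_continuous)
  have \<psi>B: "\<psi> u \<in> ?B" if "u \<in> ?B" for u
    using cont that continuous_map_image_subset_topspace by blast
  have closedE: "closed ?E"
    using closedin_Euclidean_space closed_closedin euclidean_product_topology by metis
  have cont\<Psi>: "continuous_on ?E \<Psi>"
  proof -
    let ?A = "{u \<in> ?E. radius n u \<ge> 1}"
    have "closed ?B"
      unfolding topspace_closed_ball_radius Collect_conj_eq Collect_mem_eq
      by (intro closed_Int closedE closed_Collect_le continuous_on_radius continuous_intros)
    moreover have "closed ?A"
      unfolding Collect_conj_eq Collect_mem_eq
      by (intro closed_Int closedE closed_Collect_le continuous_on_radius continuous_intros)
    moreover have "continuous_on ?A (\<lambda>u. (\<lambda>i. radius n u * \<psi> (\<rho> u) i))"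
    proof (intro continuous_on_coordinatewise_then_product continuous_intros continuous_on_radius)
      fix i
      have "continuous_on ?A (\<psi> \<circ> \<rho>)"
      proof (intro continuous_on_compose)
        show "continuous_on ?A \<rho>"
          by (rule continuous_on_subset[OF cont\<rho>]) auto
        have "\<rho> ` ?A \<subseteq> ?B"
          using \<rho> by (auto simp: closed_ball_top_decompose)
        then show "continuous_on (\<rho> ` ?A) \<psi>"
          by (rule continuous_on_subset[OF cont\<psi>])
      qed
      then show "continuous_on ?A (\<lambda>u. \<psi> (\<rho> u) i)"
        using continuous_on_product_then_coordinatewise by (fastforce simp: o_def)
    qed
    ultimately have "continuous_on (?B \<union> ?A) \<Psi>"
      unfolding \<Psi>_def using cont\<psi>
      by (intro continuous_on_cases) (auto simp: \<rho>_id topspace_closed_ball_radius)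
    moreover have "?B \<union> ?A = ?E"
      by (auto simp: topspace_closed_ball_radius)
    ultimately show ?thesis by simp
  qed
  have \<Psi>E: "\<Psi> u \<in> ?E" if "u \<in> ?E" for u
  proof (cases "radius n u \<le> 1")
    case True
    then show ?thesis
      using \<psi>B[of u] that by (simp add: \<Psi>_def topspace_closed_ball_radius)
  next
    case False
    then have "\<psi> (\<rho> u) \<in> bounding_sphere n"
      using \<rho>[OF that] sph by auto
    then show ?thesis
      using False by (simp add: \<Psi>_def bounding_sphere_radius topspace_Euclidean_space)
  qed
  have inside: "radius n (\<Psi> u) < 1" if "u \<in> ?E" "radius n u < 1" for u
    using that opn(1) by (auto simp: \<Psi>_def open_ball_radius)
  have outside: "\<Psi> u = (\<lambda>i. radius n u * \<psi> (\<rho> u) i)" "radius n (\<Psi> u) = radius n u" if "u \<in> ?E" "radius n u \<ge> 1" for u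
  proof -
    show *: "\<Psi> u = (\<lambda>i. radius n u * \<psi> (\<rho> u) i)"
      using that by (cases "radius n u = 1") (auto simp: \<Psi>_def \<rho>_id)
    have "radius n (\<psi> (\<rho> u)) = 1"
      using \<rho>[of u] that sph by (auto simp: bounding_sphere_radius)
    then show "radius n (\<Psi> u) = radius n u"
      unfolding * radius_scale using radius_nonneg[of n u] by simp
  qed
  \<comment> \<open>The cone extends beyond the ball, so it is open in the whole space, as
    invariance of domain demands. The centre is left out because it has no direction.\<close>
  define cone where "cone W = {u \<in> ?E. radius n u \<noteq> 0 \<and> \<rho> u \<in> W}" for W
  have open_image: "openin (Euclidean_space n) (\<Psi> ` cone W)"
    if "open W" "inj_on \<psi> (bounding_sphere n \<inter> W)" for W
  proof (rule invariance_of_domain_Euclidean_space)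
    have "openin (top_of_set {u \<in> ?E. radius n u \<noteq> 0}) ({u \<in> ?E. radius n u \<noteq> 0} \<inter> \<rho> -` W)"
      by (rule continuous_openin_preimage_gen[OF cont\<rho> that(1)])
    moreover have "openin (top_of_set ?E) {u \<in> ?E. radius n u \<noteq> 0}"
      using continuous_openin_preimage_gen[OF continuous_on_radius[of ?E n], of "- {0}"]
      by (simp add: vimage_def Int_def open_Compl)
    ultimately have "openin (top_of_set ?E) ({u \<in> ?E. radius n u \<noteq> 0} \<inter> \<rho> -` W)"
      by (rule openin_trans)
    moreover have "{u \<in> ?E. radius n u \<noteq> 0} \<inter> \<rho> -` W = cone W"
      by (auto simp: cone_def)
    ultimately have "openin (top_of_set ?E) (cone W)" by simp
    then show "openin (Euclidean_space n) (cone W)"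
      by (subst Euclidean_space_eq)
    have "cone W \<subseteq> ?E" by (auto simp: cone_def)
    then show "continuous_map (subtopology (Euclidean_space n) (cone W)) (Euclidean_space n) \<Psi>"
      unfolding cm_Euclidean_space_iff_continuous_on
      using cont\<Psi> \<Psi>E by (auto intro: continuous_on_subset)
    show "inj_on \<Psi> (cone W)"
    proof (rule inj_onI)
      fix u v assume u: "u \<in> cone W" and v: "v \<in> cone W" and e: "\<Psi> u = \<Psi> v"
      then have uv: "u \<in> ?E" "v \<in> ?E" "radius n u \<noteq> 0" "radius n v \<noteq> 0" by (auto simp: cone_def)
      show "u = v"
      proof (cases "radius n u < 1")
        case True
        then have "radius n v < 1"
          using inside[OF uv(1)] outside(2)[OF uv(2)] e by force
        with True e have "\<psi> u = \<psi> v" "u \<in> open_ball_set n" "v \<in> open_ball_set n"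
          using uv by (auto simp: \<Psi>_def open_ball_radius)
        then show ?thesis using opn(2) by (auto dest: inj_onD)
      next
        case False
        then have *: "radius n u \<ge> 1" "radius n v \<ge> 1"
          using inside[OF uv(2)] outside(2)[OF uv(1)] e by force+
        then have rad: "radius n u = radius n v"
          using outside(2)[OF uv(1)] outside(2)[OF uv(2)] e by simp
        have "(\<lambda>i. radius n u * \<psi> (\<rho> u) i) = (\<lambda>i. radius n u * \<psi> (\<rho> v) i)"
          using outside(1)[OF uv(1)] outside(1)[OF uv(2)] e rad * by simp
        then have "\<psi> (\<rho> u) = \<psi> (\<rho> v)"
          using uv(3) by (auto simp: fun_eq_iff)
        moreover have "\<rho> u \<in> bounding_sphere n \<inter> W" "\<rho> v \<in> bounding_sphere n \<inter> W"
          using u v \<rho> by (auto simp: cone_def)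
        ultimately have "\<rho> u = \<rho> v" using that(2) by (auto dest: inj_onD)
        then show ?thesis using \<rho>_back[OF uv(3)] \<rho>_back[OF uv(4)] rad by simp
      qed
    qed
  qed
  let ?O = "\<Psi> ` cone W1 \<inter> \<Psi> ` cone W2"
  have "openin (Euclidean_space n) ?O"
    using open_image[OF W(1) inj(1)] open_image[OF W(2) inj(2)] by (rule openin_Int)
  then have "openin (top_of_set ?E) ?O"
    by (subst (asm) Euclidean_space_eq)
  then obtain G where G: "open G" "?O = ?E \<inter> G"
    by (auto simp: openin_open)
  have "a \<in> ?E" "b \<in> ?E" "radius n a = 1" "radius n b = 1"
    using ab by (auto simp: bounding_sphere_radius)
  then have "a \<in> cone W1" "b \<in> cone W2" "\<Psi> a = \<psi> a" "\<Psi> b = \<psi> a"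
    using ab eq by (auto simp: cone_def \<rho>_id \<Psi>_def)
  then have "\<psi> a \<in> ?O" by force
  then have p: "\<psi> a \<in> G" "\<psi> a \<in> ?E" using G by auto
  have rp: "radius n (\<psi> a) = 1" using sph ab by (auto simp: bounding_sphere_radius)
  have "open ((\<lambda>r. (\<lambda>i. r * \<psi> a i)) -` G)"
    by (rule open_vimage[OF G(1) continuous_on_scale])
  moreover have "1 \<in> (\<lambda>r. (\<lambda>i. r * \<psi> a i)) -` G" using p by simp
  ultimately obtain e where e: "e > 0" "ball 1 e \<subseteq> (\<lambda>r. (\<lambda>i. r * \<psi> a i)) -` G"
    by (meson openE)
  \<comment> \<open>Any factor slightly below 1 will do: \<open>?q\<close> below is inside the ball
    and still in both open images.\<close>
  define r where "r = 1 - min (e / 2) (1 / 2)"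
  have r: "0 < r" "r < 1" "r \<in> ball 1 e" using e(1) by (auto simp: r_def dist_real_def min_def)
  let ?q = "\<lambda>i. r * \<psi> a i"
  have "?q \<in> G" using e(2) r(3) by auto
  moreover have "?q \<in> ?E" using p(2) by (simp add: topspace_Euclidean_space)
  ultimately have "?q \<in> ?O" using G(2) by blast
  then obtain u v where u: "u \<in> cone W1" "?q = \<Psi> u" and v: "v \<in> cone W2" "?q = \<Psi> v" by blast
  have "radius n ?q < 1" using r rp by (simp add: radius_scale)
  moreover have uvE: "u \<in> ?E" "v \<in> ?E" using u v by (auto simp: cone_def)
  ultimately have "radius n u < 1" "radius n v < 1"
    using outside(2)[OF uvE(1)] outside(2)[OF uvE(2)] u(2) v(2) by force+
  then have "\<psi> u = \<psi> v" "u \<in> open_ball_set n" "v \<in> open_ball_set n"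
    using uvE u(2) v(2) by (auto simp: \<Psi>_def open_ball_radius)
  then have "u = v" using opn(2) by (auto dest: inj_onD)
  then have "\<rho> u \<in> bounding_sphere n \<inter> W1 \<inter> W2"
    using u(1) v(1) \<rho> by (auto simp: cone_def)
  then show False using W(3) by blast
qed

text \<open>In the coordinates given by characteristic maps of \<open>D\<close> and of its image,
  \<open>g\<close> becomes a self-map of the ball that is injective inside and preserves the sphere.
  The facets \<open>s\<close> and \<open>t\<close> correspond to disjoint open parts of the sphere,
  on each of which this map is injective, so \<open>ball_map_no_fold\<close> forbids a common image
  point.\<close>

lemma cell_map_no_fold:
  assumes CW: "finite_regular_CW T" and CW': "finite_regular_CW T'" and g: "cell_map g T T'"
    and D: "D \<in> ncells T (Suc n)"
    and st: "s \<in> ncells T n" "t \<in> ncells T n" "s \<subseteq> closed_cell T D" "t \<subseteq> closed_cell T D"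
    and eq: "g ` s = g ` t"
  shows "s = t"
proof (rule ccontr)
  assume "s \<noteq> t"
  let ?N = "Suc n"
  let ?X = "carrier_space T" and ?X' = "carrier_space T'"
  let ?B = "topspace (closed_ball_top ?N)" and ?S = "bounding_sphere ?N" and ?O = "open_ball_set ?N"
  obtain h where h: "embedding_map (closed_ball_top ?N) ?X h" "h ` ?O = D"
    "h ` ?S \<subseteq> (\<Union>k<?N. \<Union>(ncells T k))" "closed_cell T D \<subseteq> h ` ?B"
    by (rule cw_char[OF CW D])
  have D': "g ` D \<in> ncells T' ?N"
    by (rule cell_map_ncells[OF CW CW' g D])
  obtain k where k: "embedding_map (closed_ball_top ?N) ?X' k" "k ` ?O = g ` D"
    "closed_cell T' (g ` D) \<subseteq> k ` ?B"
    by (rule cw_char[OF CW' D'])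
  have hcont: "continuous_map (closed_ball_top ?N) ?X h"
    using h(1) homeomorphic_imp_continuous_map continuous_map_into_fulltopology
    unfolding embedding_map_def by blast
  have hinj: "inj_on h ?B"
    using h(1) unfolding embedding_map_def homeomorphic_map_def by blast
  obtain k' where k': "homeomorphic_maps (closed_ball_top ?N) (subtopology ?X' (k ` ?B)) k k'"
    using k(1) unfolding embedding_map_def homeomorphic_map_maps by blast
  have gh: "g (h x) \<in> k ` ?B" if "x \<in> ?B" for x
  proof -
    have "h x \<in> closed_cell T D"
      using closed_cell_eq_image[OF CW D hcont h(2)] that by blast
    then show ?thesis
      using cell_map_closed_cell[OF CW CW' g D] k(3) by blast
  qed
  have k'B: "k' y \<in> ?B" and kk': "k (k' y) = y" if "y \<in> k ` ?B" for y
    using k' that by (auto simp: homeomorphic_maps_def)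
  have k'k: "k' (k x) = x" if "x \<in> ?B" for x
    using k' that by (auto simp: homeomorphic_maps_def)
  define \<psi> where "\<psi> = k' \<circ> (g \<circ> h)"
  have \<psi>_eq: "\<psi> x = \<psi> y \<longleftrightarrow> g (h x) = g (h y)" if "x \<in> ?B" "y \<in> ?B" for x y
    using kk'[OF gh[OF that(1)]] kk'[OF gh[OF that(2)]] by (metis \<psi>_def comp_apply)
  have BO: "?O \<subseteq> ?B" "?S \<subseteq> ?B"
    by (auto simp: closed_ball_top_decompose)
  have low: "\<exists>m\<le>n. \<exists>e\<in>ncells T m. h x \<in> e" if "x \<in> ?S" for x
  proof -
    have "h x \<in> (\<Union>k<?N. \<Union>(ncells T k))"
      using h(3) imageI[OF that] by (rule subsetD)
    then show ?thesis by (simp add: less_Suc_eq_le Bex_def)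
  qed
  have "\<psi> ` ?O \<subseteq> ?O"
  proof
    fix y assume "y \<in> \<psi> ` ?O"
    then obtain x where x: "x \<in> ?O" "y = k' (g (h x))" by (auto simp: \<psi>_def)
    then have "g (h x) \<in> k ` ?O" using h(2) k(2) by blast
    then show "y \<in> ?O" using k'k BO x(2) by auto
  qed
  moreover have "inj_on \<psi> ?O"
  proof (rule inj_onI)
    fix x y assume xy: "x \<in> ?O" "y \<in> ?O" "\<psi> x = \<psi> y"
    then have "g (h x) = g (h y)" using \<psi>_eq BO by blast
    then have "h x = h y"
      using cell_map_inj[OF CW CW' g D] xy h(2) by (metis imageI inj_onD)
    then show "x = y" using hinj xy BO by (metis inj_onD subsetD)
  qed
  moreover have "\<psi> ` ?S \<subseteq> ?S"
  proof
    fix y assume "y \<in> \<psi> ` ?S"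
    then obtain x where x: "x \<in> ?S" "y = k' (g (h x))" by (auto simp: \<psi>_def)
    then have gk: "g (h x) \<in> k ` ?B" using gh BO by blast
    \<comment> \<open>Points of the sphere lie over cells of dimension at most \<open>n\<close>; as
      \<open>g\<close> preserves dimensions, they cannot enter the open cell.\<close>
    have "y \<notin> ?O"
    proof
      assume "y \<in> ?O"
      then have "g (h x) \<in> g ` D" using k(2) kk'[OF gk] x(2) by (metis imageI)
      moreover obtain m e where me: "m \<le> n" "e \<in> ncells T m" "h x \<in> e" using low[OF x(1)] by blast
      ultimately have "m = ?N"
        using cell_map_dim[OF CW CW' g me(2,3) D'] by blast
      with me(1) show False by simp
    qed
    then show "y \<in> ?S" using k'B[OF gk] x(2) by (simp add: closed_ball_top_decompose)
  qed
  moreover have "continuous_map (closed_ball_top ?N) (closed_ball_top ?N) \<psi>"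
    unfolding \<psi>_def
  proof (rule continuous_map_compose)
    show "continuous_map (closed_ball_top ?N) (subtopology ?X' (k ` ?B)) (g \<circ> h)"
      using hcont cell_map_continuous[OF CW CW' g] gh
      by (auto simp: continuous_map_in_subtopology intro: continuous_map_compose)
    show "continuous_map (subtopology ?X' (k ` ?B)) (closed_ball_top ?N) k'"
      using k' by (simp add: homeomorphic_maps_def)
  qed
  \<comment> \<open>The closed cells of all other cells of dimension at most \<open>n\<close> form a
    closed set that misses \<open>c\<close>; on the sphere its complement consists of just the
    points over \<open>c\<close>.\<close>
  moreover have cone: "\<exists>W. open W \<and> (\<forall>x\<in>?S. x \<in> W \<longleftrightarrow> h x \<in> c)" if c: "c \<in> ncells T n" for c
  proof -
    define Z where "Z = \<Union>(closed_cell T ` {e. \<exists>m\<le>n. e \<in> ncells T m \<and> e \<noteq> c})"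
    have "finite {e. \<exists>m\<le>n. e \<in> ncells T m \<and> e \<noteq> c}"
      by (rule finite_subset[OF _ cw_finite(1)[OF CW]]) (auto simp: cells_def)
    then have "closedin ?X Z"
      unfolding Z_def using closedin_closed_cell[OF CW] by (intro closedin_Union) auto
    then have "openin (closed_ball_top ?N) {x \<in> ?B. h x \<in> topspace ?X - Z}"
      by (intro openin_continuous_map_preimage[OF hcont] openin_diff openin_topspace)
    then obtain W where W: "open W" "{x \<in> ?B. h x \<in> topspace ?X - Z} = ?B \<inter> W"
      by (subst (asm) closed_ball_top_eq) (auto simp: openin_open)
    have "x \<in> W \<longleftrightarrow> h x \<in> c" if x: "x \<in> ?S" for x
    proof -
      have "h x \<in> topspace ?X"
        using hcont x BO continuous_map_image_subset_topspace by blast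
      then have "x \<in> W \<longleftrightarrow> h x \<notin> Z" using W(2) x BO by blast
      also have "\<dots> \<longleftrightarrow> h x \<in> c"
      proof
        assume "h x \<notin> Z"
        moreover obtain m e where me: "m \<le> n" "e \<in> ncells T m" "h x \<in> e" using low[OF x] by blast
        moreover have "h x \<in> closed_cell T e"
          using cell_subset_closed_cell[OF CW me(2)] me(3) by blast
        ultimately have "e = c" unfolding Z_def by blast
        with me show "h x \<in> c" by simp
      next
        assume hc: "h x \<in> c"
        show "h x \<notin> Z"
        proof
          assume "h x \<in> Z"
          then obtain m e where me: "m \<le> n" "e \<in> ncells T m" "e \<noteq> c" "h x \<in> closed_cell T e"
            unfolding Z_def by blast
          show False
            using cell_meets_closed_cell[OF CW c me(2) hc me(4)] me(1,3) by auto
        qed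
      qed
      finally show ?thesis .
    qed
    with W(1) show ?thesis by blast
  qed
  obtain W1 where W1: "open W1" "\<forall>x\<in>?S. x \<in> W1 \<longleftrightarrow> h x \<in> s" using cone[OF st(1)] by blast
  obtain W2 where W2: "open W2" "\<forall>x\<in>?S. x \<in> W2 \<longleftrightarrow> h x \<in> t" using cone[OF st(2)] by blast
  have disj: "s \<inter> t = {}"
    using cw_disjoint[OF CW st(1,2)] \<open>s \<noteq> t\<close> by blast
  have inj: "inj_on \<psi> (?S \<inter> W)" if c: "c \<in> ncells T n" and W: "\<forall>x\<in>?S. x \<in> W \<longleftrightarrow> h x \<in> c" for c W
  proof (rule inj_onI)
    fix x y assume xy: "x \<in> ?S \<inter> W" "y \<in> ?S \<inter> W" "\<psi> x = \<psi> y"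
    then have "g (h x) = g (h y)" "h x \<in> c" "h y \<in> c" using \<psi>_eq BO W by blast+
    then have "h x = h y"
      using cell_map_inj[OF CW CW' g c] by (metis inj_onD)
    then show "x = y" using hinj xy BO by (metis IntD1 inj_onD subsetD)
  qed
  have lift: "\<exists>x\<in>?S. h x = y" if c: "y \<in> c" "c \<in> ncells T n" "c \<subseteq> closed_cell T D" for y c
  proof -
    obtain x where x: "x \<in> ?B" "h x = y" using c h(4) by blast
    have "x \<notin> ?O"
    proof
      assume "x \<in> ?O"
      then have "y \<in> D" using h(2) x(2) by blast
      then show False using cw_disjoint[OF CW c(2) D c(1)] by simp
    qed
    with x show ?thesis by (auto simp: closed_ball_top_decompose)
  qed
  obtain y where y: "y \<in> s" using cell_nonempty[OF CW st(1)] by blast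
  then obtain z where z: "z \<in> t" "g z = g y" using eq by (metis imageE imageI)
  obtain a where a: "a \<in> ?S" "h a = y" using lift[OF y st(1,3)] by blast
  obtain b where b: "b \<in> ?S" "h b = z" using lift[OF z(1) st(2,4)] by blast
  have "\<psi> a = \<psi> b" using a b z(2) by (simp add: \<psi>_def)
  moreover have "?S \<inter> W1 \<inter> W2 = {}" using W1(2) W2(2) disj by blast
  moreover have "a \<in> ?S \<inter> W1" "b \<in> ?S \<inter> W2" using a b y z(1) W1(2) W2(2) by auto
  ultimately show False
    using ball_map_no_fold[of ?N \<psi> W1 W2 a b] W1(1) W2(1) inj[OF st(1) W1(2)] inj[OF st(2) W2(2)] by blast
qed

section \<open>Invariants of local constructions\<close>

text \<open>Adjacency in the link of \<open>x\<close>, stated without links: only the closed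
  triangle has to contain the point, however the closed cells meet otherwise.\<close>

definition adjacency_at :: "'a cell_complex \<Rightarrow> 'a \<Rightarrow> ('a set \<times> 'a set) set" where
  "adjacency_at T x = {(D, D'). D \<in> ncells T 3 \<and> D' \<in> ncells T 3 \<and>
     (\<exists>s\<in>ncells T 2. x \<in> closed_cell T s \<and> s \<subseteq> closed_cell T D \<and> s \<subseteq> closed_cell T D')}"

definition locally_strongly_connected :: "'a cell_complex \<Rightarrow> bool" where
  "locally_strongly_connected T \<longleftrightarrow> (\<forall>x \<in> points T. \<forall>D \<in> ncells T 3. \<forall>D' \<in> ncells T 3.
     x \<in> closed_cell T D \<longrightarrow> x \<in> closed_cell T D' \<longrightarrow> (D, D') \<in> (adjacency_at T x)\<^sup>*)"

definition free_faces_at :: "'a cell_complex \<Rightarrow> 'a \<Rightarrow> 'a set set" where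
  "free_faces_at T x = {s \<in> ncells T 2. x \<in> closed_cell T s \<and> card (cofacets 3 T s) = 1}"

text \<open>Two distinct cofacets are demanded rather than a cardinality, since this form is carried
  along directly by maps that keep tetrahedra distinct.\<close>

definition interior_faces :: "'a cell_complex \<Rightarrow> 'a set set" where
  "interior_faces T = {s \<in> ncells T 2. \<exists>D \<in> cofacets 3 T s. \<exists>D' \<in> cofacets 3 T s. D \<noteq> D'}"

text \<open>Informally, the tetrahedra around an edge form a chain with at most two ends. Vertices
  have to be excluded: in a single tetrahedron each vertex already lies in three free
  triangles.\<close>

definition two_free_faces_at_edges :: "'a cell_complex \<Rightarrow> bool" where
  "two_free_faces_at_edges T \<longleftrightarrow> (\<forall>x \<in> \<Union>(ncells T 1). card (free_faces_at T x) \<le> 2)"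

definition two_faces_at_edges :: "'a cell_complex \<Rightarrow> bool" where
  "two_faces_at_edges T \<longleftrightarrow> (\<forall>x \<in> \<Union>(ncells T 1). \<forall>D \<in> ncells T 3.
     card {s \<in> ncells T 2. x \<in> closed_cell T s \<and> s \<subseteq> closed_cell T D} \<le> 2)"

lemma pseudomanifold_CW: "pseudomanifold d T \<Longrightarrow> finite_regular_CW T"
  by (simp add: pseudomanifold_def simplicial_CW_def)

lemma pseudomanifold_pure:
  "pseudomanifold d T \<Longrightarrow> c \<in> ncells T n \<Longrightarrow> \<exists>D \<in> ncells T d. c \<subseteq> closed_cell T D"
  using ncells_subset_cells unfolding pseudomanifold_def pure_dim_def face_le_def by blast

lemma finite_cofacets: "finite_regular_CW T \<Longrightarrow> finite (cofacets d T s)"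
  unfolding cofacets_def using cw_finite(2) by (rule finite_subset[rotated]) auto

lemma mem_cofacets: "D \<in> cofacets d T s \<longleftrightarrow> D \<in> ncells T d \<and> s \<subseteq> closed_cell T D"
  by (simp add: cofacets_def face_le_def)

lemma pseudomanifold_cofacets_card: "pseudomanifold 3 T \<Longrightarrow> s \<in> ncells T 2 \<Longrightarrow> card (cofacets 3 T s) \<le> 2"
  by (simp add: pseudomanifold_def)

lemma card_cofacets_eq_1:
  assumes T: "pseudomanifold 3 T" and s: "s \<in> ncells T 2"
  shows "card (cofacets 3 T s) = 1 \<longleftrightarrow> s \<notin> interior_faces T"
proof -
  obtain D where D: "D \<in> cofacets 3 T s"
    using pseudomanifold_pure[OF T s] by (auto simp: mem_cofacets)
  have fin: "finite (cofacets 3 T s)"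
    by (rule finite_cofacets[OF pseudomanifold_CW[OF T]])
  show ?thesis
  proof
    assume "card (cofacets 3 T s) = 1"
    then obtain E where "cofacets 3 T s = {E}" by (auto simp: card_1_singleton_iff)
    then show "s \<notin> interior_faces T" by (simp add: interior_faces_def)
  next
    assume "s \<notin> interior_faces T"
    then have "cofacets 3 T s = {D}" using D s unfolding interior_faces_def by blast
    then show "card (cofacets 3 T s) = 1" by simp
  qed
qed

text \<open>The faces of free 2-cells form a subcomplex, which thus contains the boundary; and a
  2-cell inside the closed cell of another 2-cell is equal to it.\<close>

lemma boundary_2_cell:
  assumes T: "pseudomanifold 3 T" and s: "s \<in> ncells T 2" "s \<in> boundary_cells 3 T"
  shows "card (cofacets 3 T s) = 1"
proof -
  note CW = pseudomanifold_CW[OF T]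
  let ?S = "{c \<in> cells T. \<exists>s' \<in> ncells T 2. card (cofacets 3 T s') = 1 \<and> c \<subseteq> closed_cell T s'}"
  have "subcomplex T ?S"
    unfolding subcomplex_def face_le_def
  proof (intro conjI ballI impI)
    fix e c assume e: "e \<in> ?S" and c: "c \<in> cells T" "c \<subseteq> closed_cell T e"
    from e obtain s' where s': "s' \<in> ncells T 2" "card (cofacets 3 T s') = 1" "e \<subseteq> closed_cell T s'" by blast
    have "c \<subseteq> closed_cell T s'"
      using c(2) closed_cell_mono[OF CW s'(3)] by (rule subset_trans)
    with c(1) s' show "c \<in> ?S" by blast
  qed blast
  moreover have "{s \<in> ncells T (3 - 1). card (cofacets 3 T s) = 1} \<subseteq> ?S"
    using cell_subset_closed_cell[OF CW] ncells_subset_cells by fastforce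
  ultimately have "s \<in> ?S"
    using s(2) unfolding boundary_cells_def by blast
  then obtain s' where s': "s' \<in> ncells T 2" "card (cofacets 3 T s') = 1" "s \<subseteq> closed_cell T s'" by blast
  obtain x where "x \<in> s" using cell_nonempty[OF CW s(1)] by blast
  then have "s = s'" using same_dim_face[OF CW s(1) s'(1)] s'(3) by blast
  with s' show ?thesis by simp
qed

lemma adjacency_at_cell_map:
  assumes CW: "finite_regular_CW T" and CW': "finite_regular_CW T'" and g: "cell_map g T T'"
    and "(D, D') \<in> (adjacency_at T x)\<^sup>*"
  shows "(g ` D, g ` D') \<in> (adjacency_at T' (g x))\<^sup>*"
  using assms(4)
proof (induction rule: rtrancl_induct)
  case (step E E')
  then obtain s where s: "s \<in> ncells T 2" "x \<in> closed_cell T s" "s \<subseteq> closed_cell T E" "s \<subseteq> closed_cell T E'"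
    and E: "E \<in> ncells T 3" "E' \<in> ncells T 3"
    by (auto simp: adjacency_at_def)
  have "g x \<in> closed_cell T' (g ` s)"
    using cell_map_closed_cell[OF CW CW' g s(1)] s(2) by blast
  moreover have "g ` s \<subseteq> closed_cell T' (g ` E)" "g ` s \<subseteq> closed_cell T' (g ` E')"
    using cell_map_face[OF CW CW' g s(3) E(1)] cell_map_face[OF CW CW' g s(4) E(2)] .
  moreover have "g ` s \<in> ncells T' 2" "g ` E \<in> ncells T' 3" "g ` E' \<in> ncells T' 3"
    using cell_map_ncells[OF CW CW' g] s(1) E by blast+
  ultimately have "(g ` E, g ` E') \<in> adjacency_at T' (g x)"
    unfolding adjacency_at_def by blast
  with step.IH show ?case by (rule rtrancl_into_rtrancl)
qed simp

lemma finite_free_faces: "finite_regular_CW T \<Longrightarrow> finite (free_faces_at T x)"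
  unfolding free_faces_at_def using cw_finite(2) by (rule finite_subset[rotated]) auto

lemma simplex_complex_invariants:
  assumes "is_simplex_complex 3 T"
  obtains D where "ncells T 3 = {D}" "locally_strongly_connected T" "interior_faces T = {}"
    "two_faces_at_edges T \<Longrightarrow> two_free_faces_at_edges T"
proof -
  from assms have T: "pseudomanifold 3 T" by (simp add: is_simplex_complex_def)
  note CW = pseudomanifold_CW[OF T]
  from assms obtain D where D: "D \<in> ncells T 3" "closed_cell T D = points T"
    by (auto simp: is_simplex_complex_def)
  have "E = D" if E: "E \<in> ncells T 3" for E
  proof -
    obtain x where x: "x \<in> E" using cell_nonempty[OF CW E] by blast
    then have "x \<in> closed_cell T D" using cell_subset_topspace[OF CW E] D(2) by blast
    then show ?thesis using same_dim_face[OF CW E D(1) x] by blast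
  qed
  then have eq: "ncells T 3 = {D}" using D(1) by blast
  moreover have "locally_strongly_connected T"
    unfolding locally_strongly_connected_def eq by simp
  moreover have "interior_faces T = {}"
    unfolding interior_faces_def cofacets_def eq by auto
  moreover have "two_free_faces_at_edges T" if LS: "two_faces_at_edges T"
    unfolding two_free_faces_at_edges_def
  proof
    fix x assume x: "x \<in> \<Union>(ncells T 1)"
    have "free_faces_at T x \<subseteq> {s \<in> ncells T 2. x \<in> closed_cell T s \<and> s \<subseteq> closed_cell T D}"
      unfolding free_faces_at_def using cell_subset_topspace[OF CW] D(2) by auto
    then have "card (free_faces_at T x) \<le> card {s \<in> ncells T 2. x \<in> closed_cell T s \<and> s \<subseteq> closed_cell T D}"
      using cw_finite(2)[OF CW] by (intro card_mono) auto
    also have "\<dots> \<le> 2" using LS x D(1) unfolding two_faces_at_edges_def by blast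
    finally show "card (free_faces_at T x) \<le> 2" .
  qed
  ultimately show ?thesis using that by blast
qed

section \<open>Gluing a tetrahedron to a free triangle\<close>

locale gluing =
  fixes T :: "'a cell_complex" and T' :: "'b cell_complex" and s D j
  assumes T: "pseudomanifold 3 T" and T': "pseudomanifold 3 T'"
    and s: "s \<in> ncells T 2" "card (cofacets 3 T s) = 1"
    and D: "D \<in> ncells T' 3"
    and j: "cell_map j T T'" "inj_on j (points T)"
    and cover: "points T' = j ` points T \<union> closed_cell T' D"
    and meet: "j ` points T \<inter> closed_cell T' D = j ` closed_cell T s"
begin

lemma CW: "finite_regular_CW T" and CW': "finite_regular_CW T'"
  using T T' pseudomanifold_CW by auto

lemma closed_cell_iff:
  assumes "y \<in> points T" "c \<in> ncells T n"
  shows "j y \<in> closed_cell T' (j ` c) \<longleftrightarrow> y \<in> closed_cell T c"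
  unfolding cell_map_closed_cell[OF CW CW' j(1) assms(2), symmetric]
  by (rule inj_on_image_mem_iff[OF j(2) assms(1) closed_cell_topspace[OF CW]])

lemma face_iff:
  assumes "c \<in> ncells T m" "e \<in> ncells T n"
  shows "j ` c \<subseteq> closed_cell T' (j ` e) \<longleftrightarrow> c \<subseteq> closed_cell T e"
proof -
  have "j y \<in> closed_cell T' (j ` e) \<longleftrightarrow> y \<in> closed_cell T e" if "y \<in> c" for y
    by (rule closed_cell_iff[OF subsetD[OF cell_subset_topspace[OF CW assms(1)] that] assms(2)])
  then show ?thesis
    by (simp add: image_subset_iff subset_eq)
qed

lemma image_eq_iff: "c \<in> ncells T m \<Longrightarrow> e \<in> ncells T n \<Longrightarrow> j ` c = j ` e \<longleftrightarrow> c = e"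
  by (rule inj_on_image_eq_iff[OF j(2) cell_subset_topspace[OF CW] cell_subset_topspace[OF CW]])

lemma new_closed_cell_iff:
  assumes "y \<in> points T"
  shows "j y \<in> closed_cell T' D \<longleftrightarrow> y \<in> closed_cell T s"
proof -
  have "j y \<in> closed_cell T' D \<longleftrightarrow> j y \<in> j ` closed_cell T s"
    using meet assms by blast
  also have "\<dots> \<longleftrightarrow> y \<in> closed_cell T s"
    by (rule inj_on_image_mem_iff[OF j(2) assms closed_cell_topspace[OF CW]])
  finally show ?thesis .
qed

lemma glue_face: "j ` s \<subseteq> closed_cell T' D"
  using meet cell_subset_closed_cell[OF CW s(1)] by blast

lemma new_cell: "D \<notin> (`) j ` ncells T 3"
proof
  assume "D \<in> (`) j ` ncells T 3"
  then obtain c where c: "c \<in> ncells T 3" "D = j ` c" by blast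
  obtain y where y: "y \<in> c" using cell_nonempty[OF CW c(1)] by blast
  have "y \<in> points T" using cell_subset_topspace[OF CW c(1)] y by blast
  moreover have "j y \<in> closed_cell T' D" using cell_subset_closed_cell[OF CW' D] c(2) y by blast
  ultimately have "y \<in> closed_cell T s" using new_closed_cell_iff by blast
  then show False using cell_meets_closed_cell[OF CW c(1) s(1) y] by simp
qed

lemma top_cells: "ncells T' 3 = insert D ((`) j ` ncells T 3)"
proof
  show "insert D ((`) j ` ncells T 3) \<subseteq> ncells T' 3"
    using D cell_map_ncells[OF CW CW' j(1)] by blast
  show "ncells T' 3 \<subseteq> insert D ((`) j ` ncells T 3)"
  proof
    fix E assume E: "E \<in> ncells T' 3"
    obtain x where x: "x \<in> E" using cell_nonempty[OF CW' E] by blast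
    have "x \<in> points T'" using cell_subset_topspace[OF CW' E] x by blast
    then consider y where "y \<in> points T" "x = j y" | "x \<in> closed_cell T' D"
      using cover by blast
    then show "E \<in> insert D ((`) j ` ncells T 3)"
    proof cases
      case 1
      obtain m c where c: "c \<in> ncells T m" "y \<in> c" using cw_point[OF CW 1(1)] by blast
      have "m = 3 \<and> j ` c = E" using cell_map_dim[OF CW CW' j(1) c E] x 1(2) by blast
      with c(1) show ?thesis by blast
    next
      case 2
      then show ?thesis using same_dim_face[OF CW' E D x] by blast
    qed
  qed
qed

lemma faces:
  assumes r: "r \<in> ncells T' 2"
  shows "r \<in> (`) j ` ncells T 2 \<or> (r \<inter> j ` points T = {} \<and> r \<subseteq> closed_cell T' D)"
proof (cases "r \<inter> j ` points T = {}")
  case True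
  have "A \<subseteq> K" if "A \<subseteq> J \<union> K" "A \<inter> J = {}" for A J K :: "'b set"
    using that by blast
  from this[OF cell_subset_topspace[OF CW' r, unfolded cover] True] True show ?thesis by simp
next
  case False
  then obtain y where y: "y \<in> points T" "j y \<in> r" by blast
  obtain m c where c: "c \<in> ncells T m" "y \<in> c" using cw_point[OF CW y(1)] by blast
  have "m = 2 \<and> j ` c = r" using cell_map_dim[OF CW CW' j(1) c r y(2)] by blast
  with c(1) show ?thesis by blast
qed

lemma old_cofacet:
  assumes r: "r \<in> ncells T 2" "r \<noteq> s" and E: "E \<in> cofacets 3 T' (j ` r)"
  shows "\<exists>E0 \<in> cofacets 3 T r. E = j ` E0"
proof -
  obtain y where y: "y \<in> r" using cell_nonempty[OF CW r(1)] by blast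
  have ytop: "y \<in> points T" using cell_subset_topspace[OF CW r(1)] y by blast
  have "E \<noteq> D"
  proof
    assume "E = D"
    then have "j y \<in> closed_cell T' D" using E y by (auto simp: mem_cofacets)
    then have "y \<in> closed_cell T s" using new_closed_cell_iff[OF ytop] by blast
    then show False using same_dim_face[OF CW r(1) s(1) y] r(2) by blast
  qed
  then obtain E0 where E0: "E0 \<in> ncells T 3" "E = j ` E0"
    using E top_cells by (auto simp: mem_cofacets)
  then have "r \<subseteq> closed_cell T E0" using E face_iff[OF r(1) E0(1)] by (simp add: mem_cofacets)
  with E0 show ?thesis by (auto simp: mem_cofacets)
qed

lemma new_face_cofacet:
  assumes r: "r \<in> ncells T' 2" "r \<inter> j ` points T = {}" and E: "E \<in> cofacets 3 T' r"
  shows "E = D"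
proof (rule ccontr)
  assume "E \<noteq> D"
  then obtain E0 where E0: "E0 \<in> ncells T 3" "E = j ` E0" using E top_cells by (auto simp: mem_cofacets)
  then have "r \<subseteq> j ` closed_cell T E0"
    using E cell_map_closed_cell[OF CW CW' j(1) E0(1)] by (simp add: mem_cofacets)
  also have "\<dots> \<subseteq> j ` points T" using closed_cell_topspace[OF CW] by blast
  finally show False using r(2) cell_nonempty[OF CW' r(1)] by blast
qed

lemma interior_faces_subset: "interior_faces T' \<subseteq> insert (j ` s) ((`) j ` interior_faces T)"
proof
  fix r' assume r': "r' \<in> interior_faces T'"
  then obtain E E' where E: "r' \<in> ncells T' 2" "E \<in> cofacets 3 T' r'" "E' \<in> cofacets 3 T' r'" "E \<noteq> E'"
    by (auto simp: interior_faces_def)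
  then consider r where "r \<in> ncells T 2" "r' = j ` r" | "r' \<inter> j ` points T = {}"
    using faces by blast
  then show "r' \<in> insert (j ` s) ((`) j ` interior_faces T)"
  proof cases
    case 1
    show ?thesis
    proof (cases "r = s")
      case False
      obtain E0 where E0: "E0 \<in> cofacets 3 T r" "E = j ` E0"
        using old_cofacet[OF 1(1) False] E(2) 1(2) by blast
      obtain E1 where E1: "E1 \<in> cofacets 3 T r" "E' = j ` E1"
        using old_cofacet[OF 1(1) False] E(3) 1(2) by blast
      have "E0 \<noteq> E1" using E(4) E0 E1 by blast
      then have "r \<in> interior_faces T" using 1(1) E0 E1 unfolding interior_faces_def by blast
      with 1(2) show ?thesis by blast
    qed (use 1 in blast)
  next
    case 2
    with new_face_cofacet[OF E(1) 2 E(2)] new_face_cofacet[OF E(1) 2 E(3)] E(4) show ?thesis by simp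
  qed
qed

text \<open>A point that the new tetrahedron shares with an old one lies in the closed cell of
  \<open>s\<close>. There \<open>D\<close> is adjacent to the old cofacet \<open>Ds\<close> of
  \<open>s\<close>, and old chains lead on from \<open>Ds\<close>.\<close>

lemma connected:
  assumes "locally_strongly_connected T"
  shows "locally_strongly_connected T'"
proof -
  obtain Ds where Ds: "Ds \<in> ncells T 3" "s \<subseteq> closed_cell T Ds" using pseudomanifold_pure[OF T s(1)] by blast
  have old: "(j ` E, j ` E') \<in> (adjacency_at T' (j y))\<^sup>*"
    if "E \<in> ncells T 3" "E' \<in> ncells T 3" "y \<in> points T"
      "j y \<in> closed_cell T' (j ` E)" "j y \<in> closed_cell T' (j ` E')" for E E' y
  proof (rule adjacency_at_cell_map[OF CW CW' j(1)])
    have "y \<in> closed_cell T E" "y \<in> closed_cell T E'"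
      using that(4,5) closed_cell_iff[OF that(3,1)] closed_cell_iff[OF that(3,2)] by simp_all
    then show "(E, E') \<in> (adjacency_at T y)\<^sup>*"
      using assms that(1-3) unfolding locally_strongly_connected_def by simp
  qed
  have new: "(D, j ` E) \<in> (adjacency_at T' x)\<^sup>*" "(j ` E, D) \<in> (adjacency_at T' x)\<^sup>*"
    if E: "E \<in> ncells T 3" and x: "x \<in> closed_cell T' D" "x \<in> closed_cell T' (j ` E)" for E x
  proof -
    have "x \<in> j ` closed_cell T E" using x(2) cell_map_closed_cell[OF CW CW' j(1) E] by blast
    then obtain y where y: "y \<in> points T" "x = j y" using closed_cell_topspace[OF CW] by blast
    have ys: "y \<in> closed_cell T s" using new_closed_cell_iff[OF y(1)] x(1) y(2) by blast
    have "y \<in> closed_cell T Ds" using ys closed_cell_mono[OF CW Ds(2)] by blast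
    then have "j y \<in> closed_cell T' (j ` Ds)" using closed_cell_iff[OF y(1) Ds(1)] by blast
    then have *: "(j ` Ds, j ` E) \<in> (adjacency_at T' x)\<^sup>*" "(j ` E, j ` Ds) \<in> (adjacency_at T' x)\<^sup>*"
      using old[OF Ds(1) E y(1)] old[OF E Ds(1) y(1)] x(2) y(2) by auto
    have "x \<in> closed_cell T' (j ` s)" using closed_cell_iff[OF y(1) s(1)] ys y(2) by blast
    moreover have "j ` s \<subseteq> closed_cell T' (j ` Ds)" using face_iff[OF s(1) Ds(1)] Ds(2) by blast
    moreover have "j ` s \<in> ncells T' 2" "j ` Ds \<in> ncells T' 3" using cell_map_ncells[OF CW CW' j(1)] s(1) Ds(1) by blast+
    ultimately have "(D, j ` Ds) \<in> adjacency_at T' x" "(j ` Ds, D) \<in> adjacency_at T' x"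
      using D glue_face unfolding adjacency_at_def by blast+
    with * show "(D, j ` E) \<in> (adjacency_at T' x)\<^sup>*" "(j ` E, D) \<in> (adjacency_at T' x)\<^sup>*"
      by (auto intro: converse_rtrancl_into_rtrancl rtrancl_into_rtrancl)
  qed
  show ?thesis
    unfolding locally_strongly_connected_def
  proof (intro ballI impI)
    fix x E E' assume x: "x \<in> points T'" and E: "E \<in> ncells T' 3" "E' \<in> ncells T' 3"
      and xE: "x \<in> closed_cell T' E" "x \<in> closed_cell T' E'"
    have "E = D \<or> (\<exists>E0\<in>ncells T 3. E = j ` E0)" "E' = D \<or> (\<exists>E1\<in>ncells T 3. E' = j ` E1)"
      using E unfolding top_cells by (simp_all add: image_iff)
    then consider "E = D" "E' = D" | E1 where "E = D" "E1 \<in> ncells T 3" "E' = j ` E1"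
      | E0 where "E0 \<in> ncells T 3" "E = j ` E0" "E' = D"
      | E0 E1 where "E0 \<in> ncells T 3" "E = j ` E0" "E1 \<in> ncells T 3" "E' = j ` E1"
      by (elim disjE bexE) simp_all
    then show "(E, E') \<in> (adjacency_at T' x)\<^sup>*"
    proof cases
      case 4
      then have "x \<in> j ` closed_cell T E0" using xE(1) cell_map_closed_cell[OF CW CW' j(1)] by blast
      then obtain y where "y \<in> points T" "x = j y" using closed_cell_topspace[OF CW] by blast
      then show ?thesis using old[OF 4(1,3)] 4 xE by blast
    qed (use new xE in auto)
  qed
qed

text \<open>At a point of the closed cell of \<open>s\<close>, the triangle \<open>s\<close> ceases
  to be free, which leaves at most one old free triangle, and \<open>D\<close> contributes at most
  one triangle besides \<open>s\<close>. At any other point the free triangles are all old or all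
  belong to \<open>D\<close>.\<close>

lemma free_faces:
  assumes free: "two_free_faces_at_edges T" and LS: "two_faces_at_edges T'"
  shows "two_free_faces_at_edges T'"
  unfolding two_free_faces_at_edges_def
proof
  fix x assume x: "x \<in> \<Union>(ncells T' 1)"
  then obtain e' where e': "e' \<in> ncells T' 1" "x \<in> e'" by blast
  define New where "New = {r \<in> ncells T' 2. x \<in> closed_cell T' r \<and> r \<inter> j ` points T = {} \<and> r \<subseteq> closed_cell T' D}"
  define Old where "Old y = (`) j ` (free_faces_at T y - {s})" for y
  define At where "At = {r \<in> ncells T' 2. x \<in> closed_cell T' r \<and> r \<subseteq> closed_cell T' D}"
  have At: "card At \<le> 2" "finite At"
    using LS x D cw_finite(2)[OF CW'] unfolding At_def two_faces_at_edges_def by auto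
  have NewAt: "New \<subseteq> At" by (auto simp: New_def At_def)
  have sub: "r \<in> New \<or> (\<exists>y \<in> points T. x = j y \<and> r \<in> Old y)" if r: "r \<in> free_faces_at T' x" for r
  proof -
    have r2: "r \<in> ncells T' 2" "x \<in> closed_cell T' r" "r \<notin> interior_faces T'"
      using r card_cofacets_eq_1[OF T'] by (auto simp: free_faces_at_def)
    consider r0 where "r0 \<in> ncells T 2" "r = j ` r0" | "r \<in> New"
      using faces[OF r2(1)] r2 by (auto simp: New_def)
    then show ?thesis
    proof cases
      case 1
      have "x \<in> j ` closed_cell T r0" using r2(2) 1 cell_map_closed_cell[OF CW CW' j(1)] by blast
      then obtain y where y: "y \<in> closed_cell T r0" "x = j y" by blast
      have up: "j ` E \<in> cofacets 3 T' r" if "E \<in> cofacets 3 T r0" for E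
        using that 1 face_iff[OF 1(1)] cell_map_ncells[OF CW CW' j(1)] by (auto simp: mem_cofacets)
      have "r0 \<notin> interior_faces T"
      proof
        assume "r0 \<in> interior_faces T"
        then obtain E E' where E: "E \<in> cofacets 3 T r0" "E' \<in> cofacets 3 T r0" "E \<noteq> E'"
          by (auto simp: interior_faces_def)
        then have "j ` E \<noteq> j ` E'" using image_eq_iff[of E 3 E' 3] by (simp add: mem_cofacets)
        then show False using up E r2(1,3) unfolding interior_faces_def by blast
      qed
      moreover have "r0 \<noteq> s"
      proof
        assume "r0 = s"
        obtain Ds where "Ds \<in> cofacets 3 T s" using pseudomanifold_pure[OF T s(1)] by (auto simp: mem_cofacets)
        then have "j ` Ds \<in> cofacets 3 T' r" "D \<in> cofacets 3 T' r" "j ` Ds \<noteq> D"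
          using up \<open>r0 = s\<close> 1(2) glue_face D new_cell by (auto simp: mem_cofacets)
        then show False using r2(1,3) unfolding interior_faces_def by blast
      qed
      ultimately have "r \<in> Old y"
        using 1 y(1) card_cofacets_eq_1[OF T] unfolding Old_def free_faces_at_def by blast
      then show ?thesis using y closed_cell_topspace[OF CW] by blast
    qed simp
  qed
  show "card (free_faces_at T' x) \<le> 2"
  proof (cases "x \<in> j ` points T")
    case False
    then have "free_faces_at T' x \<subseteq> At" using sub NewAt by blast
    then show ?thesis using At card_mono le_trans by blast
  next
    case True
    then obtain y where y: "y \<in> points T" "x = j y" by blast
    have ff: "free_faces_at T' x \<subseteq> New \<union> Old y"
    proof
      fix r assume "r \<in> free_faces_at T' x"
      from sub[OF this] show "r \<in> New \<union> Old y"
      proof (elim disjE bexE conjE)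
        fix y' assume y': "y' \<in> points T" "x = j y'" "r \<in> Old y'"
        have "y' = y" by (rule inj_onD[OF j(2) _ y'(1) y(1)]) (use y'(2) y(2) in simp)
        with y'(3) show ?thesis by simp
      qed simp
    qed
    obtain m e where e: "e \<in> ncells T m" "y \<in> e" using cw_point[OF CW y(1)] by blast
    then have "e \<in> ncells T 1" using cell_map_dim[OF CW CW' j(1) e e'(1)] e'(2) y(2) by blast
    then have c2: "card (free_faces_at T y) \<le> 2" using free e(2) unfolding two_free_faces_at_edges_def by blast
    have fin: "finite (free_faces_at T y)" by (rule finite_free_faces[OF CW])
    have finO: "finite (Old y)" using fin by (simp add: Old_def)
    have cO: "card (Old y) \<le> card (free_faces_at T y - {s})"
      unfolding Old_def using fin by (intro card_image_le) simp
    show ?thesis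
    proof (cases "y \<in> closed_cell T s")
      case False
      have "New = {}"
      proof (rule ccontr)
        assume "New \<noteq> {}"
        then obtain r where r: "r \<in> ncells T' 2" "x \<in> closed_cell T' r" "r \<subseteq> closed_cell T' D"
          by (auto simp: New_def)
        then have "x \<in> closed_cell T' D" using closed_cell_mono[OF CW' r(3)] by blast
        then show False using False new_closed_cell_iff[OF y(1)] y(2) by blast
      qed
      then have "card (free_faces_at T' x) \<le> card (Old y)" using ff finO by (intro card_mono) auto
      also have "\<dots> \<le> card (free_faces_at T y)" using cO fin by (meson card_Diff1_le le_trans)
      finally show ?thesis using c2 by simp
    next
      case True
      then have "s \<in> free_faces_at T y" using s by (simp add: free_faces_at_def)
      then have "card (free_faces_at T y - {s}) \<le> 1" using c2 fin by simp
      moreover have "card New \<le> 1"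
      proof -
        have "j ` s \<in> At"
          using True closed_cell_iff[OF y(1) s(1)] y(2) cell_map_ncells[OF CW CW' j(1) s(1)] glue_face
          by (simp add: At_def)
        moreover have "j ` s \<notin> New"
          using cell_nonempty[OF CW s(1)] cell_subset_topspace[OF CW s(1)] by (auto simp: New_def)
        ultimately have "New \<subseteq> At - {j ` s}" using NewAt by blast
        then have "card New \<le> card (At - {j ` s})" using At(2) by (intro card_mono) auto
        then show ?thesis using At \<open>j ` s \<in> At\<close> by simp
      qed
      moreover have "finite New" using NewAt At(2) by (rule finite_subset)
      then have "card (free_faces_at T' x) \<le> card New + card (Old y)"
        using card_mono[OF _ ff] card_Un_le[of New "Old y"] finO by (meson finite_UnI le_trans)
      ultimately show ?thesis using cO by simp
    qed
  qed
qed

end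

lemma glue_simplex_step_gluing:
  assumes "pseudomanifold 3 T" "pseudomanifold 3 T'" "glue_simplex_step 3 T T'"
  obtains s D j where "gluing T T' s D j"
proof -
  note CW = pseudomanifold_CW[OF assms(1)]
  from assms(3) show ?thesis
    unfolding glue_simplex_step_def
  proof (elim exE conjE)
    fix s D j
    assume s: "s \<in> ncells T (3 - 1) \<inter> boundary_cells 3 T" and D: "D \<in> ncells T' 3"
      and j: "embedding_map (carrier_space T) (carrier_space T') j" "\<forall>n. \<forall>c \<in> ncells T n. j ` c \<in> ncells T' n"
      and cover: "points T' = j ` points T \<union> closed_cell T' D"
      and meet: "j ` points T \<inter> closed_cell T' D = j ` closed_cell T s"
    have inj: "inj_on j (points T)"
      using j(1) unfolding embedding_map_def homeomorphic_map_def by blast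
    have "continuous_map (carrier_space T) (carrier_space T') j"
      using j(1) homeomorphic_imp_continuous_map continuous_map_into_fulltopology
      unfolding embedding_map_def by blast
    moreover have "\<forall>c\<in>cells T. inj_on j c"
      using inj unfolding cw_topspace[OF CW] by (meson Sup_upper inj_on_subset)
    ultimately have cm: "cell_map j T T'"
      using j(2) unfolding cell_map_def by simp
    have s2: "s \<in> ncells T 2" "s \<in> boundary_cells 3 T"
      using s by simp_all
    show ?thesis
      by (rule that[of s D j], rule gluing.intro)
         (rule assms s2 boundary_2_cell[OF assms(1) s2] D cm inj cover meet)+
  qed
qed

section \<open>Identifying two free triangles along a common edge\<close>

locale identification =
  fixes T :: "'a cell_complex" and T' :: "'b cell_complex" and s t F \<phi> q
  assumes T: "pseudomanifold 3 T" and T': "pseudomanifold 3 T'"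
    and s: "s \<in> ncells T 2" "card (cofacets 3 T s) = 1"
    and t: "t \<in> ncells T 2" "card (cofacets 3 T t) = 1"
    and st: "s \<noteq> t"
    and F: "F \<in> ncells T 1" "F \<subseteq> closed_cell T s" "F \<subseteq> closed_cell T t"
    and \<phi>: "\<phi> ` closed_cell T s = closed_cell T t" "inj_on \<phi> (closed_cell T s)"
      "\<And>n c. c \<in> ncells T n \<Longrightarrow> c \<subseteq> closed_cell T s \<Longrightarrow> \<phi> ` c \<in> ncells T n"
      "\<And>x. x \<in> closed_cell T F \<Longrightarrow> \<phi> x = x"
    and q: "cell_map q T T'" "q ` points T = points T'"
      "\<And>x y. x \<in> points T \<Longrightarrow> y \<in> points T \<Longrightarrow>
        q x = q y \<longleftrightarrow> x = y \<or> (x \<in> closed_cell T s \<and> y = \<phi> x) \<or> (y \<in> closed_cell T s \<and> x = \<phi> y)"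
      "\<And>n. ncells T' n = (`) q ` ncells T n"
begin

lemma CW: "finite_regular_CW T" and CW': "finite_regular_CW T'"
  using T T' pseudomanifold_CW by auto

lemma \<phi>_mem: "x \<in> closed_cell T s \<Longrightarrow> \<phi> x \<in> closed_cell T t"
  using \<phi>(1) by blast

lemma \<phi>_image: "\<phi> ` s = t"
proof -
  have sub: "s \<subseteq> closed_cell T s" by (rule cell_subset_closed_cell[OF CW s(1)])
  obtain x where x: "x \<in> s" using cell_nonempty[OF CW s(1)] by blast
  have "\<phi> x \<in> closed_cell T t" using \<phi>_mem x sub by blast
  then show ?thesis by (rule same_dim_face[OF CW \<phi>(3)[OF s(1) sub] t(1) imageI[OF x]])
qed

lemma identify_eq: "x \<in> closed_cell T s \<Longrightarrow> q (\<phi> x) = q x"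
  using q(3)[of "\<phi> x" x] closed_cell_topspace[OF CW] \<phi>_mem by blast

lemma q_faces: "q ` s = q ` t"
proof -
  have "q (\<phi> x) = q x" if "x \<in> s" for x
    using identify_eq cell_subset_closed_cell[OF CW s(1)] that by blast
  then have "(\<lambda>x. q (\<phi> x)) ` s = q ` s" by (rule image_cong[OF refl])
  then show ?thesis by (simp add: \<phi>_image[symmetric] image_image)
qed

lemma fibre_trivial:
  assumes "x \<in> points T" "y \<in> points T" "q y = q x"
    "x \<notin> closed_cell T s" "x \<notin> closed_cell T t"
  shows "y = x"
  using q(3)[OF assms(1,2)] assms(3-5) \<phi>_mem by metis

lemma off_faces:
  assumes "r \<in> ncells T n" "n \<ge> 2" "r \<noteq> s" "r \<noteq> t" "x \<in> r"
  shows "x \<notin> closed_cell T s" "x \<notin> closed_cell T t"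
  using cell_meets_closed_cell[OF CW assms(1) s(1) assms(5)] cell_meets_closed_cell[OF CW assms(1) t(1) assms(5)]
    assms(2-4) by auto

lemma closed_cell_lift:
  assumes "c \<in> ncells T n" "q x \<in> closed_cell T' (q ` c)"
  obtains y where "y \<in> points T" "y \<in> closed_cell T c" "q y = q x"
proof -
  have "q x \<in> q ` closed_cell T c"
    using assms(2) unfolding cell_map_closed_cell[OF CW CW' q(1) assms(1)] .
  then obtain y where "y \<in> closed_cell T c" "q y = q x" by (auto simp: image_iff)
  then show ?thesis using that closed_cell_topspace[OF CW] by blast
qed

lemma face_lift:
  assumes r: "r \<in> ncells T 2" "r \<noteq> s" "r \<noteq> t" and E: "E \<in> ncells T 3" "q ` r \<subseteq> closed_cell T' (q ` E)"
  shows "r \<subseteq> closed_cell T E"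
proof
  fix x assume x: "x \<in> r"
  then have "q x \<in> closed_cell T' (q ` E)" using E(2) by blast
  then obtain y where y: "y \<in> points T" "y \<in> closed_cell T E" "q y = q x"
    by (rule closed_cell_lift[OF E(1)])
  have "x \<in> points T" using cell_subset_topspace[OF CW r(1)] x by blast
  then have "y = x"
    using fibre_trivial[OF _ y(1,3)] off_faces[OF r(1) _ r(2,3) x] by simp
  with y(2) show "x \<in> closed_cell T E" by simp
qed

lemma inj_top_cells:
  assumes D: "D \<in> ncells T 3" "D' \<in> ncells T 3" and eq: "q ` D = q ` D'"
  shows "D = D'"
proof -
  obtain x where x: "x \<in> D" using cell_nonempty[OF CW D(1)] by blast
  have "q x \<in> q ` D'" using x eq by blast
  then obtain y where y: "y \<in> D'" "q y = q x" by (auto simp: image_iff)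
  have "D \<noteq> s" "D \<noteq> t"
    using cw_disjoint[OF CW D(1) s(1) x] cw_disjoint[OF CW D(1) t(1) x] x by auto
  then have "x \<notin> closed_cell T s" "x \<notin> closed_cell T t"
    using off_faces[OF D(1) _ _ _ x] by simp_all
  then have "y = x"
    using fibre_trivial[of x y] y(2) subsetD[OF cell_subset_topspace[OF CW D(1)] x]
      subsetD[OF cell_subset_topspace[OF CW D(2)] y(1)] by simp
  with x y(1) show ?thesis using cw_disjoint[OF CW D] by simp
qed

lemma cofacet_image: "E \<in> cofacets 3 T r \<Longrightarrow> q ` E \<in> cofacets 3 T' (q ` r)"
  using cell_map_face[OF CW CW' q(1), of r E 3] cell_map_ncells[OF CW CW' q(1), of E 3] by (simp add: mem_cofacets)

lemma interior_faces_image: "r \<in> interior_faces T \<Longrightarrow> q ` r \<in> interior_faces T'"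
proof -
  assume "r \<in> interior_faces T"
  then obtain E E' where E: "r \<in> ncells T 2" "E \<in> cofacets 3 T r" "E' \<in> cofacets 3 T r" "E \<noteq> E'"
    by (auto simp: interior_faces_def)
  have "q ` E \<noteq> q ` E'" using E inj_top_cells[of E E'] by (auto simp: mem_cofacets)
  then show ?thesis
    using cofacet_image[OF E(2)] cofacet_image[OF E(3)] cell_map_ncells[OF CW CW' q(1) E(1)]
    unfolding interior_faces_def by blast
qed

lemma interior_faces_subset: "interior_faces T' \<subseteq> insert (q ` s) ((`) q ` interior_faces T)"
proof
  fix r' assume r': "r' \<in> interior_faces T'"
  then obtain E0 E1 where E: "r' \<in> ncells T' 2" "E0 \<in> cofacets 3 T' r'" "E1 \<in> cofacets 3 T' r'" "E0 \<noteq> E1"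
    by (auto simp: interior_faces_def)
  obtain r where r: "r \<in> ncells T 2" "r' = q ` r" using E(1) unfolding q(4) by (auto simp: image_iff)
  show "r' \<in> insert (q ` s) ((`) q ` interior_faces T)"
  proof (cases "r = s \<or> r = t")
    case True
    then show ?thesis using r(2) q_faces by auto
  next
    case False
    have lift: "\<exists>E' \<in> cofacets 3 T r. E = q ` E'" if E': "E \<in> cofacets 3 T' r'" for E
    proof -
      obtain D where D: "D \<in> ncells T 3" "E = q ` D"
        using E' unfolding mem_cofacets q(4) by (auto simp: image_iff)
      have "r \<subseteq> closed_cell T D"
        using face_lift[OF r(1) _ _ D(1)] False E' D(2) r(2) by (simp add: mem_cofacets)
      with D show ?thesis by (auto simp: mem_cofacets)
    qed
    obtain E2 where E2: "E2 \<in> cofacets 3 T r" "E0 = q ` E2" using lift[OF E(2)] by (elim bexE)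
    obtain E3 where E3: "E3 \<in> cofacets 3 T r" "E1 = q ` E3" using lift[OF E(3)] by (elim bexE)
    have "E2 \<noteq> E3" using E(4) E2(2) E3(2) by auto
    then have "r \<in> interior_faces T" using r(1) E2(1) E3(1) unfolding interior_faces_def by auto
    then show ?thesis using r(2) by simp
  qed
qed

text \<open>Otherwise the identification would fold the closed tetrahedron containing both faces.\<close>

lemma cofacets_st:
  obtains Ds Dt where "Ds \<in> cofacets 3 T s" "Dt \<in> cofacets 3 T t" "Ds \<noteq> Dt"
proof -
  obtain Ds where Ds: "Ds \<in> ncells T 3" "s \<subseteq> closed_cell T Ds" using pseudomanifold_pure[OF T s(1)] by blast
  obtain Dt where Dt: "Dt \<in> ncells T 3" "t \<subseteq> closed_cell T Dt" using pseudomanifold_pure[OF T t(1)] by blast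
  have "Ds \<noteq> Dt"
  proof
    assume "Ds = Dt"
    then have "s = t"
      using cell_map_no_fold[OF CW CW' q(1), of Ds 2 s t] Ds Dt(2) s(1) t(1) q_faces by simp
    with st show False by simp
  qed
  then show ?thesis using that Ds Dt by (simp add: mem_cofacets)
qed

lemma q_s_interior: "q ` s \<in> interior_faces T'"
proof -
  obtain Ds Dt where D: "Ds \<in> cofacets 3 T s" "Dt \<in> cofacets 3 T t" "Ds \<noteq> Dt" by (rule cofacets_st)
  have "q ` Ds \<noteq> q ` Dt" using D inj_top_cells[of Ds Dt] by (auto simp: mem_cofacets)
  moreover have "q ` Ds \<in> cofacets 3 T' (q ` s)" "q ` Dt \<in> cofacets 3 T' (q ` s)"
    using cofacet_image[OF D(1)] cofacet_image[OF D(2)] q_faces by simp_all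
  ultimately show ?thesis
    using cell_map_ncells[OF CW CW' q(1) s(1)] unfolding interior_faces_def by blast
qed

text \<open>Interior triangles stay interior and the common image of \<open>s\<close> and
  \<open>t\<close> becomes interior, so a free triangle can only come from another free
  triangle.\<close>

lemma free_faces_lift:
  assumes "r' \<in> free_faces_at T' (q x)"
  obtains y r where "y \<in> points T" "q y = q x" "r \<in> free_faces_at T y - {s, t}" "r' = q ` r"
proof -
  have r': "r' \<in> ncells T' 2" "q x \<in> closed_cell T' r'" "r' \<notin> interior_faces T'"
    using assms card_cofacets_eq_1[OF T'] by (auto simp: free_faces_at_def)
  obtain r where r: "r \<in> ncells T 2" "r' = q ` r" using r'(1) unfolding q(4) by (auto simp: image_iff)
  obtain y where y: "y \<in> points T" "y \<in> closed_cell T r" "q y = q x"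
    using closed_cell_lift[OF r(1)] r'(2) r(2) by metis
  have "r \<notin> interior_faces T" using interior_faces_image[of r] r'(3) r(2) by auto
  then have "r \<in> free_faces_at T y"
    using r(1) y(2) card_cofacets_eq_1[OF T r(1)] by (simp add: free_faces_at_def)
  moreover have "r \<noteq> s" "r \<noteq> t" using q_s_interior r'(3) r(2) q_faces by auto
  ultimately show ?thesis using that[OF y(1,3) _ r(2)] by simp
qed

lemma st_free:
  shows "y \<in> closed_cell T s \<Longrightarrow> s \<in> free_faces_at T y" and "y \<in> closed_cell T t \<Longrightarrow> t \<in> free_faces_at T y"
  using s t by (simp_all add: free_faces_at_def)

lemma card_other_free_faces:
  assumes free: "card (free_faces_at T y) \<le> 2"
  shows "y \<in> closed_cell T s \<or> y \<in> closed_cell T t \<Longrightarrow> card (free_faces_at T y - {s, t}) \<le> 1"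
    and "y \<in> closed_cell T s \<Longrightarrow> y \<in> closed_cell T t \<Longrightarrow> free_faces_at T y - {s, t} = {}"
proof -
  have fin: "finite (free_faces_at T y)" by (rule finite_free_faces[OF CW])
  {
    assume "y \<in> closed_cell T s \<or> y \<in> closed_cell T t"
    then obtain u where u: "u \<in> free_faces_at T y" "u \<in> {s, t}" using st_free by blast
    have "card (free_faces_at T y - {s, t}) \<le> card (free_faces_at T y - {u})"
      using fin u(2) by (intro card_mono) auto
    also have "\<dots> \<le> 1" using u(1) fin free by simp
    finally show "card (free_faces_at T y - {s, t}) \<le> 1" .
  next
    assume "y \<in> closed_cell T s" "y \<in> closed_cell T t"
    then have "{s, t} \<subseteq> free_faces_at T y" using st_free by simp
    moreover have "card {s, t} = 2" using st by simp
    ultimately have "{s, t} = free_faces_at T y"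
      using free fin by (intro card_seteq) auto
    then show "free_faces_at T y - {s, t} = {}" by simp
  }
qed

lemma edge_lift:
  assumes "y \<in> points T" "q y \<in> \<Union>(ncells T' 1)"
  shows "y \<in> \<Union>(ncells T 1)"
proof -
  obtain e' where e': "e' \<in> ncells T' 1" "q y \<in> e'" using assms(2) by blast
  obtain m e where e: "e \<in> ncells T m" "y \<in> e" using cw_point[OF CW assms(1)] by blast
  have "m = 1" using cell_map_dim[OF CW CW' q(1) e e'] by simp
  with e show ?thesis by blast
qed

lemma card_UN_le_1:
  assumes "\<And>y y'. y \<in> A \<Longrightarrow> y' \<in> A \<Longrightarrow> y = y'" "\<And>y. y \<in> A \<Longrightarrow> finite (f y) \<and> card (f y) \<le> (1::nat)"
  shows "finite (\<Union>(f ` A)) \<and> card (\<Union>(f ` A)) \<le> 1"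
proof (cases "A = {}")
  case False
  then obtain y where "A = {y}" using assms(1) by blast
  with assms(2) show ?thesis by simp
qed simp

text \<open>If a point of the fibre lies outside the closed cells of \<open>s\<close> and
  \<open>t\<close>, it is the whole fibre. Otherwise each point of the fibre lies in one of them and
  has at most one further free triangle, or none if it lies in both. At most one point of the fibre
  is outside the closed cell of \<open>s\<close>, and at most one is outside that of
  \<open>t\<close>, which makes at most two free triangles.\<close>

lemma free_faces:
  assumes free: "two_free_faces_at_edges T"
  shows "two_free_faces_at_edges T'"
  unfolding two_free_faces_at_edges_def
proof
  fix x' assume x': "x' \<in> \<Union>(ncells T' 1)"
  then have "x' \<in> points T'" using cell_subset_topspace[OF CW'] by blast
  then obtain x where x: "x \<in> points T" "x' = q x" unfolding q(2)[symmetric] by (auto simp: image_iff)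
  define fib where "fib = {y \<in> points T. q y = q x}"
  define other where "other y = (`) q ` (free_faces_at T y - {s, t})" for y
  have card_free: "card (free_faces_at T y) \<le> 2" if "y \<in> fib" for y
    using free edge_lift[of y] that x' x(2) unfolding two_free_faces_at_edges_def fib_def by auto
  have fin: "finite (free_faces_at T y)" for y by (rule finite_free_faces[OF CW])
  then have fin_other: "finite (other y)" for y by (simp add: other_def)
  have card_other: "card (other y) \<le> card (free_faces_at T y - {s, t})" for y
    unfolding other_def using fin by (intro card_image_le) simp
  have sub: "free_faces_at T' x' \<subseteq> \<Union>(other ` fib)"
  proof
    fix r' assume "r' \<in> free_faces_at T' x'"
    then obtain y r where "y \<in> points T" "q y = q x" "r \<in> free_faces_at T y - {s, t}" "r' = q ` r"
      unfolding x(2) by (rule free_faces_lift)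
    then show "r' \<in> \<Union>(other ` fib)" unfolding fib_def other_def by auto
  qed
  show "card (free_faces_at T' x') \<le> 2"
  proof (cases "\<exists>y\<in>fib. y \<notin> closed_cell T s \<and> y \<notin> closed_cell T t")
    case True
    then obtain y where y: "y \<in> fib" "y \<notin> closed_cell T s" "y \<notin> closed_cell T t" by blast
    have "z = y" if "z \<in> fib" for z
      using fibre_trivial[of y z] y that by (simp add: fib_def)
    then have "\<Union>(other ` fib) \<subseteq> other y" by blast
    with sub have "card (free_faces_at T' x') \<le> card (other y)"
      using fin_other by (intro card_mono) (rule fin_other, rule subset_trans)
    also have "\<dots> \<le> card (free_faces_at T y - {s, t})" by (rule card_other)
    also have "\<dots> \<le> card (free_faces_at T y)" using fin by (intro card_mono) auto
    finally show ?thesis using card_free[OF y(1)] by simp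
  next
    case False
    define A where "A c = {y \<in> fib. y \<notin> closed_cell T c}" for c
    have small: "finite (\<Union>(other ` A c)) \<and> card (\<Union>(other ` A c)) \<le> 1" if c: "c = s \<or> c = t" for c
    proof (rule card_UN_le_1)
      fix y y' assume yy: "y \<in> A c" "y' \<in> A c"
      then have top: "y \<in> points T" "y' \<in> points T" "q y = q y'"
        by (simp_all add: A_def fib_def)
      from c show "y = y'"
      proof
        assume "c = s"
        then show ?thesis using q(3)[OF top(1,2)] top(3) yy by (simp add: A_def)
      next
        assume "c = t"
        then show ?thesis using q(3)[OF top(1,2)] top(3) yy \<phi>_mem by (auto simp: A_def)
      qed
    next
      fix y assume y: "y \<in> A c"
      then have "card (free_faces_at T y - {s, t}) \<le> 1"
        using card_other_free_faces(1)[OF card_free] False by (auto simp: A_def)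
      then show "finite (other y) \<and> card (other y) \<le> 1"
        using fin_other card_other[of y] by simp
    qed
    have "\<Union>(other ` fib) \<subseteq> \<Union>(other ` A s) \<union> \<Union>(other ` A t)"
    proof (rule UN_least)
      fix y assume y: "y \<in> fib"
      show "other y \<subseteq> \<Union>(other ` A s) \<union> \<Union>(other ` A t)"
      proof (cases "y \<in> closed_cell T s \<and> y \<in> closed_cell T t")
        case True
        then have "other y = {}" using card_other_free_faces(2)[OF card_free[OF y]] by (simp add: other_def)
        then show ?thesis by simp
      next
        case False
        then have "y \<in> A s \<or> y \<in> A t" using y by (auto simp: A_def)
        then show ?thesis by auto
      qed
    qed
    with sub have "free_faces_at T' x' \<subseteq> \<Union>(other ` A s) \<union> \<Union>(other ` A t)" by (rule subset_trans)
    then have "card (free_faces_at T' x') \<le> card (\<Union>(other ` A s) \<union> \<Union>(other ` A t))"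
      using small[of s] small[of t] by (intro card_mono) auto
    also have "\<dots> \<le> card (\<Union>(other ` A s)) + card (\<Union>(other ` A t))" by (rule card_Un_le)
    finally show ?thesis using small[of s] small[of t] by simp
  qed
qed

text \<open>For identified points \<open>y\<close> and \<open>\<phi> y\<close>, a chain at
  \<open>y\<close> leads to the cofacet \<open>Ds\<close> of \<open>s\<close> and a chain at
  \<open>\<phi> y\<close> to the cofacet \<open>Dt\<close> of \<open>t\<close>; the images of these
  two are adjacent through the new interior triangle.\<close>

lemma connected:
  assumes conn: "locally_strongly_connected T"
  shows "locally_strongly_connected T'"
  unfolding locally_strongly_connected_def
proof (intro ballI impI)
  have chain: "(q ` E, q ` E') \<in> (adjacency_at T' (q y))\<^sup>*"
    if "E \<in> ncells T 3" "E' \<in> ncells T 3" "y \<in> closed_cell T E" "y \<in> closed_cell T E'" for E E' y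
  proof (rule adjacency_at_cell_map[OF CW CW' q(1)])
    have "y \<in> points T" using that(3) closed_cell_topspace[OF CW] by blast
    then show "(E, E') \<in> (adjacency_at T y)\<^sup>*"
      using conn that unfolding locally_strongly_connected_def by simp
  qed
  obtain Ds Dt where D: "Ds \<in> cofacets 3 T s" "Dt \<in> cofacets 3 T t" by (rule cofacets_st)
  have D3: "Ds \<in> ncells T 3" "Dt \<in> ncells T 3" "s \<subseteq> closed_cell T Ds" "t \<subseteq> closed_cell T Dt"
    using D by (simp_all add: mem_cofacets)
  have bridge: "(q ` E, q ` E') \<in> (adjacency_at T' (q y))\<^sup>* \<and> (q ` E', q ` E) \<in> (adjacency_at T' (q y))\<^sup>*"
    if E: "E \<in> ncells T 3" "E' \<in> ncells T 3" "y \<in> closed_cell T E" "\<phi> y \<in> closed_cell T E'"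
      and ys: "y \<in> closed_cell T s" for E E' y
  proof -
    have y: "y \<in> closed_cell T Ds" "\<phi> y \<in> closed_cell T Dt"
      using ys \<phi>_mem[OF ys] closed_cell_mono[OF CW D3(3)] closed_cell_mono[OF CW D3(4)] by blast+
    have qy: "q (\<phi> y) = q y" by (rule identify_eq[OF ys])
    have "q y \<in> closed_cell T' (q ` s)"
      using ys unfolding cell_map_closed_cell[OF CW CW' q(1) s(1), symmetric] by simp
    moreover have "q ` Ds \<in> cofacets 3 T' (q ` s)" "q ` Dt \<in> cofacets 3 T' (q ` s)"
      using cofacet_image[OF D(1)] cofacet_image[OF D(2)] q_faces by simp_all
    moreover have "q ` s \<in> ncells T' 2" by (rule cell_map_ncells[OF CW CW' q(1) s(1)])
    ultimately have "(q ` Ds, q ` Dt) \<in> adjacency_at T' (q y)" "(q ` Dt, q ` Ds) \<in> adjacency_at T' (q y)"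
      unfolding adjacency_at_def mem_cofacets by auto
    moreover have "(q ` E, q ` Ds) \<in> (adjacency_at T' (q y))\<^sup>*" "(q ` Ds, q ` E) \<in> (adjacency_at T' (q y))\<^sup>*"
      using chain E(1,3) D3(1) y(1) by simp_all
    moreover have "(q ` E', q ` Dt) \<in> (adjacency_at T' (q y))\<^sup>*" "(q ` Dt, q ` E') \<in> (adjacency_at T' (q y))\<^sup>*"
      using chain[OF E(2) D3(2) E(4) y(2)] chain[OF D3(2) E(2) y(2) E(4)] qy by simp_all
    ultimately show ?thesis
      by (meson rtrancl_into_rtrancl rtrancl_trans)
  qed
  fix x' E0 E1 assume x': "x' \<in> points T'" and E: "E0 \<in> ncells T' 3" "E1 \<in> ncells T' 3"
    and xE: "x' \<in> closed_cell T' E0" "x' \<in> closed_cell T' E1"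
  obtain x where x: "x' = q x" using x' unfolding q(2)[symmetric] by (auto simp: image_iff)
  obtain E2 E3 where E': "E2 \<in> ncells T 3" "E0 = q ` E2" "E3 \<in> ncells T 3" "E1 = q ` E3"
    using E unfolding q(4) by (auto simp: image_iff)
  obtain y where y: "y \<in> points T" "y \<in> closed_cell T E2" "q y = q x"
    using closed_cell_lift[OF E'(1)] xE(1) E'(2) x by metis
  obtain z where z: "z \<in> points T" "z \<in> closed_cell T E3" "q z = q x"
    using closed_cell_lift[OF E'(3)] xE(2) E'(4) x by metis
  consider "y = z" | "y \<in> closed_cell T s" "z = \<phi> y" | "z \<in> closed_cell T s" "y = \<phi> z"
    using q(3)[OF y(1) z(1)] y(3) z(3) by auto
  then show "(E0, E1) \<in> (adjacency_at T' x')\<^sup>*"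
  proof cases
    case 1
    then show ?thesis using chain[OF E'(1,3) y(2)] z(2) y(3) E' x by simp
  next
    case 2
    then show ?thesis using bridge[OF E'(1,3) y(2)] z(2) y(3) E' x by simp
  next
    case 3
    then show ?thesis using bridge[OF E'(3,1) z(2)] y(2) z(3) E' x by simp
  qed
qed

text \<open>Such a point is in neither of the closed cells of \<open>s\<close> and \<open>t\<close>,
  as both triangles are free; the identification does not touch it.\<close>

lemma closed_point:
  assumes x: "x \<in> points T" "free_faces_at T x = {}"
  shows "y \<in> points T \<Longrightarrow> q y = q x \<Longrightarrow> y = x" and "free_faces_at T' (q x) = {}"
proof -
  have off: "x \<notin> closed_cell T s" "x \<notin> closed_cell T t" using st_free x(2) by auto
  show fib: "y \<in> points T \<Longrightarrow> q y = q x \<Longrightarrow> y = x" for y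
    using fibre_trivial[OF x(1) _ _ off] by simp
  show "free_faces_at T' (q x) = {}"
  proof (rule ccontr)
    assume "free_faces_at T' (q x) \<noteq> {}"
    then obtain r' where "r' \<in> free_faces_at T' (q x)" by auto
    then obtain y r where "y \<in> points T" "q y = q x" "r \<in> free_faces_at T y - {s, t}"
      by (rule free_faces_lift)
    then show False using fib[of y] x(2) by simp
  qed
qed

text \<open>At a point of the open edge, \<open>s\<close> and \<open>t\<close> already exhaust the
  two possible free triangles, and both disappear. As \<open>\<phi>\<close> fixes the edge, no other
  point is identified with \<open>x\<close>.\<close>

lemma closing_point:
  assumes x: "x \<in> F" and free: "two_free_faces_at_edges T"
  shows "y \<in> points T \<Longrightarrow> q y = q x \<Longrightarrow> y = x" and "free_faces_at T' (q x) = {}"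
    and "free_faces_at T x \<noteq> {}"
proof -
  have xst: "x \<in> closed_cell T s" "x \<in> closed_cell T t" using F x by auto
  have \<phi>x: "\<phi> x = x" using \<phi>(4) cell_subset_closed_cell[OF CW F(1)] x by blast
  have xtop: "x \<in> points T" using cell_subset_topspace[OF CW F(1)] x by blast
  show fib: "y \<in> points T \<Longrightarrow> q y = q x \<Longrightarrow> y = x" for y
    using q(3)[OF xtop, of y] \<phi>x inj_onD[OF \<phi>(2), of x y] xst(1) by auto
  have "card (free_faces_at T x) \<le> 2"
    using free x F(1) unfolding two_free_faces_at_edges_def by auto
  then have none: "free_faces_at T x - {s, t} = {}"
    using card_other_free_faces(2) xst by simp
  show "free_faces_at T x \<noteq> {}" using st_free(1)[OF xst(1)] by auto
  show "free_faces_at T' (q x) = {}"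
  proof (rule ccontr)
    assume "free_faces_at T' (q x) \<noteq> {}"
    then obtain r' where "r' \<in> free_faces_at T' (q x)" by auto
    then obtain y r where "y \<in> points T" "q y = q x" "r \<in> free_faces_at T y - {s, t}"
      by (rule free_faces_lift)
    then show False using fib[of y] none by auto
  qed
qed

end

lemma identify_step_identification:
  assumes "pseudomanifold 3 T" "pseudomanifold 3 T'" "identify_step 3 T T'"
  obtains s t F \<phi> q where "identification T T' s t F \<phi> q"
proof -
  note CW = pseudomanifold_CW[OF assms(1)]
  from assms(3) show ?thesis
    unfolding identify_step_def
  proof (elim exE conjE)
    fix s t F \<phi> q
    assume st: "s \<in> ncells T (3 - 1) \<inter> boundary_cells 3 T" "t \<in> ncells T (3 - 1) \<inter> boundary_cells 3 T" "s \<noteq> t"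
      and F: "F \<in> ncells T (3 - 2)" "F \<subseteq> closed_cell T s \<inter> closed_cell T t"
      and \<phi>: "homeomorphic_map (subtopology (carrier_space T) (closed_cell T s))
                         (subtopology (carrier_space T) (closed_cell T t)) \<phi>"
        "\<forall>n. \<forall>c \<in> ncells T n. c \<subseteq> closed_cell T s \<longrightarrow> \<phi> ` c \<in> ncells T n"
        "\<forall>x \<in> closed_cell T F. \<phi> x = x"
      and q: "quotient_map (carrier_space T) (carrier_space T') q"
        "\<forall>x \<in> points T. \<forall>y \<in> points T.
           q x = q y \<longleftrightarrow> x = y \<or> (x \<in> closed_cell T s \<and> y = \<phi> x) \<or> (y \<in> closed_cell T s \<and> x = \<phi> y)"
        "\<forall>c \<in> cells T. inj_on q c" "\<forall>n. ncells T' n = (\<lambda>c. q ` c) ` ncells T n"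
    have s2: "s \<in> ncells T 2" "s \<in> boundary_cells 3 T" and t2: "t \<in> ncells T 2" "t \<in> boundary_cells 3 T"
      using st by simp_all
    have F1: "F \<in> ncells T 1" "F \<subseteq> closed_cell T s" "F \<subseteq> closed_cell T t"
      using F by simp_all
    have top: "topspace (subtopology (carrier_space T) (closed_cell T c)) = closed_cell T c" for c
      using closed_cell_topspace[OF CW, of c] by (simp add: Int_absorb1)
    have \<phi>im: "\<phi> ` closed_cell T s = closed_cell T t" "inj_on \<phi> (closed_cell T s)"
      using \<phi>(1) unfolding homeomorphic_map_def quotient_map_def top by simp_all
    have cm: "cell_map q T T'"
      using quotient_imp_continuous_map[OF q(1)] q(3,4) unfolding cell_map_def by simp
    have onto: "q ` points T = points T'"
      using q(1) by (simp add: quotient_map_def)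
    show ?thesis
    proof (rule that[of s t F \<phi> q], rule identification.intro)
      show "\<phi> ` c \<in> ncells T n" if "c \<in> ncells T n" "c \<subseteq> closed_cell T s" for n c
        using \<phi>(2) that by simp
      show "\<phi> x = x" if "x \<in> closed_cell T F" for x
        using \<phi>(3) that by simp
      show "q x = q y \<longleftrightarrow> x = y \<or> (x \<in> closed_cell T s \<and> y = \<phi> x) \<or> (y \<in> closed_cell T s \<and> x = \<phi> y)"
        if "x \<in> points T" "y \<in> points T" for x y
        using q(2) that by simp
      show "ncells T' n = (`) q ` ncells T n" for n
        using q(4) by simp
    qed (rule assms s2 t2 st(3) boundary_2_cell[OF assms(1) s2] boundary_2_cell[OF assms(1) t2] F1 \<phi>im cm onto)+
  qed
qed

section \<open>Local constructions of simplicial complexes\<close>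

lemma pi1_rank_le_mono: "pi1_rank_le S n \<Longrightarrow> n \<le> m \<Longrightarrow> pi1_rank_le S m"
  unfolding pi1_rank_le_def by (meson le_trans)

context
  fixes C :: "'a::euclidean_space set set"
  assumes C: "simplicial_complex C"
begin

lemma sc_same_dim:
  assumes "S \<in> C" "S' \<in> C" "S \<subseteq> S'" "n simplex S" "n simplex S'"
  shows "S = S'"
  using face_of_aff_dim_lt[OF sc_convex[OF C assms(2)] sc_subset_face[OF C assms(1-3)]]
    aff_dim_simplex[OF assms(4)] aff_dim_simplex[OF assms(5)] by force

lemma sc_rel_interior_eq: "S \<in> C \<Longrightarrow> S' \<in> C \<Longrightarrow> rel_interior S = rel_interior S' \<Longrightarrow> S = S'"
  using convex_closure_rel_interior[OF sc_convex[OF C]] sc_closed[OF C] by (metis closure_closed)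

text \<open>The generating half of van Kampen's theorem with an empty second part: no new generator
  arises.\<close>

lemma rank_add_star:
  assumes Y: "upper_set C Y" "pi1_rank_le (cell_union Y) n" and c: "c \<in> C" "c \<noteq> {}"
    and pc: "path_connected (cell_union Y \<inter> cell_union (star C c))" "cell_union Y \<inter> cell_union (star C c) \<noteq> {}"
  shows "pi1_rank_le (cell_union (Y \<union> star C c)) n"
proof -
  have up: "upper_set C (Y \<union> star C c)"
    using upper_set_Un[OF Y(1) upper_set_star] .
  have "openin (top_of_set (cell_union Y \<union> cell_union (star C c))) (cell_union Y)"
    "openin (top_of_set (cell_union Y \<union> cell_union (star C c))) (cell_union (star C c))"
    using openin_cell_union_gen[OF C Y(1) up] openin_cell_union_gen[OF C upper_set_star up]
    by (simp_all add: cell_union_Un)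
  from pi1_rank_le_Un[OF this Y(2) simply_connected_star[OF C c], of _ "{}"] pc
  show ?thesis by (simp add: cell_union_Un)
qed

end

section \<open>Following the cells of all stages into the final complex\<close>

primrec compose_from :: "(nat \<Rightarrow> 'a \<Rightarrow> 'a) \<Rightarrow> nat \<Rightarrow> nat \<Rightarrow> 'a \<Rightarrow> 'a" where
  "compose_from g i 0 = id"
| "compose_from g i (Suc n) = compose_from g (Suc i) n \<circ> g i"

text \<open>The step maps are fixed as a family \<open>g\<close>, so that they can be composed to a
  map from every stage to the last one. \<open>M\<close> is the stage where gluings end and
  identifications begin.\<close>

locale lc_sequence =
  fixes C :: "'a::euclidean_space set set" and T :: "nat \<Rightarrow> (nat \<Rightarrow> real) cell_complex"
    and M k :: nat and g :: "nat \<Rightarrow> (nat \<Rightarrow> real) \<Rightarrow> nat \<Rightarrow> real" and h :: "(nat \<Rightarrow> real) \<Rightarrow> 'a"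
  assumes C: "simplicial_complex C" and M: "1 \<le> M" "M \<le> k"
    and T: "\<And>i. 1 \<le> i \<Longrightarrow> i \<le> k \<Longrightarrow> pseudomanifold 3 (T i)"
    and start: "is_simplex_complex 3 (T 1)"
    and glue: "\<And>i. 1 \<le> i \<Longrightarrow> i < M \<Longrightarrow> \<exists>s D. gluing (T i) (T (Suc i)) s D (g i)"
    and identify: "\<And>i. M \<le> i \<Longrightarrow> i < k \<Longrightarrow> \<exists>s t F \<phi>. identification (T i) (T (Suc i)) s t F \<phi> (g i)"
    and h: "homeomorphic_map (carrier_space (T k)) (top_of_set (\<Union>C)) h"
      "\<And>n. ncells (cell_complex_of C) n = (`) h ` ncells (T k) n"
begin

lemma CW: "1 \<le> i \<Longrightarrow> i \<le> k \<Longrightarrow> finite_regular_CW (T i)"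
  using T pseudomanifold_CW by blast

definition to_last :: "nat \<Rightarrow> (nat \<Rightarrow> real) \<Rightarrow> nat \<Rightarrow> real" where
  "to_last i = compose_from g i (k - i)"

definition f :: "nat \<Rightarrow> (nat \<Rightarrow> real) \<Rightarrow> 'a" where
  "f i = h \<circ> to_last i"

text \<open>The simplex of \<open>C\<close> that the cell finally becomes. Distinct triangles of a
  stage may share it, distinct tetrahedra do not.\<close>

definition simp_of :: "nat \<Rightarrow> (nat \<Rightarrow> real) set \<Rightarrow> 'a set" where
  "simp_of i c = f i ` closed_cell (T i) c"

lemma step_cell_map: "1 \<le> i \<Longrightarrow> i < k \<Longrightarrow> cell_map (g i) (T i) (T (Suc i))"
proof (cases "i < M")
  case True
  assume "1 \<le> i" "i < k"
  then obtain s D where "gluing (T i) (T (Suc i)) s D (g i)" using glue True by blast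
  then show ?thesis by (simp add: gluing_def)
next
  case False
  assume "1 \<le> i" "i < k"
  then obtain s t F \<phi> where "identification (T i) (T (Suc i)) s t F \<phi> (g i)" using identify False by force
  then show ?thesis by (simp add: identification_def)
qed

lemma step_inj_top_cells:
  assumes "1 \<le> i" "i < k" "D \<in> ncells (T i) 3" "D' \<in> ncells (T i) 3" "g i ` D = g i ` D'"
  shows "D = D'"
proof (cases "i < M")
  case True
  then obtain s E where "gluing (T i) (T (Suc i)) s E (g i)" using glue assms(1) by blast
  then show ?thesis using gluing.image_eq_iff assms(3-5) by blast
next
  case False
  then obtain s t F \<phi> where "identification (T i) (T (Suc i)) s t F \<phi> (g i)" using identify assms(2) by force
  then show ?thesis using identification.inj_top_cells assms(3-5) by blast
qed

lemma to_last_k: "to_last k = id"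
  by (simp add: to_last_def)

lemma to_last_step: "i < k \<Longrightarrow> to_last i = to_last (Suc i) \<circ> g i"
  unfolding to_last_def by (simp add: Suc_diff_Suc[symmetric])

lemma f_step: "i < k \<Longrightarrow> f i = f (Suc i) \<circ> g i"
  by (simp add: f_def to_last_step comp_assoc)

lemma cell_map_id: "cell_map id S S"
  by (simp add: cell_map_def)

lemma to_last_cell_map:
  assumes "1 \<le> i" "i \<le> k"
  shows "cell_map (to_last i) (T i) (T k)"
  using assms(2,1)
proof (induction rule: inc_induct)
  case base
  show ?case unfolding to_last_k by (rule cell_map_id)
next
  case (step i)
  have "cell_map (to_last (Suc i) \<circ> g i) (T i) (T k)"
    by (rule cell_map_compose[OF step_cell_map step.IH]) (use step.hyps step.prems in simp_all)
  then show ?case unfolding to_last_step[OF step.hyps(2)] .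
qed

lemma to_last_inj_top_cells:
  assumes "1 \<le> i" "i \<le> k"
  shows "\<forall>D \<in> ncells (T i) 3. \<forall>D' \<in> ncells (T i) 3. to_last i ` D = to_last i ` D' \<longrightarrow> D = D'"
  using assms(2,1)
proof (induction rule: inc_induct)
  case base
  then show ?case by (simp add: to_last_k)
next
  case (step i)
  have cm: "cell_map (g i) (T i) (T (Suc i))" using step by (intro step_cell_map) auto
  show ?case
  proof (intro ballI impI)
    fix D D' assume D: "D \<in> ncells (T i) 3" "D' \<in> ncells (T i) 3" and eq: "to_last i ` D = to_last i ` D'"
    have "to_last (Suc i) ` g i ` D = to_last (Suc i) ` g i ` D'"
      using eq step.hyps by (simp add: to_last_step image_comp)
    moreover have "g i ` D \<in> ncells (T (Suc i)) 3" "g i ` D' \<in> ncells (T (Suc i)) 3"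
      using cm D by (simp_all add: cell_map_def)
    ultimately have "g i ` D = g i ` D'" using step by simp
    then show "D = D'" using step_inj_top_cells[of i D D'] step D by simp
  qed
qed

lemma h_inj: "inj_on h (points (T k))"
  using h(1) unfolding homeomorphic_map_def by blast

lemma to_last_image_subset: "1 \<le> i \<Longrightarrow> i \<le> k \<Longrightarrow> c \<in> ncells (T i) n \<Longrightarrow> to_last i ` c \<in> ncells (T k) n"
  using to_last_cell_map by (simp add: cell_map_def)

lemma simp_of_last:
  assumes c: "c \<in> ncells (T k) n"
  shows "h ` closed_cell (T k) c \<in> C" "int n simplex (h ` closed_cell (T k) c)"
    "h ` c = rel_interior (h ` closed_cell (T k) c)"
proof -
  have "h ` c \<in> ncells (cell_complex_of C) n" using c h(2) by blast
  then obtain S where S: "S \<in> C" "int n simplex S" "h ` c = rel_interior S"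
    by (auto simp: cell_complex_of_def)
  have "c \<subseteq> points (T k)" using cell_subset_topspace[OF CW c] M by simp
  then have "h ` closed_cell (T k) c = closed_cell (cell_complex_of C) (h ` c)"
    unfolding closed_cell_def using homeomorphic_map_closure_of[OF h(1)] by (simp add: cell_complex_of_def)
  also have "\<dots> = S" unfolding S(3) by (rule closed_cell_complex_of[OF C S(1)])
  finally show "h ` closed_cell (T k) c \<in> C" "int n simplex (h ` closed_cell (T k) c)"
    "h ` c = rel_interior (h ` closed_cell (T k) c)" using S by simp_all
qed

lemma simp_of_eq:
  assumes "1 \<le> i" "i \<le> k" "c \<in> ncells (T i) n"
  shows "simp_of i c = h ` closed_cell (T k) (to_last i ` c)"
  unfolding simp_of_def f_def image_comp[symmetric]
  using cell_map_closed_cell[OF CW CW to_last_cell_map assms(3)] assms M by simp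

lemma simp_of:
  assumes "1 \<le> i" "i \<le> k" "c \<in> ncells (T i) n"
  shows "simp_of i c \<in> C" "int n simplex (simp_of i c)" "f i ` c = rel_interior (simp_of i c)"
  using simp_of_last[OF to_last_image_subset[OF assms]]
  unfolding simp_of_eq[OF assms] f_def image_comp by simp_all

lemma simp_of_mono:
  assumes "1 \<le> i" "i \<le> k" "c \<subseteq> closed_cell (T i) e"
  shows "simp_of i c \<subseteq> simp_of i e"
  unfolding simp_of_def using closed_cell_mono[OF CW assms(3)] assms by blast

lemma simp_of_step:
  assumes "1 \<le> i" "i < k" "c \<in> ncells (T i) n"
  shows "simp_of (Suc i) (g i ` c) = simp_of i c"
  unfolding simp_of_def f_step[OF assms(2)] image_comp[symmetric]
  using cell_map_closed_cell[OF CW CW step_cell_map assms(3)] assms by simp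

lemma simp_of_eq_imp:
  assumes "1 \<le> i" "i \<le> k" "c \<in> ncells (T i) n" "c' \<in> ncells (T i) n" "simp_of i c = simp_of i c'"
  shows "to_last i ` c = to_last i ` c'"
proof -
  have "h ` to_last i ` c = h ` to_last i ` c'"
    using simp_of(3)[OF assms(1-3)] simp_of(3)[OF assms(1,2,4)] assms(5) by (simp add: f_def image_comp)
  then show ?thesis
    using inj_on_image_eq_iff[OF h_inj] cell_subset_topspace[OF CW to_last_image_subset] assms M by simp
qed

lemma simp_of_inj_top_cells:
  assumes "1 \<le> i" "i \<le> k" "D \<in> ncells (T i) 3" "D' \<in> ncells (T i) 3" "simp_of i D = simp_of i D'"
  shows "D = D'"
  using to_last_inj_top_cells[OF assms(1,2)] simp_of_eq_imp[OF assms] assms(3,4) by simp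

lemma f_mem_simp_of: "x \<in> closed_cell (T i) c \<Longrightarrow> f i x \<in> simp_of i c"
  by (simp add: simp_of_def)

text \<open>The count takes place in \<open>C\<close>: triangles of \<open>D\<close> at
  \<open>x\<close> become triangles of a geometric tetrahedron that contain the edge through
  \<open>f i x\<close>. Distinct ones stay distinct because the map to the last stage cannot fold
  \<open>D\<close>.\<close>

lemma two_faces: "1 \<le> i \<Longrightarrow> i \<le> k \<Longrightarrow> two_faces_at_edges (T i)"
  unfolding two_faces_at_edges_def
proof (intro ballI)
  assume i: "1 \<le> i" "i \<le> k"
  fix x D assume x: "x \<in> \<Union>(ncells (T i) 1)" and D: "D \<in> ncells (T i) 3"
  then obtain e where e: "e \<in> ncells (T i) 1" "x \<in> e" by blast
  let ?A = "{s \<in> ncells (T i) 2. x \<in> closed_cell (T i) s \<and> s \<subseteq> closed_cell (T i) D}"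
  let ?B = "{t \<in> C. 2 simplex t \<and> simp_of i e \<subseteq> t \<and> t \<subseteq> simp_of i D}"
  have "simp_of i ` ?A \<subseteq> ?B"
  proof
    fix t assume "t \<in> simp_of i ` ?A"
    then obtain s where s: "s \<in> ncells (T i) 2" "x \<in> closed_cell (T i) s" "s \<subseteq> closed_cell (T i) D" "t = simp_of i s"
      by blast
    have "f i x \<in> rel_interior (simp_of i e)" using simp_of(3)[OF i e(1)] e(2) by blast
    then have "simp_of i e \<subseteq> t"
      unfolding s(4) using f_mem_simp_of[OF s(2)]
      by (intro sc_rel_interior_subset[OF C simp_of(1)[OF i e(1)] simp_of(1)[OF i s(1)]])
    then show "t \<in> ?B"
      using simp_of(1,2)[OF i s(1)] simp_of_mono[OF i s(3)] s(4) by simp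
  qed
  moreover have "inj_on (simp_of i) ?A"
  proof (rule inj_onI)
    fix s t assume st: "s \<in> ?A" "t \<in> ?A" "simp_of i s = simp_of i t"
    then have "to_last i ` s = to_last i ` t" using simp_of_eq_imp[OF i, of s 2 t] by simp
    moreover have "D \<in> ncells (T i) (Suc 2)" using D by (simp add: numeral_3_eq_3)
    ultimately show "s = t"
      using st cell_map_no_fold[OF CW[OF i] CW to_last_cell_map[OF i], of D 2 s t] M by simp
  qed
  ultimately have "card ?A \<le> card ?B"
    using sc_finite[OF C] by (intro card_inj_on_le[of "simp_of i"]) auto
  also have "\<dots> \<le> 2"
    using simp_of[OF i D] simp_of[OF i e(1)] by (intro card_triangles_at_edge[OF C]) simp_all
  finally show "card ?A \<le> 2" .
qed

lemma invariants:
  assumes "1 \<le> i" "i \<le> k"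
  shows "locally_strongly_connected (T i) \<and> two_free_faces_at_edges (T i)"
  using assms
proof (induction i rule: dec_induct)
  case base
  show ?case using simplex_complex_invariants[OF start] two_faces[of 1] M by auto
next
  case (step i)
  then have IH: "locally_strongly_connected (T i)" "two_free_faces_at_edges (T i)" by simp_all
  show ?case
  proof (cases "i < M")
    case True
    then obtain s D where *: "gluing (T i) (T (Suc i)) s D (g i)" using glue step.hyps by blast
    show ?thesis
      using gluing.connected[OF * IH(1)] gluing.free_faces[OF * IH(2) two_faces[of "Suc i"]] step.prems by simp
  next
    case False
    then obtain s t F \<phi> where "identification (T i) (T (Suc i)) s t F \<phi> (g i)"
      using identify[of i] step by force
    then show ?thesis using identification.connected identification.free_faces IH by blast
  qed
qed

section \<open>Tetrahedra of the final complex and their adjacency\<close>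

definition glued :: "nat \<Rightarrow> 'a set set" where
  "glued i = simp_of i ` interior_faces (T i)"

definition tops :: "nat \<Rightarrow> 'a set set" where
  "tops i = simp_of i ` ncells (T i) 3"

lemma cell_over:
  assumes "S \<in> C" "int n simplex S"
  obtains c where "c \<in> ncells (T k) n" "simp_of k c = S"
proof -
  have "rel_interior S \<in> ncells (cell_complex_of C) n"
    using assms by (auto simp: cell_complex_of_def)
  then obtain c where c: "c \<in> ncells (T k) n" "rel_interior S = h ` c" unfolding h(2) by blast
  have k: "1 \<le> k" "k \<le> k" using M by simp_all
  have "rel_interior (simp_of k c) = rel_interior S"
    using simp_of(3)[OF k c(1)] c(2) by (simp add: f_def to_last_k)
  then have "simp_of k c = S" using sc_rel_interior_eq[OF C simp_of(1)[OF k c(1)] assms(1)] by simp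
  with c(1) show ?thesis by (rule that)
qed

lemma sc_nat_simplex: "S \<in> C \<Longrightarrow> S \<noteq> {} \<Longrightarrow> \<exists>n. int n simplex S"
proof -
  assume S: "S \<in> C" "S \<noteq> {}"
  then obtain n where n: "n simplex S" using sc_simplex[OF C] by blast
  have "n \<noteq> -1" using n S(2) by auto
  then have "int (nat n) = n" using simplex_dim_ge[OF n] by simp
  with n show ?thesis by metis
qed

lemma tops_subset: "1 \<le> i \<Longrightarrow> i \<le> k \<Longrightarrow> tops i \<subseteq> tets C"
  using simp_of(1,2)[of i _ 3] by (auto simp: tops_def tets_def)

lemma tops_k: "tops k = tets C"
proof
  show "tops k \<subseteq> tets C" using tops_subset M by simp
  show "tets C \<subseteq> tops k"
  proof
    fix S assume "S \<in> tets C"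
    then have "S \<in> C" "int 3 simplex S" by (simp_all add: tets_def)
    then obtain c where "c \<in> ncells (T k) 3" "simp_of k c = S" by (rule cell_over)
    then show "S \<in> tops k" by (auto simp: tops_def)
  qed
qed

lemma pure_nonempty: "S \<in> C \<Longrightarrow> S \<noteq> {} \<Longrightarrow> \<exists>D \<in> tets C. S \<subseteq> D"
proof -
  assume S: "S \<in> C" "S \<noteq> {}"
  have k: "1 \<le> k" "k \<le> k" using M by simp_all
  obtain n where n: "int n simplex S" using sc_nat_simplex[OF S] by blast
  obtain c where c: "c \<in> ncells (T k) n" "simp_of k c = S" using cell_over[OF S(1) n] .
  obtain D where D: "D \<in> ncells (T k) 3" "c \<subseteq> closed_cell (T k) D"
    using pseudomanifold_pure[OF T[OF k] c(1)] by blast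
  then have "simp_of k D \<in> tops k" by (simp add: tops_def)
  then show ?thesis using simp_of_mono[OF k D(2)] c(2) tops_k by auto
qed

lemma pure: "S \<in> C \<Longrightarrow> \<exists>D \<in> tets C. S \<subseteq> D"
proof (cases "S = {}")
  case True
  \<comment> \<open>The empty face, too, needs a tetrahedron above it; the first simplex supplies
    one.\<close>
  obtain D where "ncells (T 1) 3 = {D}" by (rule simplex_complex_invariants[OF start])
  then have "D \<in> ncells (T 1) 3" by simp
  then have "simp_of 1 D \<in> tets C" using tops_subset[of 1] M by (auto simp: tops_def)
  with True show ?thesis by blast
qed (use pure_nonempty in simp)

lemma tet_maximal: "S \<in> tets C \<Longrightarrow> S' \<in> C \<Longrightarrow> S \<subseteq> S' \<Longrightarrow> S' = S"
proof -
  assume S: "S \<in> tets C" "S' \<in> C" "S \<subseteq> S'"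
  obtain D where D: "D \<in> tets C" "S' \<subseteq> D" using pure[OF S(2)] by blast
  then have "S = D" using sc_same_dim[OF C, of S D 3] S by (auto simp: tets_def)
  with D(2) S(3) show ?thesis by simp
qed

lemma card_tets_at_triangle:
  assumes t: "t \<in> C" "2 simplex t"
  shows "card {S \<in> tets C. t \<subseteq> S} \<le> 2"
proof -
  have k: "1 \<le> k" "k \<le> k" using M by simp_all
  have "int 2 simplex t" using t(2) by simp
  then obtain c where c: "c \<in> ncells (T k) 2" "simp_of k c = t" using cell_over[OF t(1)] by blast
  have hc: "h ` c = rel_interior t" using simp_of(3)[OF k c(1)] c(2) by (simp add: f_def to_last_k)
  have "{S \<in> tets C. t \<subseteq> S} \<subseteq> simp_of k ` cofacets 3 (T k) c"
  proof
    fix S assume S: "S \<in> {S \<in> tets C. t \<subseteq> S}"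
    then have "S \<in> tops k" using tops_k by simp
    then obtain E where E: "E \<in> ncells (T k) 3" "S = simp_of k E" by (auto simp: tops_def)
    have "h ` c \<subseteq> h ` closed_cell (T k) E"
      using S E(2) hc rel_interior_subset[of t] by (auto simp: simp_of_def f_def to_last_k)
    then have "c \<subseteq> closed_cell (T k) E"
      using inj_on_image_subset_iff[OF h_inj cell_subset_topspace[OF CW[OF k] c(1)] closed_cell_topspace[OF CW[OF k]]]
      by simp
    with E show "S \<in> simp_of k ` cofacets 3 (T k) c" by (simp add: mem_cofacets)
  qed
  then have "card {S \<in> tets C. t \<subseteq> S} \<le> card (simp_of k ` cofacets 3 (T k) c)"
    using finite_cofacets[OF CW[OF k]] by (intro card_mono) simp_all
  also have "\<dots> \<le> card (cofacets 3 (T k) c)" using finite_cofacets[OF CW[OF k]] by (rule card_image_le)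
  also have "\<dots> \<le> 2" by (rule pseudomanifold_cofacets_card[OF T[OF k] c(1)])
  finally show ?thesis .
qed

lemma star_triangle:
  assumes t: "t \<in> C" "2 simplex t"
  shows "star C t = insert t {S \<in> tets C. t \<subseteq> S}"
proof
  show "insert t {S \<in> tets C. t \<subseteq> S} \<subseteq> star C t" using t(1) by (auto simp: star_def tets_def)
  show "star C t \<subseteq> insert t {S \<in> tets C. t \<subseteq> S}"
  proof
    fix S assume "S \<in> star C t"
    then have S: "S \<in> C" "t \<subseteq> S" by (simp_all add: star_def)
    obtain n where n: "n simplex S" using sc_simplex[OF C S(1)] by blast
    obtain D where D: "D \<in> C" "3 simplex D" "S \<subseteq> D" using pure[OF S(1)] by (auto simp: tets_def)
    have "aff_dim t \<le> aff_dim S" "aff_dim S \<le> aff_dim D" using S(2) D(3) by (simp_all add: aff_dim_subset)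
    then have "n = 2 \<or> n = 3"
      using aff_dim_simplex[OF t(2)] aff_dim_simplex[OF n] aff_dim_simplex[OF D(2)] by linarith
    then show "S \<in> insert t {S \<in> tets C. t \<subseteq> S}"
      using sc_same_dim[OF C t(1) S t(2)] n S by (auto simp: tets_def)
  qed
qed

text \<open>A triangle shared by two different tetrahedra is interior, so its simplex is in
  \<open>glued i\<close>; it contains \<open>c\<close> since it contains the relative interior point
  \<open>f i x\<close> of \<open>c\<close>.\<close>

lemma chain:
  assumes i: "1 \<le> i" "i \<le> k" and c: "c \<in> C" "f i x \<in> rel_interior c"
    and "(D, D') \<in> (adjacency_at (T i) x)\<^sup>*"
  shows "(simp_of i D, simp_of i D') \<in> (tet_adjacency C (glued i) c)\<^sup>*"
  using assms(5)
proof (induction rule: rtrancl_induct)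
  case (step E E')
  then obtain s where E: "E \<in> ncells (T i) 3" "E' \<in> ncells (T i) 3"
    and s: "s \<in> ncells (T i) 2" "x \<in> closed_cell (T i) s" "s \<subseteq> closed_cell (T i) E" "s \<subseteq> closed_cell (T i) E'"
    by (auto simp: adjacency_at_def)
  show ?case
  proof (cases "E = E'")
    case False
    have "E \<in> cofacets 3 (T i) s" "E' \<in> cofacets 3 (T i) s" using E s by (simp_all add: mem_cofacets)
    then have "s \<in> interior_faces (T i)" using s(1) False unfolding interior_faces_def by blast
    then have "simp_of i s \<in> glued i" by (simp add: glued_def)
    moreover have "c \<subseteq> simp_of i s"
      using sc_rel_interior_subset[OF C c(1) simp_of(1)[OF i s(1)] c(2) f_mem_simp_of[OF s(2)]] .
    moreover have "simp_of i E \<in> tets C" "simp_of i E' \<in> tets C"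
      using tops_subset[OF i] E by (auto simp: tops_def)
    ultimately have "(simp_of i E, simp_of i E') \<in> tet_adjacency C (glued i) c"
      using simp_of_mono[OF i s(3)] simp_of_mono[OF i s(4)] unfolding tet_adjacency_def[OF C] by blast
    with step.IH show ?thesis by (rule rtrancl_into_rtrancl)
  qed (use step.IH in simp)
qed simp

text \<open>Tetrahedra of \<open>C\<close> around \<open>c\<close> contain \<open>f i x\<close>. As
  \<open>x\<close> is the only point over it, the cells over these tetrahedra contain
  \<open>x\<close> itself, and strong connectedness at \<open>x\<close> applies. With a larger
  fibre, they might belong to unrelated points.\<close>

lemma connected_at_point:
  assumes i: "1 \<le> i" "i \<le> k" and x: "x \<in> points (T i)" "c \<in> C" "f i x \<in> rel_interior c"
    and fib: "\<And>y. y \<in> points (T i) \<Longrightarrow> f i y = f i x \<Longrightarrow> y = x"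
    and D: "S \<in> tops i" "S' \<in> tops i" "c \<subseteq> S" "c \<subseteq> S'"
  shows "(S, S') \<in> (tet_adjacency C (glued i) c)\<^sup>*"
proof -
  have lift: "x \<in> closed_cell (T i) E" if "c \<subseteq> simp_of i E" for E
  proof -
    have "f i x \<in> simp_of i E" using x(3) that rel_interior_subset by blast
    then obtain y where y: "y \<in> closed_cell (T i) E" "f i y = f i x" by (auto simp: simp_of_def image_iff)
    then have "y = x" using fib closed_cell_topspace[OF CW[OF i]] by blast
    with y(1) show ?thesis by simp
  qed
  obtain E E' where E: "E \<in> ncells (T i) 3" "S = simp_of i E" "E' \<in> ncells (T i) 3" "S' = simp_of i E'"
    using D(1,2) by (auto simp: tops_def)
  have "(E, E') \<in> (adjacency_at (T i) x)\<^sup>*"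
    using invariants[OF i] x(1) E(1,3) lift[of E] lift[of E'] D(3,4) E(2,4)
    unfolding locally_strongly_connected_def by simp
  then show ?thesis using chain[OF i x(2,3)] E(2,4) by simp
qed

lemma connected_last:
  assumes c: "c \<in> C" "c \<noteq> {}" and S: "S \<in> tets C" "S' \<in> tets C" "c \<subseteq> S" "c \<subseteq> S'"
  shows "(S, S') \<in> (tet_adjacency C (glued k) c)\<^sup>*"
proof -
  have k: "1 \<le> k" "k \<le> k" using M by simp_all
  obtain n where n: "int n simplex c" using sc_nat_simplex[OF c] by blast
  obtain e where e: "e \<in> ncells (T k) n" "simp_of k e = c" using cell_over[OF c(1) n] .
  obtain x where x: "x \<in> e" using cell_nonempty[OF CW[OF k] e(1)] by blast
  have xtop: "x \<in> points (T k)" using cell_subset_topspace[OF CW[OF k] e(1)] x by blast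
  have "f k x \<in> rel_interior c" using simp_of(3)[OF k e(1)] e(2) x by blast
  moreover have "y = x" if "y \<in> points (T k)" "f k y = f k x" for y
    using inj_onD[OF h_inj _ that(1) xtop] that(2) by (simp add: f_def to_last_k)
  ultimately show ?thesis
    using connected_at_point[OF k xtop c(1)] S unfolding tops_k by blast
qed

end

section \<open>Building up the complement of the knot\<close>

context lc_sequence
begin

text \<open>Downward from the last stage, where the map to \<open>C\<close> is injective: a point
  without free triangles keeps this property and has a one-point fibre in each
  identification.\<close>

lemma closed_point_fibre:
  assumes "M \<le> i" "i \<le> k"
  shows "\<forall>x \<in> points (T i). \<forall>y \<in> points (T i).
    free_faces_at (T i) x = {} \<longrightarrow> f i y = f i x \<longrightarrow> y = x"
  using assms(2,1)
proof (induction rule: inc_induct)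
  case base
  then show ?case using h_inj by (simp add: f_def to_last_k inj_on_def)
next
  case (step i)
  have i: "1 \<le> i" "i < k" using step.hyps step.prems M by simp_all
  obtain s t F \<phi> where "identification (T i) (T (Suc i)) s t F \<phi> (g i)"
    using identify step.hyps step.prems by blast
  then interpret identification "T i" "T (Suc i)" s t F \<phi> "g i" .
  show ?case
  proof (intro ballI impI)
    fix x y assume x: "x \<in> points (T i)" "free_faces_at (T i) x = {}"
      and y: "y \<in> points (T i)" "f i y = f i x"
    have "g i x \<in> points (T (Suc i))" "g i y \<in> points (T (Suc i))"
      using q(2) x(1) y(1) by blast+
    moreover have "f (Suc i) (g i y) = f (Suc i) (g i x)" using y(2) i by (simp add: f_step)
    ultimately have "g i y = g i x" using step.IH step.prems closed_point(2)[OF x] by simp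
    then show "y = x" by (rule closed_point(1)[OF x y(1)])
  qed
qed

text \<open>One point per edge is enough to test whether the edge is closed, and it makes
  unnecessary any comparison of the free triangles at different points of an open edge.\<close>

definition mark :: "'a set \<Rightarrow> 'a" where
  "mark e = (SOME z. z \<in> rel_interior e)"

lemma mark: "e \<in> C \<Longrightarrow> e \<noteq> {} \<Longrightarrow> mark e \<in> rel_interior e"
  unfolding mark_def using rel_interior_eq_empty[OF sc_convex[OF C]] by (simp add: some_in_eq)

text \<open>The edges of \<open>C\<close> around which the complex \<open>T i\<close> already closes up. No free triangle at \<open>x\<close> means
  that no later identification moves \<open>x\<close>, so \<open>x\<close> is the only point over the marked point of the edge.\<close>

definition closed_edges :: "nat \<Rightarrow> 'a set set" where
  "closed_edges i = {e \<in> C. 1 simplex e \<and>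
     (\<exists>x \<in> points (T i). f i x = mark e \<and> free_faces_at (T i) x = {})}"

text \<open>Tetrahedra are never merged on the way to \<open>C\<close>, so the glued cell yields a
  tetrahedron \<open>S\<close> that was not there before; \<open>r\<close> is the triangle of the
  gluing.\<close>

lemma glue_data:
  assumes i: "1 \<le> i" "i < M"
  obtains r S S' where "r \<in> C" "2 simplex r" "S \<in> tets C" "S \<notin> tops i" "S' \<in> tops i" "r \<subseteq> S" "r \<subseteq> S'"
    "tops (Suc i) = insert S (tops i)" "glued (Suc i) \<subseteq> insert r (glued i)"
proof -
  note PM = T
  obtain s D where "gluing (T i) (T (Suc i)) s D (g i)" using glue i by blast
  then interpret gluing "T i" "T (Suc i)" s D "g i" .
  have ik: "i \<le> k" "i < k" "1 \<le> Suc i" "Suc i \<le> k" using i M by simp_all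
  have "simp_of (Suc i) ` (`) (g i) ` ncells (T i) 3 = tops i"
    unfolding tops_def image_image using simp_of_step[OF i(1) ik(2)] by (intro image_cong) simp_all
  then have tops: "tops (Suc i) = insert (simp_of (Suc i) D) (tops i)"
    unfolding tops_def[of "Suc i"] top_cells by simp
  have "simp_of (Suc i) D \<notin> tops i"
  proof
    assume "simp_of (Suc i) D \<in> tops i"
    then obtain E where E: "E \<in> ncells (T i) 3" "simp_of (Suc i) D = simp_of i E" by (auto simp: tops_def)
    then have "simp_of (Suc i) D = simp_of (Suc i) (g i ` E)" using simp_of_step[OF i(1) ik(2) E(1)] by simp
    then have "D = g i ` E"
      using simp_of_inj_top_cells[OF ik(3,4) D, of "g i ` E"] E(1) top_cells by simp
    with E(1) new_cell show False by simp
  qed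
  moreover have "simp_of (Suc i) D \<in> tets C" using tops_subset[OF ik(3,4)] tops by simp
  moreover obtain Ds where Ds: "Ds \<in> ncells (T i) 3" "s \<subseteq> closed_cell (T i) Ds"
    using pseudomanifold_pure[OF PM[OF i(1) ik(1)] s(1)] by blast
  moreover have "simp_of i s \<subseteq> simp_of (Suc i) D"
    using simp_of_mono[OF ik(3,4) glue_face] simp_of_step[OF i(1) ik(2) s(1)] by simp
  moreover have "glued (Suc i) \<subseteq> insert (simp_of i s) (glued i)"
  proof
    fix r assume "r \<in> glued (Suc i)"
    then obtain c where "c \<in> interior_faces (T (Suc i))" "r = simp_of (Suc i) c" by (auto simp: glued_def)
    then obtain d where "d = s \<or> d \<in> interior_faces (T i)" "r = simp_of (Suc i) (g i ` d)"
      using interior_faces_subset by (auto simp: subset_iff)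
    moreover from this(1) have "d \<in> ncells (T i) 2" using s(1) by (auto simp: interior_faces_def)
    ultimately show "r \<in> insert (simp_of i s) (glued i)"
      using simp_of_step[OF i(1) ik(2), of d 2] by (auto simp: glued_def)
  qed
  ultimately show ?thesis
    using that[of "simp_of i s" "simp_of (Suc i) D" "simp_of i Ds"] simp_of[OF i(1) ik(1) s(1)]
      simp_of_mono[OF i(1) ik(1) Ds(2)] tops by (simp add: tops_def)
qed

lemma closed_edges_mono:
  assumes i: "M \<le> i" "i < k"
  shows "closed_edges i \<subseteq> closed_edges (Suc i)"
proof
  obtain s t F \<phi> where "identification (T i) (T (Suc i)) s t F \<phi> (g i)" using identify i by blast
  then interpret identification "T i" "T (Suc i)" s t F \<phi> "g i" .
  fix e assume "e \<in> closed_edges i"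
  then obtain x where e: "e \<in> C" "1 simplex e"
    and x: "x \<in> points (T i)" "free_faces_at (T i) x = {}" "f i x = mark e"
    by (auto simp: closed_edges_def)
  have "g i x \<in> points (T (Suc i))" using q(2) x(1) by blast
  moreover have "f (Suc i) (g i x) = mark e" using x(3) i by (simp add: f_step)
  ultimately show "e \<in> closed_edges (Suc i)"
    using closed_point(2)[OF x(1,2)] e by (auto simp: closed_edges_def)
qed

lemma tops_step_identify:
  assumes i: "M \<le> i" "i < k"
  shows "tops (Suc i) = tops i"
proof -
  obtain s t F \<phi> where "identification (T i) (T (Suc i)) s t F \<phi> (g i)" using identify i by blast
  then interpret identification "T i" "T (Suc i)" s t F \<phi> "g i" .
  have "1 \<le> i" using i M by simp
  then show ?thesis
    unfolding tops_def q(4)[of 3] image_image using simp_of_step[of i _ 3] i by (intro image_cong) simp_all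
qed

text \<open>Downward from the last stage, where every tetrahedron of \<open>C\<close> is present: an
  identification does not change the set of tetrahedra.\<close>

lemma tops_all:
  assumes "M \<le> i" "i \<le> k"
  shows "tops i = tets C"
  using assms(2,1)
proof (induction rule: inc_induct)
  case base
  show ?case by (rule tops_k)
next
  case (step i)
  then show ?case using tops_step_identify by simp
qed

text \<open>\<open>t\<close> comes from the two identified triangles and \<open>e\<close> from their
  common edge. A point over \<open>mark e\<close> without free triangles would be the only one over
  it, but the point on \<open>F\<close> has free triangles; after the step it has none. Hence its
  fibre is a single point even before the step, and the chains around \<open>e\<close> pass only
  through triangles glued earlier.\<close>

lemma identify_data:
  assumes i: "M \<le> i" "i < k"
  obtains t e where "t \<in> C" "2 simplex t" "e \<in> C" "1 simplex e" "e \<subseteq> t"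
    "glued (Suc i) \<subseteq> insert t (glued i)" "e \<notin> closed_edges i" "e \<in> closed_edges (Suc i)"
    "\<And>S S'. S \<in> tets C \<Longrightarrow> S' \<in> tets C \<Longrightarrow> e \<subseteq> S \<Longrightarrow> e \<subseteq> S' \<Longrightarrow> (S, S') \<in> (tet_adjacency C (glued i) e)\<^sup>*"
proof -
  note CWi = CW
  obtain s t F \<phi> where "identification (T i) (T (Suc i)) s t F \<phi> (g i)" using identify i by blast
  then interpret identification "T i" "T (Suc i)" s t F \<phi> "g i" .
  have ik: "1 \<le> i" "i \<le> k" "1 \<le> Suc i" "Suc i \<le> k" using i M by simp_all
  let ?t = "simp_of i s" and ?e = "simp_of i F"
  have free: "two_free_faces_at_edges (T i)" using invariants[OF ik(1,2)] by simp
  have e: "?e \<in> C" "1 simplex ?e" "f i ` F = rel_interior ?e" using simp_of[OF ik(1,2) F(1)] by simp_all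
  then have "?e \<noteq> {}" by auto
  then have "mark ?e \<in> f i ` F" using mark[OF e(1)] e(3) by simp
  then obtain x where x: "x \<in> F" "f i x = mark ?e" by auto
  have xtop: "x \<in> points (T i)"
    using cell_subset_topspace[OF CWi[OF ik(1,2)] F(1)] x(1) by blast
  note closing = closing_point[OF x(1) free]
  have gx: "g i x \<in> points (T (Suc i))" using q(2) xtop by blast
  have "?e \<notin> closed_edges i"
  proof
    assume "?e \<in> closed_edges i"
    then obtain x' where x': "x' \<in> points (T i)" "free_faces_at (T i) x' = {}" "f i x' = mark ?e"
      by (auto simp: closed_edges_def)
    then have "x = x'" using closed_point_fibre[OF i(1) ik(2)] xtop x(2) by simp
    with closing(3) x'(2) show False by simp
  qed
  moreover have "f (Suc i) (g i x) = mark ?e" using x(2) i(2) by (simp add: f_step)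
  then have "?e \<in> closed_edges (Suc i)"
    using gx closing(2) e(1,2) by (auto simp: closed_edges_def)
  moreover have "(S, S') \<in> (tet_adjacency C (glued i) ?e)\<^sup>*"
    if S: "S \<in> tets C" "S' \<in> tets C" "?e \<subseteq> S" "?e \<subseteq> S'" for S S'
  proof (rule connected_at_point[OF ik(1,2) xtop e(1) _ _ _ _ S(3,4)])
    show "f i x \<in> rel_interior ?e" using e(3) x(1) by blast
    show "S \<in> tops i" "S' \<in> tops i" using S(1,2) tops_all[OF i(1) ik(2)] by simp_all
    fix y assume y: "y \<in> points (T i)" "f i y = f i x"
    have "f (Suc i) (g i y) = f (Suc i) (g i x)" using y(2) i(2) by (simp add: f_step)
    moreover have "g i y \<in> points (T (Suc i))" using q(2) y(1) by blast
    ultimately have "g i y = g i x" using closed_point_fibre[of "Suc i"] ik(4) i(1) gx closing(2) by simp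
    then show "y = x" by (rule closing(1)[OF y(1)])
  qed
  moreover have "glued (Suc i) \<subseteq> insert ?t (glued i)"
  proof
    fix r assume "r \<in> glued (Suc i)"
    then obtain c where "c \<in> interior_faces (T (Suc i))" "r = simp_of (Suc i) c" by (auto simp: glued_def)
    then obtain d where "d = s \<or> d \<in> interior_faces (T i)" "r = simp_of (Suc i) (g i ` d)"
      using interior_faces_subset by (auto simp: subset_iff)
    moreover from this(1) have "d \<in> ncells (T i) 2" using s(1) by (auto simp: interior_faces_def)
    ultimately show "r \<in> insert ?t (glued i)"
      using simp_of_step[OF ik(1) i(2), of d 2] by (auto simp: glued_def)
  qed
  moreover have "?e \<subseteq> ?t" by (rule simp_of_mono[OF ik(1,2) F(2)])
  ultimately show ?thesis
    using that[of ?t ?e] e(1,2) simp_of[OF ik(1,2) s(1)] by simp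
qed

section \<open>Growing an open region with few generating loops\<close>

lemma simplex_nonempty: "n simplex S \<Longrightarrow> n \<ge> 0 \<Longrightarrow> S \<noteq> {}"
  by auto

text \<open>The star of the gluing triangle consists of this triangle, the new tetrahedron and an
  old one, and it meets the region in the old open tetrahedron, which is convex. That
  \<open>Y\<close> has only triangles and tetrahedra is recorded because it keeps \<open>Y\<close>
  off the knot.\<close>

lemma glue_phase:
  assumes "1 \<le> i" "i \<le> M"
  shows "\<exists>Y. upper_set C Y \<and> {} \<notin> Y \<and> pi1_rank_le (cell_union Y) 0 \<and> glued i \<subseteq> Y \<and>
    Y \<inter> tets C = tops i \<and> (\<forall>S\<in>Y. 2 simplex S \<or> 3 simplex S)"
  using assms
proof (induction i rule: dec_induct)
  case base
  obtain D where D: "ncells (T 1) 3 = {D}" "interior_faces (T 1) = {}"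
    by (rule simplex_complex_invariants[OF start])
  let ?S = "simp_of 1 D"
  have tops1: "tops 1 = {?S}" using D(1) by (simp add: tops_def)
  then have S: "?S \<in> tets C" using tops_subset[of 1] M by simp
  then have S': "?S \<in> C" "3 simplex ?S" "?S \<noteq> {}" by (auto simp: tets_def)
  have "upper_set C {?S}" using S'(1) tet_maximal[OF S] by (simp add: upper_set_def)
  moreover have "pi1_rank_le (cell_union {?S}) 0"
  proof (rule pi1_rank_le_simply_connected)
    show "simply_connected (cell_union {?S})"
      using convex_rel_interior[OF sc_convex[OF C S'(1)]] by (simp add: cell_union_def convex_imp_simply_connected)
    show "cell_union {?S} \<noteq> {}"
      using S'(3) rel_interior_eq_empty[OF sc_convex[OF C S'(1)]] by (simp add: cell_union_def)
  qed
  moreover have "glued 1 = {}" using D(2) by (simp add: glued_def)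
  ultimately show ?case using S S' tops1 by (intro exI[of _ "{?S}"]) auto
next
  case (step i)
  then obtain Y where Y: "upper_set C Y" "{} \<notin> Y" "pi1_rank_le (cell_union Y) 0" "glued i \<subseteq> Y"
    "Y \<inter> tets C = tops i" "\<forall>S\<in>Y. 2 simplex S \<or> 3 simplex S"
    by auto
  have "1 \<le> i" "i < M" using step by simp_all
  then obtain r S S' where r: "r \<in> C" "2 simplex r" and S: "S \<in> tets C" "S \<notin> tops i" "S' \<in> tops i" "r \<subseteq> S" "r \<subseteq> S'"
    and next_step: "tops (Suc i) = insert S (tops i)" "glued (Suc i) \<subseteq> insert r (glued i)"
    by (rule glue_data)
  have SY: "S \<notin> Y" "S' \<in> Y" "S' \<in> tets C" using S Y(5) by auto
  have SC: "S \<in> C" "S' \<in> C" using S(1) SY(3) by (auto simp: tets_def)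
  have rY: "r \<notin> Y" using Y(1) SC S(4) SY(1) unfolding upper_set_def by auto
  have "{S, S'} = {D \<in> tets C. r \<subseteq> D}"
  proof (rule card_seteq)
    show "finite {D \<in> tets C. r \<subseteq> D}"
      by (rule finite_subset[OF _ sc_finite[OF C]]) (auto simp: tets_def)
    have "S \<noteq> S'" using SY by auto
    then show "card {D \<in> tets C. r \<subseteq> D} \<le> card {S, S'}" using card_tets_at_triangle[OF r] by simp
  qed (use S SY in auto)
  then have star: "star C r = {r, S, S'}" using star_triangle[OF r] by simp
  have "cell_union Y \<inter> cell_union (star C r) = cell_union (Y \<inter> star C r)"
    using Y(1) by (intro cell_union_Int[OF C]) (auto simp: upper_set_def star_def)
  also have "Y \<inter> star C r = {S'}" using star rY SY by auto
  finally have inter: "cell_union Y \<inter> cell_union (star C r) = rel_interior S'" by (simp add: cell_union_def)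
  have "S' \<noteq> {}" using SY Y(2) by auto
  then have "rel_interior S' \<noteq> {}" using rel_interior_eq_empty[OF sc_convex[OF C SC(2)]] by simp
  then have "pi1_rank_le (cell_union (Y \<union> star C r)) 0"
    using rank_add_star[OF C Y(1,3) r(1)] path_connected_rel_interior[OF C SC(2)] inter simplex_nonempty[OF r(2)]
    by simp
  moreover have "upper_set C (Y \<union> star C r)" by (rule upper_set_Un[OF Y(1) upper_set_star])
  moreover have "{} \<notin> Y \<union> star C r" using Y(2) simplex_nonempty[OF r(2)] by (auto simp: star_def)
  moreover have "glued (Suc i) \<subseteq> Y \<union> star C r" using next_step(2) Y(4) star by auto
  moreover have "(Y \<union> star C r) \<inter> tets C = tops (Suc i)"
  proof -
    have "\<not> 3 simplex r" using aff_dim_simplex[OF r(2)] aff_dim_simplex[of 3 r] by auto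
    then have "r \<notin> tets C" by (simp add: tets_def)
    then have "star C r \<inter> tets C = {S, S'}" using star S(1) SY(3) by auto
    then show ?thesis using Y(5) next_step(1) S(3) by (simp add: Int_Un_distrib2 insert_absorb)
  qed
  moreover have "\<forall>S\<in>Y \<union> star C r. 2 simplex S \<or> 3 simplex S"
    using Y(6) star r(2) S(1) SY(3) by (auto simp: tets_def)
  ultimately show ?case by blast
qed

context
  fixes K :: "'a set set"
  assumes K: "K \<subseteq> C" "\<And>e. e \<in> K \<Longrightarrow> 1 simplex e"
begin

definition knot_cells :: "'a set set" where
  "knot_cells = {S \<in> C. \<exists>e\<in>K. S \<subseteq> e}"

lemma simplex_in_knot:
  assumes "S \<in> knot_cells" "n simplex S"
  shows "n \<le> 1"
proof -
  obtain e where "e \<in> K" "S \<subseteq> e" using assms(1) by (auto simp: knot_cells_def)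
  then show ?thesis
    using aff_dim_subset[of S e] aff_dim_simplex[OF assms(2)] aff_dim_simplex[OF K(2)] by fastforce
qed

lemma star_knot: "c \<notin> knot_cells \<Longrightarrow> c \<in> C \<Longrightarrow> star C c \<inter> knot_cells = {}"
  unfolding knot_cells_def star_def by blast

text \<open>The number of closed knot edges is the account from which generators are paid: it never
  decreases, and a generator is spent only when it grows.\<close>

lemma identify_phase:
  assumes "M \<le> i" "i \<le> k"
  shows "\<exists>Y n. upper_set C Y \<and> {} \<notin> Y \<and> pi1_rank_le (cell_union Y) n \<and> glued i \<subseteq> Y \<and>
    tets C \<subseteq> Y \<and> Y \<inter> knot_cells = {} \<and> n \<le> card (closed_edges i \<inter> K)"
  using assms
proof (induction i rule: dec_induct)
  case base
  obtain Y where Y: "upper_set C Y" "{} \<notin> Y" "pi1_rank_le (cell_union Y) 0" "glued M \<subseteq> Y"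
    "Y \<inter> tets C = tops M" "\<forall>S\<in>Y. 2 simplex S \<or> 3 simplex S"
    using glue_phase[of M] M by auto
  have "tets C \<subseteq> Y" using Y(5) tops_all[of M] M by auto
  moreover have "Y \<inter> knot_cells = {}"
  proof -
    have "S \<notin> knot_cells" if "S \<in> Y" for S
      using Y(6) that simplex_in_knot[of S 2] simplex_in_knot[of S 3] by auto
    then show ?thesis by auto
  qed
  ultimately show ?case using Y(1-4) by (intro exI[of _ Y] exI[of _ 0]) simp
next
  case (step i)
  then obtain Y n where Y: "upper_set C Y" "{} \<notin> Y" "pi1_rank_le (cell_union Y) n" "glued i \<subseteq> Y"
    "tets C \<subseteq> Y" "Y \<inter> knot_cells = {}" "n \<le> card (closed_edges i \<inter> K)"
    by auto
  have i: "M \<le> i" "i < k" using step by simp_all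
  obtain t e where t: "t \<in> C" "2 simplex t" and e: "e \<in> C" "1 simplex e" "e \<subseteq> t"
    and gl: "glued (Suc i) \<subseteq> insert t (glued i)" and cl: "e \<notin> closed_edges i" "e \<in> closed_edges (Suc i)"
    and conn: "\<And>S S'. S \<in> tets C \<Longrightarrow> S' \<in> tets C \<Longrightarrow> e \<subseteq> S \<Longrightarrow> e \<subseteq> S' \<Longrightarrow> (S, S') \<in> (tet_adjacency C (glued i) e)\<^sup>*"
    using identify_data[OF i] by metis
  have fin: "finite (closed_edges (Suc i) \<inter> K)"
    using sc_finite[OF C] K(1) by (auto intro: finite_subset)
  have mono: "closed_edges i \<inter> K \<subseteq> closed_edges (Suc i) \<inter> K" using closed_edges_mono[OF i] by auto
  then have le: "card (closed_edges i \<inter> K) \<le> card (closed_edges (Suc i) \<inter> K)" by (rule card_mono[OF fin])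
  have new: "upper_set C (Y \<union> star C c)" "{} \<notin> Y \<union> star C c" "tets C \<subseteq> Y \<union> star C c"
    "(Y \<union> star C c) \<inter> knot_cells = {}" if "c \<in> C" "c \<noteq> {}" "c \<notin> knot_cells" for c
    using upper_set_Un[OF Y(1) upper_set_star] that Y(2,5,6) star_knot[of c] by (auto simp: star_def)
  show ?case
  proof (cases "t \<in> Y")
    case True
    \<comment> \<open>\<open>t\<close> may be present already, as part of a star that was added
      earlier.\<close>
    then show ?thesis using Y gl le by (intro exI[of _ Y] exI[of _ n]) auto
  next
    case tY: False
    have eY: "e \<notin> Y" using Y(1) t(1) e(3) tY unfolding upper_set_def by auto
    show ?thesis
    proof (cases "e \<in> K")
      case True
      have star: "Y \<inter> star C t = {S \<in> tets C. t \<subseteq> S}"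
        using star_triangle[OF t] tY Y(5) by auto
      let ?St = "{S \<in> tets C. t \<subseteq> S}"
      have fS: "finite ?St" by (rule finite_subset[OF _ sc_finite[OF C]]) (auto simp: tets_def)
      obtain A where A: "A \<in> tets C" "t \<subseteq> A" using pure[OF t(1)] by blast
      \<comment> \<open>\<open>B = A\<close> covers the case of a single tetrahedron at
        \<open>t\<close>; the two parts in \<open>pi1_rank_le_Un\<close> may coincide.\<close>
      obtain B where B: "?St = {A, B}"
      proof (cases "?St = {A}")
        case False
        then obtain B where B: "B \<in> ?St" "B \<noteq> A" using A by auto
        have "{A, B} = ?St"
          using A B card_tets_at_triangle[OF t] fS by (intro card_seteq) auto
        with that show ?thesis by metis
      qed (use that[of A] in simp)
      have AB: "A \<in> C" "B \<in> C" "A \<noteq> {}" using A B simplex_nonempty[OF t(2)] by (auto simp: tets_def)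
      have "cell_union Y \<inter> cell_union (star C t) = cell_union (Y \<inter> star C t)"
        using Y(1) by (intro cell_union_Int[OF C]) (auto simp: upper_set_def star_def)
      then have inter: "cell_union Y \<inter> cell_union (star C t) = rel_interior A \<union> rel_interior B"
        unfolding star B by (simp add: cell_union_def)
      have tK: "t \<notin> knot_cells" using simplex_in_knot[of t 2] t(2) by auto
      have t0: "t \<noteq> {}" using simplex_nonempty[OF t(2)] by simp
      have "openin (top_of_set (cell_union Y \<union> cell_union (star C t))) (cell_union Y)"
        "openin (top_of_set (cell_union Y \<union> cell_union (star C t))) (cell_union (star C t))"
        using openin_cell_union_gen[OF C Y(1) new(1)[OF t(1) t0 tK]]
          openin_cell_union_gen[OF C upper_set_star new(1)[OF t(1) t0 tK]]
        by (simp_all add: cell_union_Un)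
      from pi1_rank_le_Un[OF this Y(3) simply_connected_star[OF C t(1) t0] inter
          path_connected_rel_interior[OF C AB(1)] path_connected_rel_interior[OF C AB(2)]]
      have "pi1_rank_le (cell_union (Y \<union> star C t)) (if rel_interior B \<subseteq> rel_interior A then n else Suc n)"
        using AB(3) rel_interior_eq_empty[OF sc_convex[OF C AB(1)]] by (simp add: cell_union_Un)
      then have rank: "pi1_rank_le (cell_union (Y \<union> star C t)) (Suc n)"
        by (rule pi1_rank_le_mono) simp
      \<comment> \<open>This very step closes \<open>e\<close>, so the count grows and pays for the
        new generator.\<close>
      have "e \<in> closed_edges (Suc i) \<inter> K - closed_edges i \<inter> K" using cl True by simp
      then have "card (closed_edges i \<inter> K) < card (closed_edges (Suc i) \<inter> K)"
        using mono by (intro psubset_card_mono[OF fin]) blast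
      then have "Suc n \<le> card (closed_edges (Suc i) \<inter> K)" using Y(7) by simp
      moreover have "glued (Suc i) \<subseteq> Y \<union> star C t" using gl Y(4) t(1) by (auto simp: star_def)
      ultimately show ?thesis using new[OF t(1) t0 tK] rank by blast
    next
      case False
      have e0: "e \<noteq> {}" using simplex_nonempty[OF e(2)] by simp
      have eK: "e \<notin> knot_cells"
      proof
        assume "e \<in> knot_cells"
        then obtain e' where "e' \<in> K" "e \<subseteq> e'" by (auto simp: knot_cells_def)
        then have "e = e'" using sc_same_dim[OF C e(1) _ _ e(2)] K by blast
        with False \<open>e' \<in> K\<close> show False by simp
      qed
      \<comment> \<open>The tetrahedra around \<open>e\<close> are chained through triangles of
        \<open>glued i\<close>, all of which are in \<open>Y\<close>, so the star meets the region
        in a path-connected set.\<close>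
      have rank: "pi1_rank_le (cell_union (Y \<union> star C e)) n"
        using path_connected_Int_star[OF C Y(1) e(1) e0 pure Y(5) Y(4) conn]
        by (intro rank_add_star[OF C Y(1,3) e(1) e0])
      have "glued (Suc i) \<subseteq> Y \<union> star C e" using gl Y(4) t(1) e(3) by (auto simp: star_def)
      moreover have "n \<le> card (closed_edges (Suc i) \<inter> K)" using Y(7) le by simp
      ultimately show ?thesis using new[OF e(1) e0 eK] rank by blast
    qed
  qed
qed

text \<open>At the last stage the tetrahedra around every nonempty simplex are chained through glued
  triangles, so the stars can be added in any order without a new generator.\<close>

lemma final_phase:
  assumes Y: "upper_set C Y" "{} \<notin> Y" "pi1_rank_le (cell_union Y) n" "glued k \<subseteq> Y" "tets C \<subseteq> Y" "Y \<inter> knot_cells = {}"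
    and B: "finite B" "B \<subseteq> C - knot_cells - {{}}"
  shows "\<exists>Y. upper_set C Y \<and> {} \<notin> Y \<and> pi1_rank_le (cell_union Y) n \<and> glued k \<subseteq> Y \<and> tets C \<subseteq> Y \<and>
    Y \<inter> knot_cells = {} \<and> B \<subseteq> Y"
  using B
proof (induction B rule: finite_induct)
  case empty
  then show ?case using Y by blast
next
  case (insert c B)
  then obtain Y where Y: "upper_set C Y" "{} \<notin> Y" "pi1_rank_le (cell_union Y) n" "glued k \<subseteq> Y" "tets C \<subseteq> Y"
    "Y \<inter> knot_cells = {}" "B \<subseteq> Y"
    by auto
  have c: "c \<in> C" "c \<noteq> {}" "c \<notin> knot_cells" using insert.prems by auto
  have "pi1_rank_le (cell_union (Y \<union> star C c)) n"
    using path_connected_Int_star[OF C Y(1) c(1,2) pure Y(5) Y(4) connected_last[OF c(1,2)]]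
    by (intro rank_add_star[OF C Y(1,3) c(1,2)])
  moreover have "upper_set C (Y \<union> star C c)" by (rule upper_set_Un[OF Y(1) upper_set_star])
  moreover have "{} \<notin> Y \<union> star C c" using Y(2) c(2) by (auto simp: star_def)
  moreover have "(Y \<union> star C c) \<inter> knot_cells = {}" using Y(6) star_knot[OF c(3,1)] by auto
  moreover have "insert c B \<subseteq> Y \<union> star C c" using Y(7) c(1) by (auto simp: star_def)
  ultimately show ?case using Y(4,5) by (meson le_supI1)
qed

lemma pi1_rank_knot_complement: "pi1_rank_le (\<Union>C - \<Union>K) (card K)"
proof -
  obtain Y n where Y: "upper_set C Y" "{} \<notin> Y" "pi1_rank_le (cell_union Y) n" "glued k \<subseteq> Y" "tets C \<subseteq> Y"
    "Y \<inter> knot_cells = {}" and n: "n \<le> card (closed_edges k \<inter> K)"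
    using identify_phase[of k] M by auto
  have "finite (C - knot_cells - {{}})" using sc_finite[OF C] by simp
  then obtain Z where Z: "upper_set C Z" "{} \<notin> Z" "pi1_rank_le (cell_union Z) n" "Z \<inter> knot_cells = {}"
    "C - knot_cells - {{}} \<subseteq> Z"
    using final_phase[OF Y _ order_refl] by auto
  have "Z = C - knot_cells - {{}}" using Z by (auto simp: upper_set_def)
  moreover have "\<Union>C - \<Union>K = cell_union (C - knot_cells - {{}})"
  proof (rule equalityI; rule subsetI)
    fix x assume x: "x \<in> \<Union>C - \<Union>K"
    then obtain S where "x \<in> S" "S \<in> C" by blast
    then obtain S0 where S0: "S0 \<in> C" "x \<in> rel_interior S0" by (rule sc_carrier[OF C])
    have "x \<in> S0" using S0(2) rel_interior_subset by blast
    then have "S0 \<notin> knot_cells" using x by (auto simp: knot_cells_def)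
    moreover have "S0 \<noteq> {}" using \<open>x \<in> S0\<close> by blast
    ultimately show "x \<in> cell_union (C - knot_cells - {{}})" using S0 by (auto simp: cell_union_def)
  next
    fix x assume "x \<in> cell_union (C - knot_cells - {{}})"
    then obtain S where S: "S \<in> C" "S \<notin> knot_cells" "x \<in> rel_interior S" by (auto simp: cell_union_def)
    have "x \<in> S" using S(3) rel_interior_subset by blast
    moreover have "x \<notin> e" if e: "e \<in> K" for e
    proof
      assume "x \<in> e"
      then have "S \<subseteq> e" using sc_rel_interior_subset[OF C S(1) _ S(3)] e K(1) by blast
      then show False using S(1,2) e by (auto simp: knot_cells_def)
    qed
    ultimately show "x \<in> \<Union>C - \<Union>K" using S(1) by blast
  qed
  moreover have "card (closed_edges k \<inter> K) \<le> card K"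
    using finite_subset[OF K(1) sc_finite[OF C]] by (intro card_mono) auto
  ultimately show ?thesis using Z(3) n pi1_rank_le_mono by (metis le_trans)
qed

end

end

section \<open>From a local construction to the knot group\<close>

lemma LC_lc_sequence:
  assumes C: "simplicial_complex C" and LC: "LC 3 C"
  obtains T M k g h where "lc_sequence C T M k g h"
proof -
  obtain k T where "local_construction 3 C k T" using LC by (auto simp: LC_def)
  then have k: "1 \<le> k" "card (facets C) \<le> k"
    and T: "\<forall>i \<in> {1..k}. pseudomanifold 3 (T i)" and start: "is_simplex_complex 3 (T 1)"
    and glue: "\<forall>i. 1 \<le> i \<and> i < card (facets C) \<longrightarrow> glue_simplex_step 3 (T i) (T (Suc i))"
    and identify: "\<forall>i. card (facets C) \<le> i \<and> i < k \<longrightarrow> identify_step 3 (T i) (T (Suc i))"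
    and iso: "cellular_iso (T k) (cell_complex_of C)"
    by (simp_all add: local_construction_def Let_def)
  \<comment> \<open>The complexes are indexed from 1, so \<open>M\<close> has to be at least 1
    whatever the number of facets.\<close>
  define M where "M = max 1 (card (facets C))"
  have M: "1 \<le> M" "M \<le> k" using k by (simp_all add: M_def)
  obtain h where h: "homeomorphic_map (carrier_space (T k)) (carrier_space (cell_complex_of C)) h"
    "\<forall>n. ncells (cell_complex_of C) n = (\<lambda>c. h ` c) ` ncells (T k) n"
    using iso unfolding cellular_iso_def by (elim exE conjE)
  have "\<exists>g. (i < M \<longrightarrow> (\<exists>s D. gluing (T i) (T (Suc i)) s D g)) \<and>
      (M \<le> i \<longrightarrow> (\<exists>s t F \<phi>. identification (T i) (T (Suc i)) s t F \<phi> g))" if i: "1 \<le> i" "i < k" for i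
  proof -
    have PM: "pseudomanifold 3 (T i)" "pseudomanifold 3 (T (Suc i))" using T i by simp_all
    show ?thesis
    proof (cases "i < M")
      case True
      then have "glue_simplex_step 3 (T i) (T (Suc i))" using glue i by (simp add: M_def)
      then obtain s D j where "gluing (T i) (T (Suc i)) s D j" by (rule glue_simplex_step_gluing[OF PM])
      with True show ?thesis by auto
    next
      case False
      then have "identify_step 3 (T i) (T (Suc i))" using identify i by (simp add: M_def)
      then obtain s t F \<phi> q where "identification (T i) (T (Suc i)) s t F \<phi> q"
        by (rule identify_step_identification[OF PM])
      then have "\<exists>s t F \<phi>. identification (T i) (T (Suc i)) s t F \<phi> q" by (intro exI)
      with False show ?thesis by (intro exI[of _ q]) simp
    qed
  qed
  then obtain g where g: "\<And>i. 1 \<le> i \<Longrightarrow> i < k \<Longrightarrow> (i < M \<longrightarrow> (\<exists>s D. gluing (T i) (T (Suc i)) s D (g i))) \<and>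
      (M \<le> i \<longrightarrow> (\<exists>s t F \<phi>. identification (T i) (T (Suc i)) s t F \<phi> (g i)))"
    by metis
  have "lc_sequence C T M k g h"
  proof
    show "pseudomanifold 3 (T i)" if "1 \<le> i" "i \<le> k" for i using T that by simp
    show "\<exists>s D. gluing (T i) (T (Suc i)) s D (g i)" if "1 \<le> i" "i < M" for i
      using g[of i] that M by simp
    show "\<exists>s t F \<phi>. identification (T i) (T (Suc i)) s t F \<phi> (g i)" if "M \<le> i" "i < k" for i
      using g[of i] that M by simp
    show "homeomorphic_map (carrier_space (T k)) (top_of_set (\<Union>C)) h"
      using h(1) by (simp add: cell_complex_of_def)
    show "ncells (cell_complex_of C) n = (`) h ` ncells (T k) n" for n
      using h(2) by simp
  qed (fact C M start)+
  then show ?thesis by (rule that)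
qed

lemma knot_group_presentation:
  assumes C: "simplicial_complex C" and LC: "LC 3 C" and K: "gonal_knot C m K"
    and n: "m \<le> n" and x: "x \<in> \<Union>C - K"
  shows "has_presentation (fundamental_group (\<Union>C - K) x) n"
proof -
  obtain vs where vs: "polygon_in C m vs" "K = polygon_curve vs" using K by (auto simp: gonal_knot_def)
  let ?edge = "\<lambda>i. closed_segment (vs ! i) (vs ! (Suc i mod m))"
  define E where "E = ?edge ` {..<m}"
  have m: "3 \<le> m" "length vs = m" "distinct vs" "\<And>i. i < m \<Longrightarrow> ?edge i \<in> C"
    using vs(1) by (simp_all add: polygon_in_def)
  have KE: "K = \<Union>E" by (simp add: vs(2) polygon_curve_def E_def m(2))
  have "card E \<le> m" unfolding E_def using card_image_le[of "{..<m}" ?edge] by simp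
  have edges: "1 simplex e" if e: "e \<in> E" for e
  proof -
    obtain i where i: "i < m" "e = ?edge i" using e by (auto simp: E_def)
    have "Suc i mod m \<noteq> i"
      using i(1) m(1) by (cases "Suc i = m") auto
    moreover have "Suc i mod m < m" using m(1) by simp
    ultimately have "vs ! i \<noteq> vs ! (Suc i mod m)"
      using nth_eq_iff_index_eq[OF m(3)] i(1) m(2) by metis
    then show ?thesis unfolding i(2) by (rule one_simplex_segment)
  qed
  have "E \<subseteq> C" using m(4) by (auto simp: E_def)
  obtain T M k g h where "lc_sequence C T M k g h" by (rule LC_lc_sequence[OF C LC])
  then interpret lc_sequence C T M k g h .
  have "pi1_rank_le (\<Union>C - K) (card E)"
    unfolding KE by (rule pi1_rank_knot_complement[OF \<open>E \<subseteq> C\<close> edges])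
  then show ?thesis
    using le_trans[OF \<open>card E \<le> m\<close> n] x by (rule has_presentation_fundamental_group)
qed

theorem theorem2p13:
  fixes C :: "'a::euclidean_space set set"
  assumes "simplicial_3_sphere C"
  shows "((\<exists>K. gonal_knot C 3 K \<and> complicated 3 (\<Union>C) K) \<longrightarrow> \<not> LC 3 C) \<and>
         (\<forall>m. (\<exists>K. gonal_knot C m K \<and> at_least_complicated m (\<Union>C) K) \<longrightarrow> \<not> LC 3 C)"
proof -
  have C: "simplicial_complex C" using assms by (simp add: simplicial_3_sphere_def)
  \<comment> \<open>The first claim is the case \<open>m = n = 3\<close>. In general
    \<open>m\<close> generators, and hence \<open>n\<close> of them, suffice for the knot group,
    which contradicts the lower bound in \<open>complicated n\<close>.\<close>
  have "\<not> LC 3 C" if "gonal_knot C m K" "complicated n (\<Union>C) K" "m \<le> n" for m n K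
    using knot_group_presentation[OF C _ that(1,3)] that(2) unfolding complicated_def by blast
  then show ?thesis
    unfolding at_least_complicated_def by blast
qed

end
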